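(* Let $Q$ be a non-associative commutative Moufang loop with multiplication group $\mathfrak M$. Then the following conditions are equivalent: (1) $Q$ satisfies the maximum condition for subloops; (2) $\mathfrak M$ is finitely generated; (3) $\mathfrak M$ satisfies the maximum condition for subgroups; (4) every normal subgroup of $\mathfrak M$ is finitely generated; (5) at least one maximal abelian subgroup of $\mathfrak M$ is finitely generated. Moreover, for every positive integer $n$ such that $\mathfrak M$ contains a nilpotent subgroup of class $n$, (1) is equivalent to: (6) every nilpotent subgroup of $\mathfrak M$ of class $n$ is finitely generated; and for every positive integer $s$ such that $\mathfrak M$ contains a solvable subgroup of (derived length) class $s$, (1) is equivalent to: (7) every solvable subgroup of $\mathfrak M$ of class $s$ is finitely generated.
   Context: A commutative Moufang loop (CML) is a commutative loop $(Q,\cdot)$ with identity $1$ satisfying $x^2\cdot yz = xy\cdot xz$ for all $x,y,z$. For $x\in Q$ the translation $L(x)$ is the permutation $y\mapsto xy$ of $Q$; the multiplication group $\mathfrak M=\mathfrak M(Q)$ is the permutation group generated by all $L(x)$, $x\in Q$. A loop satisfies the maximum condition for subloops if every ascending chain of subloops stabilizes; similarly for subgroups of a group. *)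

theory Defs
  imports "HOL-Algebra.Algebra"
begin

definition loop :: "'a set \<Rightarrow> ('a \<Rightarrow> 'a \<Rightarrow> 'a) \<Rightarrow> 'a \<Rightarrow> bool" where
  "loop Q mul e \<longleftrightarrow>
     e \<in> Q \<and> (\<forall>x\<in>Q. \<forall>y\<in>Q. mul x y \<in> Q) \<and>
     (\<forall>x\<in>Q. mul e x = x \<and> mul x e = x) \<and>
     (\<forall>a\<in>Q. \<forall>b\<in>Q. \<exists>!x. x \<in> Q \<and> mul a x = b) \<and>
     (\<forall>a\<in>Q. \<forall>b\<in>Q. \<exists>!y. y \<in> Q \<and> mul y a = b)"

definition CML :: "'a set \<Rightarrow> ('a \<Rightarrow> 'a \<Rightarrow> 'a) \<Rightarrow> 'a \<Rightarrow> bool" where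
  "CML Q mul e \<longleftrightarrow> loop Q mul e \<and>
     (\<forall>x\<in>Q. \<forall>y\<in>Q. mul x y = mul y x) \<and>
     (\<forall>x\<in>Q. \<forall>y\<in>Q. \<forall>z\<in>Q. mul (mul x x) (mul y z) = mul (mul x y) (mul x z))"

definition associative_loop :: "'a set \<Rightarrow> ('a \<Rightarrow> 'a \<Rightarrow> 'a) \<Rightarrow> bool" where
  "associative_loop Q mul \<longleftrightarrow>
     (\<forall>x\<in>Q. \<forall>y\<in>Q. \<forall>z\<in>Q. mul (mul x y) z = mul x (mul y z))"

definition ldiv :: "'a set \<Rightarrow> ('a \<Rightarrow> 'a \<Rightarrow> 'a) \<Rightarrow> 'a \<Rightarrow> 'a \<Rightarrow> 'a" where
  "ldiv Q mul a b = (THE x. x \<in> Q \<and> mul a x = b)"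

definition rdiv :: "'a set \<Rightarrow> ('a \<Rightarrow> 'a \<Rightarrow> 'a) \<Rightarrow> 'a \<Rightarrow> 'a \<Rightarrow> 'a" where
  "rdiv Q mul b a = (THE y. y \<in> Q \<and> mul y a = b)"

definition subloop :: "'a set \<Rightarrow> 'a set \<Rightarrow> ('a \<Rightarrow> 'a \<Rightarrow> 'a) \<Rightarrow> 'a \<Rightarrow> bool" where
  "subloop S Q mul e \<longleftrightarrow> S \<subseteq> Q \<and> e \<in> S \<and>
     (\<forall>a\<in>S. \<forall>b\<in>S. mul a b \<in> S \<and> ldiv Q mul a b \<in> S \<and> rdiv Q mul b a \<in> S)"

definition loop_max_cond :: "'a set \<Rightarrow> ('a \<Rightarrow> 'a \<Rightarrow> 'a) \<Rightarrow> 'a \<Rightarrow> bool" where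
  "loop_max_cond Q mul e \<longleftrightarrow>
     (\<forall>f :: nat \<Rightarrow> 'a set. (\<forall>i. subloop (f i) Q mul e) \<and> (\<forall>i. f i \<subseteq> f (Suc i))
        \<longrightarrow> (\<exists>N. \<forall>m\<ge>N. f m = f N))"

definition Lt :: "'a set \<Rightarrow> ('a \<Rightarrow> 'a \<Rightarrow> 'a) \<Rightarrow> 'a \<Rightarrow> ('a \<Rightarrow> 'a)" where
  "Lt Q mul x = (\<lambda>y\<in>Q. mul x y)"

definition mult_group :: "'a set \<Rightarrow> ('a \<Rightarrow> 'a \<Rightarrow> 'a) \<Rightarrow> ('a \<Rightarrow> 'a) monoid" where
  "mult_group Q mul = subgroup_generated (BijGroup Q) (Lt Q mul ` Q)"

definition fin_gen :: "('a, 'b) monoid_scheme \<Rightarrow> 'a set \<Rightarrow> bool" where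
  "fin_gen G H \<longleftrightarrow> (\<exists>S. finite S \<and> S \<subseteq> H \<and> generate G S = H)"

definition group_max_cond :: "('a, 'b) monoid_scheme \<Rightarrow> bool" where
  "group_max_cond G \<longleftrightarrow>
     (\<forall>f :: nat \<Rightarrow> 'a set. (\<forall>i. subgroup (f i) G) \<and> (\<forall>i. f i \<subseteq> f (Suc i))
        \<longrightarrow> (\<exists>N. \<forall>m\<ge>N. f m = f N))"

definition abelian_sub :: "('a, 'b) monoid_scheme \<Rightarrow> 'a set \<Rightarrow> bool" where
  "abelian_sub G A \<longleftrightarrow> subgroup A G \<and> (\<forall>a\<in>A. \<forall>b\<in>A. a \<otimes>\<^bsub>G\<^esub> b = b \<otimes>\<^bsub>G\<^esub> a)"

definition maximal_abelian_sub :: "('a, 'b) monoid_scheme \<Rightarrow> 'a set \<Rightarrow> bool" where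
  "maximal_abelian_sub G A \<longleftrightarrow> abelian_sub G A \<and> (\<forall>B. abelian_sub G B \<and> A \<subseteq> B \<longrightarrow> B = A)"

definition commutator :: "('a, 'b) monoid_scheme \<Rightarrow> 'a \<Rightarrow> 'a \<Rightarrow> 'a" where
  "commutator G a b = inv\<^bsub>G\<^esub> a \<otimes>\<^bsub>G\<^esub> inv\<^bsub>G\<^esub> b \<otimes>\<^bsub>G\<^esub> a \<otimes>\<^bsub>G\<^esub> b"

text \<open>Lower central series of the subgroup H: lcs G H 0 = H = \<gamma>_1(H), lcs G H i = \<gamma>_{i+1}(H).\<close>
fun lcs :: "('a, 'b) monoid_scheme \<Rightarrow> 'a set \<Rightarrow> nat \<Rightarrow> 'a set" where
  "lcs G H 0 = H"
| "lcs G H (Suc i) = generate G (\<Union>a \<in> lcs G H i. \<Union>h \<in> H. {commutator G a h})"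

text \<open>H is nilpotent of class exactly n (n \<ge> 1): \<gamma>_{n+1}(H) = 1 and \<gamma>_n(H) \<noteq> 1.\<close>
definition nilpotent_class :: "('a, 'b) monoid_scheme \<Rightarrow> 'a set \<Rightarrow> nat \<Rightarrow> bool" where
  "nilpotent_class G H n \<longleftrightarrow> subgroup H G \<and>
     lcs G H n = {\<one>\<^bsub>G\<^esub>} \<and> lcs G H (n - 1) \<noteq> {\<one>\<^bsub>G\<^esub>}"

text \<open>H is solvable of derived length exactly s (s \<ge> 1).\<close>
definition solvable_class :: "('a, 'b) monoid_scheme \<Rightarrow> 'a set \<Rightarrow> nat \<Rightarrow> bool" where
  "solvable_class G H s \<longleftrightarrow> subgroup H G \<and>
     (derived G ^^ s) H = {\<one>\<^bsub>G\<^esub>} \<and> (derived G ^^ (s - 1)) H \<noteq> {\<one>\<^bsub>G\<^esub>}"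

end

theory Submission
  imports Defs
begin

text \<open>Finitely generated commutative Moufang loops are centrally nilpotent (Bruck and Slaby): modulo its
centre such a loop has exponent 3, and there one adjoins the generators one at a time. If \<open>z\<close> is
central in a finite subloop \<open>H\<close>, then in the loop generated by \<open>H\<close> and \<open>y\<close> the orbit of \<open>z\<close> under
the inner mappings generates an abelian normal subloop, which an induction on the order of \<open>H\<close> and
a fixed point argument place inside the upper central series.

Hence finitely many translations generate a nilpotent group, whose subgroups are finitely generated,
and the derived group of the multiplication group is a locally finite 3-group. The bridge back is the
following: if some finitely generated subgroup has a finitely generated abelian centralizer, then the
multiplication group is finitely generated. Indeed the products of a translation with the inversion
\<open>J\<close> commute with elements of the derived group up to elements of order 3, so the argument of Alperin
on maximal elementary abelian normal subgroups bounds the order of the derived group by the order of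
the fixed points of the given subgroup. For conditions (5)-(7) one applies this to a subgroup joined
with a maximal abelian subgroup of its centralizer, which changes neither nilpotency class nor
derived length.\<close>

section \<open>Commutative Moufang loops\<close>

text \<open>The loop part rests on a self-adjointness relation. In exponent 3 the associator changes
  to its inverse under transpositions, and suitable inner mappings can be moved from one of its
  arguments to another. This is what carries associativity with \<open>z\<close> from the elements
  of \<open>H\<close> to all elements, although nothing is assumed about how the new generator
  \<open>y\<close> associates. The obstacle in the group part is that the given subgroup controls
  only finitely many translations, while the derived group involves all of them. So every bound has
  to depend on that subgroup alone: it is proved for the finite pieces of the derived group inside
  groups generated by more and more translations, and finiteness follows from uniformity.
  Involutions enter for the sake of their commutators: a conjugate of \<open>Lp h + Jp\<close> by a
  derived element is \<open>Lp h' + Jp\<close> with \<open>h\<close> and \<open>h'\<close> of equal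
  cube, and the product of the two is \<open>Lp h + - Lp h'\<close>, whose cube can be computed. The
  price is that all subgroups chosen must be invariant under the inversion; since 2 is invertible
  modulo 3, splitting an element into its two eigenparts pays it.\<close>

text \<open>The loop operations are total on the type: the carrier is the set of all \<open>x\<close> with \<open>e \<cdot> x = x\<close>, and
\<open>x \<mapsto> e \<cdot> x\<close> retracts the whole type onto it. All laws then hold without membership premises, and
restrictions and quotients are again structures of the same kind on the same type.\<close>
locale cml =
  fixes mul :: "'a \<Rightarrow> 'a \<Rightarrow> 'a" (infixl "\<cdot>" 70) and iv :: "'a \<Rightarrow> 'a" and e :: 'a
  assumes comm: "x \<cdot> y = y \<cdot> x"
    and moufang_sq: "(x \<cdot> x) \<cdot> (y \<cdot> z) = (x \<cdot> y) \<cdot> (x \<cdot> z)"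
    and left_inv: "iv x \<cdot> (x \<cdot> y) = e \<cdot> y"
    and e_mul: "e \<cdot> (x \<cdot> y) = x \<cdot> y"
    and mul_e: "(e \<cdot> x) \<cdot> y = x \<cdot> y"
    and iv_e: "iv (e \<cdot> x) = iv x"
    and e_iv: "e \<cdot> iv x = iv x"
    and e_e: "e \<cdot> e = e"
begin

section \<open>Inner mappings and associators\<close>

definition T :: "'a \<Rightarrow> 'a \<Rightarrow> 'a \<Rightarrow> 'a" where
  "T a b u = iv (a \<cdot> b) \<cdot> (a \<cdot> (b \<cdot> u))"

lemma mul_e2: "x \<cdot> (e \<cdot> y) = x \<cdot> y" by (metis comm mul_e)

lemma mul_e3: "x \<cdot> e = e \<cdot> x" by (rule comm)

lemma iv_iv: "iv (iv x) = e \<cdot> x" by (metis comm e_mul left_inv e_iv e_e mul_e)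

lemma left_inv': "x \<cdot> (iv x \<cdot> y) = e \<cdot> y" by (metis iv_iv left_inv mul_e)

lemma inv_l: "iv x \<cdot> x = e" by (metis comm e_e left_inv mul_e2)

lemma inv_r: "x \<cdot> iv x = e" by (metis comm inv_l)

lemma iv_ee: "iv e = e" by (metis e_iv inv_l comm)

lemma cancel: "x \<cdot> y = x \<cdot> z \<longleftrightarrow> e \<cdot> y = e \<cdot> z" by (metis left_inv mul_e2)

lemma lalt: "x \<cdot> (x \<cdot> y) = (x \<cdot> x) \<cdot> y" by (metis comm e_mul moufang_sq mul_e2)

lemma iv_mul: "iv (x \<cdot> y) = iv x \<cdot> iv y" by (metis comm iv_iv left_inv mul_e2)

lemma moufang_sq_nest: "(x \<cdot> y) \<cdot> (x \<cdot> z) = x \<cdot> (x \<cdot> (y \<cdot> z))" by (metis lalt moufang_sq)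

lemma assoc_nest: "(x \<cdot> y) \<cdot> z = x \<cdot> (x \<cdot> (y \<cdot> (iv x \<cdot> z)))"
  by (metis moufang_sq_nest left_inv' mul_e2)

lemma moufang: "x \<cdot> (y \<cdot> (x \<cdot> u)) = ((x \<cdot> x) \<cdot> y) \<cdot> u"
proof -
  have "y \<cdot> (x \<cdot> (y \<cdot> z)) = x \<cdot> (x \<cdot> (y \<cdot> (y \<cdot> (iv x \<cdot> z))))" for x y z
    by (metis moufang_sq_nest assoc_nest comm)
  then have "(y \<cdot> (x \<cdot> x)) \<cdot> u = x \<cdot> (y \<cdot> (x \<cdot> u))"
    by (metis assoc_nest lalt)
  then show ?thesis by (simp add: comm)
qed

lemma T_e [simp]: "T a b e = e" by (simp add: T_def comm[of b e] mul_e2 inv_l)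

lemma e_T [simp]: "e \<cdot> T a b u = T a b u" by (simp add: T_def e_mul)

text \<open>Applying \<open>moufang_sq_nest\<close> to each of the three translations shows that
  \<open>T a b u \<cdot> T a b v\<close> depends only on \<open>u \<cdot> v\<close>; the choice
  \<open>v = e\<close> identifies this function of the product as \<open>T a b\<close>. That inner
  mappings respect products underlies nearly all computations below.\<close>

lemma T_mul: "T a b (u \<cdot> v) = T a b u \<cdot> T a b v"
proof -
  let ?g = "\<lambda>w. iv (a \<cdot> b) \<cdot> (iv (a \<cdot> b) \<cdot> (a \<cdot> (a \<cdot> (b \<cdot> (b \<cdot> w)))))"
  have g: "T a b u \<cdot> T a b v = ?g (u \<cdot> v)" for u v
    by (simp add: T_def moufang_sq_nest)
  have "T a b w = ?g w" for w
  proof -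
    have "T a b w \<cdot> e = T a b w" by (metis comm e_T)
    moreover have "b \<cdot> (w \<cdot> e) = b \<cdot> w" by (metis comm mul_e2)
    ultimately show ?thesis using g[of w e] by simp
  qed
  thus ?thesis using g by simp
qed

lemma T_ee: "T a b (e \<cdot> u) = T a b u" by (simp add: T_mul)

lemma inv_uniq: "x \<cdot> y = e \<Longrightarrow> e \<cdot> x = iv y"
  by (metis comm e_iv left_inv mul_e mul_e3)

lemma T_iv: "T a b (iv u) = iv (T a b u)"
  using inv_uniq[of "T a b (iv u)" "T a b u"] by (simp flip: T_mul add: inv_l)

lemma T_fst: "T a b a = e \<cdot> a" unfolding T_def by (metis comm lalt left_inv mul_e2)

lemma T_snd: "T a b b = e \<cdot> b" unfolding T_def by (metis comm lalt left_inv mul_e2)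

lemma T_mulL: "a \<cdot> (b \<cdot> u) = (a \<cdot> b) \<cdot> T a b u" by (simp add: T_def left_inv' e_mul)

lemma T_eqI: "a \<cdot> (b \<cdot> u) = (a \<cdot> b) \<cdot> w \<Longrightarrow> T a b u = e \<cdot> w" by (simp add: T_def left_inv)

text \<open>Combine the defining law, which distributes a square over a product, with
  \<open>moufang\<close>. Cubes are thus nuclear, which is why the quotient by the centre has
  exponent 3.\<close>

lemma cube: "(x \<cdot> (x \<cdot> x)) \<cdot> (u \<cdot> v) = ((x \<cdot> (x \<cdot> x)) \<cdot> u) \<cdot> v"  by (metis lalt moufang_sq moufang)

text \<open>\<open>T a b\<close> is the inner mapping of \<open>a\<close> and \<open>b\<close>, and \<open>D x a b\<close> is the associator of \<open>a\<close>, \<open>b\<close>, \<open>x\<close>.\<close>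
definition D :: "'a \<Rightarrow> 'a \<Rightarrow> 'a \<Rightarrow> 'a" where
  "D x a b = iv x \<cdot> T a b x"

lemma T_D: "T a b x = x \<cdot> D x a b" by (simp add: D_def left_inv')

lemma e_D [simp]: "e \<cdot> D x a b = D x a b" by (simp add: D_def e_mul)

lemma D_uniq: "T a b x = x \<cdot> n \<Longrightarrow> D x a b = e \<cdot> n" by (simp add: D_def left_inv)

inductive_set gen :: "'a set \<Rightarrow> 'a set" for G where
  gen_e: "e \<in> gen G"
| gen_in: "g \<in> G \<Longrightarrow> e \<cdot> g \<in> gen G"
| gen_iv: "x \<in> gen G \<Longrightarrow> iv x \<in> gen G"
| gen_mul: "x \<in> gen G \<Longrightarrow> y \<in> gen G \<Longrightarrow> x \<cdot> y \<in> gen G"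

lemma gen_el: "x \<in> gen G \<Longrightarrow> e \<cdot> x = x"
  by (induction rule: gen.induct) (simp_all add: e_e e_mul e_iv)

lemma gen_mono: "G \<subseteq> gen K \<Longrightarrow> gen G \<subseteq> gen K"
proof
  fix x assume "G \<subseteq> gen K" "x \<in> gen G"
  show "x \<in> gen K" using \<open>x \<in> gen G\<close>
    by (induction rule: gen.induct) (use \<open>G \<subseteq> gen K\<close> in \<open>auto intro: gen_e gen_iv gen_mul\<close>)
qed

lemma T_el: "T (e \<cdot> a) b u = T a b u" "T a (e \<cdot> b) u = T a b u" by (simp_all add: T_def mul_e mul_e2)
end

section \<open>Exponent 3: symmetries of the associator\<close>

locale cml3 = cml +
  assumes exp3: "x \<cdot> x = iv x"
begin
lemma exp3_l: "x \<cdot> (x \<cdot> y) = iv x \<cdot> y" by (simp add: lalt exp3)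

lemma exp3_l': "x \<cdot> (y \<cdot> x) = iv x \<cdot> y" by (metis comm exp3_l)

lemma moufang_sq_nest3: "(x \<cdot> y) \<cdot> (x \<cdot> z) = iv x \<cdot> (y \<cdot> z)" by (simp add: moufang_sq_nest exp3_l)

lemma moufang3: "x \<cdot> (y \<cdot> (x \<cdot> u)) = (iv x \<cdot> y) \<cdot> u" by (simp add: moufang exp3)

lemma mul_inv_mul: "(x \<cdot> y) \<cdot> (iv x \<cdot> z) = iv x \<cdot> (y \<cdot> (x \<cdot> z))"
  by (metis moufang_sq_nest3 exp3_l)

lemma T_T: "T a b (T b a u) = e \<cdot> u"
proof -
  have "a \<cdot> (b \<cdot> (iv (a \<cdot> b) \<cdot> (b \<cdot> (a \<cdot> u)))) = a \<cdot> ((iv b \<cdot> iv (a \<cdot> b)) \<cdot> (a \<cdot> u))"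
    by (simp add: moufang3)
  also have "iv b \<cdot> iv (a \<cdot> b) = b \<cdot> iv a"
    by (metis iv_mul exp3_l' iv_iv mul_e)
  also have "a \<cdot> ((b \<cdot> iv a) \<cdot> (a \<cdot> u)) = a \<cdot> (iv a \<cdot> (u \<cdot> (a \<cdot> b)))"
    by (metis mul_inv_mul comm)
  also have "\<dots> = u \<cdot> (a \<cdot> b)" by (simp add: left_inv' e_mul)
  finally show ?thesis by (metis T_def comm left_inv)
qed

lemma T_mul_arg: "T b (c \<cdot> b) u = T b c u"
proof -
  have "T b (c \<cdot> b) (T c b u) = e \<cdot> u" for u
  proof (rule T_eqI)
    have "b \<cdot> ((c \<cdot> b) \<cdot> T c b u) = b \<cdot> (c \<cdot> (b \<cdot> u))" by (simp add: T_mulL)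
    also have "\<dots> = (b \<cdot> (c \<cdot> b)) \<cdot> u" by (simp add: moufang3 exp3_l')
    finally show "b \<cdot> ((c \<cdot> b) \<cdot> T c b u) = (b \<cdot> (c \<cdot> b)) \<cdot> u" .
  qed
  from this[of "T b c u"] show ?thesis by (simp add: T_T T_ee)
qed

lemma T_iv1: "T (iv b) a u = T a b u"
proof -
  have "T (iv b) (b \<cdot> a) (T b a u) = e \<cdot> u" for u
  proof (rule T_eqI)
    show "iv b \<cdot> ((b \<cdot> a) \<cdot> T b a u) = (iv b \<cdot> (b \<cdot> a)) \<cdot> u"
      by (metis T_mulL left_inv mul_e e_mul)
  qed
  then have "T (iv b) (b \<cdot> a) u = T a b u" by (metis T_T T_ee e_T)
  moreover have "T (iv b) a u = T (iv b) (b \<cdot> a) u"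
    by (metis T_mul_arg T_def comm left_inv mul_e mul_e2)
  ultimately show ?thesis by simp
qed

lemma T_iv2: "T a (iv b) u = T b a u" by (metis T_T T_iv1 T_ee e_T)

text \<open>This solves \<open>(b \<cdot> Y) \<cdot> (c \<cdot> W) = b \<cdot> c\<close> for
  \<open>W\<close>: a disturbance of one factor is compensated in the other by an inner mapping. It
  yields the symmetry of the associator and later the correction terms in
  \<open>polarization\<close>.\<close>

lemma mul_T_inv: "(b \<cdot> Y) \<cdot> (c \<cdot> T b c (iv Y)) = b \<cdot> c"
proof -
  let ?u = "c \<cdot> iv Y"
  have "b \<cdot> (c \<cdot> (iv (b \<cdot> c) \<cdot> ?u)) = (b \<cdot> c) \<cdot> T b c (iv (b \<cdot> c) \<cdot> ?u)"
    by (rule T_mulL)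
  also have "\<dots> = T b c ?u"
    by (simp add: T_mul T_iv T_fst T_snd mul_e mul_e2 left_inv' e_mul)
  also have "\<dots> = c \<cdot> T b c (iv Y)" by (simp add: T_mul T_snd mul_e)
  finally have "c \<cdot> T b c (iv Y) = b \<cdot> (c \<cdot> (iv (b \<cdot> c) \<cdot> (c \<cdot> iv Y)))" by simp
  also have "\<dots> = b \<cdot> ((iv c \<cdot> iv (b \<cdot> c)) \<cdot> iv Y)" by (simp add: moufang3)
  also have "iv c \<cdot> iv (b \<cdot> c) = c \<cdot> iv b"
    by (metis iv_mul exp3_l' iv_iv mul_e)
  finally have "(b \<cdot> Y) \<cdot> (c \<cdot> T b c (iv Y)) = iv b \<cdot> (Y \<cdot> (iv Y \<cdot> (c \<cdot> iv b)))"
    by (metis moufang_sq_nest3 comm)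
  also have "\<dots> = b \<cdot> c" by (metis left_inv' e_mul exp3_l' iv_iv mul_e)
  finally show ?thesis .
qed

lemma T_sym: "c \<cdot> T b c y = y \<cdot> T y b c"
proof -
  let ?Y = "iv y"
  have "c \<cdot> T b c y = iv (b \<cdot> iv y) \<cdot> (b \<cdot> c)"
    using mul_T_inv[of b "iv y" c] by (metis T_ee e_mul iv_iv left_inv)
  also have "b \<cdot> c = (b \<cdot> iv y) \<cdot> T b (iv y) (y \<cdot> c)"
    by (metis T_mulL left_inv mul_e2)
  finally show ?thesis by (simp add: left_inv T_iv2 T_mul T_fst e_mul mul_e)
qed

lemma T_sym': "T b c y = iv c \<cdot> (y \<cdot> T y b c)"
  by (metis T_sym left_inv e_T)

lemma T_shift: "T (b \<cdot> y) c y = T b c y"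
  by (metis T_sym' T_mul_arg)

lemma T_conj_aux: "(iv y \<cdot> c) \<cdot> T c b y = T b y c"
proof -
  let ?U = "iv y \<cdot> c"
  have "?U \<cdot> T ?U b y = T ?U b (?U \<cdot> y)" by (simp add: T_mul T_fst mul_e)
  moreover have "?U \<cdot> y = e \<cdot> c" by (metis comm left_inv')
  moreover have "T ?U b c = T b y c" by (simp add: T_shift T_iv1)
  moreover have "T ?U b y = T c b y" by (metis T_shift comm exp3_l)
  ultimately show ?thesis by (simp add: T_ee)
qed

lemma T_fix: "T c y (T b c y) = T b c y"
proof -
  have "T c y (T b c y) = T (iv y) c (T b c y)" by (simp add: T_iv1)
  also have "\<dots> = iv (iv y \<cdot> c) \<cdot> (iv y \<cdot> (c \<cdot> T b c y))" by (rule T_def)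
  also have "iv y \<cdot> (c \<cdot> T b c y) = T y b c" by (metis T_sym left_inv e_T)
  also have "iv (iv y \<cdot> c) \<cdot> T y b c = (iv c \<cdot> y) \<cdot> T y b c"
    by (simp add: iv_mul iv_iv mul_e mul_e2 comm)
  also have "\<dots> = T b c y" by (rule T_conj_aux)
  finally show ?thesis .
qed

text \<open>Written additively for \<open>t = T x y\<close>, this is t + t^-1 = -1. Geometrically,
  an element and its images under \<open>t\<close> and its inverse form a line of the Hall triple
  system. \<open>T_cube\<close> draws the consequence that the square of \<open>t\<close> is its
  inverse.\<close>

lemma T_exp: "T x y u \<cdot> T y x u = iv u"
proof -
  have "iv (T x y u) = u \<cdot> T y x u"
  proof -
    let ?U = "u \<cdot> x"
    have "u \<cdot> T y x u = u \<cdot> (iv x \<cdot> (u \<cdot> T u y x))" by (metis T_sym')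
    also have "\<dots> = iv ?U \<cdot> T u y x" by (simp add: moufang3 iv_mul)
    also have "T u y x = T ?U y x" by (simp add: T_shift)
    also have "iv ?U \<cdot> T ?U y x = T ?U y (iv ?U \<cdot> x)"
      by (simp add: T_mul T_fst T_iv mul_e iv_e e_mul)
    also have "iv ?U \<cdot> x = iv u" by (metis comm iv_mul left_inv' e_iv mul_e2)
    also have "T ?U y (iv u) = iv (T x y u)" by (metis T_iv T_shift comm)
    finally show ?thesis by simp
  qed
  thus ?thesis by (metis comm e_iv e_mul iv_iv iv_mul left_inv left_inv' mul_e2)
qed

lemma T_conj: "T c d (T a b u) = T (T c d a) (T c d b) (T c d u)"
  unfolding T_def[of a b u] T_def[of "T c d a"] by (simp add: T_mul T_iv)

lemma T_cancel: "T a b u = T a b v \<Longrightarrow> e \<cdot> u = e \<cdot> v"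
  by (metis T_T)

lemma T_swap_iff: "T a b u = e \<cdot> u \<longleftrightarrow> T b a u = e \<cdot> u"
  by (metis T_T T_ee e_T)

lemma T_cube: "T a b (T a b u) = T b a u"
proof -
  have "T a b (T a b u) \<cdot> T a b (T b a u) = T a b (T a b u \<cdot> T b a u)" by (simp only: T_mul)
  then have "T a b (T a b u) \<cdot> u = iv (T a b u)"
    by (simp only: T_T T_exp T_iv mul_e2)
  moreover have "T b a u \<cdot> u = iv (T a b u)"
  proof -
    have "T a b u \<cdot> T b a u = iv u" by (rule T_exp)
    then have "T b a u = iv (T a b u) \<cdot> iv u" by (metis left_inv e_T)
    then show ?thesis by (metis comm left_inv' e_iv iv_iv mul_e2 left_inv)
  qed
  ultimately show ?thesis by (metis cancel comm e_T)
qed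

lemma D_eq_e: "D x a b = e \<longleftrightarrow> T a b x = e \<cdot> x"
  by (metis D_def T_D comm inv_l mul_e2 mul_e3)

lemma T_fix': "T c y (T c b y) = T c b y"
proof -
  have "T y c (T c b y) = T c b y" using T_fix[of "iv c" y b] by (simp add: T_iv1 T_iv2)
  then show ?thesis by (metis T_swap_iff e_T)
qed

lemma T_fix_D: "T c y (D y b c) = D y b c" "T c y (D y c b) = D y c b"
  by (simp_all add: D_def T_mul T_iv T_snd T_fix T_fix' iv_e)

lemma D_anti: "D x b a = iv (D x a b)"
proof -
  have "T a b x \<cdot> T b a x = iv x" by (rule T_exp)
  then have "T b a x = iv (x \<cdot> D x a b) \<cdot> iv x" by (metis T_D e_T left_inv)
  also have "\<dots> = iv x \<cdot> (iv x \<cdot> iv (D x a b))" by (metis comm iv_mul)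
  also have "\<dots> = x \<cdot> iv (D x a b)" by (simp add: exp3_l iv_iv mul_e)
  finally show ?thesis by (metis D_uniq e_iv)
qed

text \<open>Both sides of \<open>T_sym\<close> are \<open>c \<cdot> y\<close> times an associator,
  since \<open>T_fix_D\<close> removes the inner mapping that \<open>T_mulL\<close> introduces.
  Together with \<open>D_anti\<close> this governs all permutations of the arguments.\<close>

lemma D_cyc: "D y b c = D c y b"
proof -
  have "c \<cdot> T b c y = (c \<cdot> y) \<cdot> D y b c"
    by (simp only: T_D[of b c y] T_mulL[of c y "D y b c"] T_fix_D)
  moreover have "y \<cdot> T y b c = (y \<cdot> c) \<cdot> D c y b"
    by (simp only: T_D[of y b c] T_mulL[of y c "D c y b"] T_fix_D)
  ultimately show ?thesis by (metis T_sym cancel comm e_D)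
qed

lemma D_swap: "D x z y = iv (D y z x)"
  by (subst D_cyc) (rule D_anti)

text \<open>The third argument ranges over the whole loop, so pairwise \<open>C\<close> on a subset
  is stronger than associativity inside it: inner mappings formed with two of its elements are
  trivial everywhere.\<close>

definition C :: "'a \<Rightarrow> 'a \<Rightarrow> bool" where "C z q \<longleftrightarrow> (\<forall>w. T z q w = e \<cdot> w)"

lemma T_perm: assumes "T a b u = e \<cdot> u"
  shows "T b a u = e \<cdot> u" "T u a b = e \<cdot> b" "T a u b = e \<cdot> b" "T b u a = e \<cdot> a" "T u b a = e \<cdot> a"
proof -
  have 1: "D u a b = e" using assms by (simp add: D_eq_e)
  have "D b u a = e" "D a b u = e" using 1 D_cyc by metis+
  then show "T u a b = e \<cdot> b" "T b u a = e \<cdot> a" by (simp_all add: D_eq_e)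
  then show "T b a u = e \<cdot> u" "T a u b = e \<cdot> b" "T u b a = e \<cdot> a"
    using assms T_swap_iff by metis+
qed

text \<open>In Hall triple systems, two points that are joined crosswise by the same pair of lines coincide.\<close>
lemma collapse: assumes "y \<cdot> z = y' \<cdot> z'" "y \<cdot> z' = y' \<cdot> z" shows "e \<cdot> y = e \<cdot> y'"
proof -
  have "iv y \<cdot> (z \<cdot> z') = iv y' \<cdot> (z \<cdot> z')"
    using moufang_sq_nest3[of y z z'] moufang_sq_nest3[of y' z' z] assms by (simp add: comm[of z z'])
  then show ?thesis by (metis cancel comm iv_iv iv_e)
qed

lemma T_product: "D (a \<cdot> b) u v = iv (a \<cdot> b) \<cdot> (T u v a \<cdot> T u v b)"
  by (simp add: D_def T_mul)

lemma D_iv: "D (iv c) u v = iv (D c u v)"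
  by (simp only: D_def T_iv iv_mul)

lemma D_iv2: "D b z (iv x) = iv (D b z x)"
  by (metis D_anti D_def T_iv2)

lemma iv_inj: "iv x = iv y \<Longrightarrow> e \<cdot> x = e \<cdot> y"
  by (metis iv_iv)

lemma D_fixed_factor: assumes "T z u b = e \<cdot> b" shows "D (a \<cdot> b) z u = T b a (D a z u)"
proof -
  have "D (a \<cdot> b) z u = iv (a \<cdot> b) \<cdot> (T z u a \<cdot> T z u b)" by (rule T_product)
  also have "\<dots> = iv (a \<cdot> b) \<cdot> ((a \<cdot> D a z u) \<cdot> b)" by (simp only: assms T_D[of z u a] mul_e2)
  also have "\<dots> = iv (b \<cdot> a) \<cdot> (b \<cdot> (a \<cdot> D a z u))" by (simp only: comm[of "a \<cdot> D a z u"] comm[of a b])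
  finally show ?thesis by (simp only: T_def)
qed

section \<open>Self-adjointness of inner mappings with respect to the associator\<close>

context
  fixes p z
  assumes p_mul: "\<And>u v. p (u \<cdot> v) = p u \<cdot> p v" and p_iv: "\<And>u. p (iv u) = iv (p u)"
    and e_p: "\<And>u. e \<cdot> p u = p u"
    and p_assoc: "\<And>u. T z u (p u) = p u"
begin

lemma p_assoc': "T z (p u) u = e \<cdot> u"
  using T_perm(3)[of z u "p u"] p_assoc e_p by simp

text \<open>Linearizes \<open>p_assoc\<close> at \<open>a \<cdot> b\<close>. For a trilinear
  associator the result would be \<open>iv (D a z (p b)) = D b z (p a)\<close>; the three inner
  mappings record the failure of linearity, and \<open>mul_T_inv\<close> is what solves the equation
  obtained.\<close>

lemma polarization: "iv (D a z (p b)) = T a b (T (p a) (p b) (T a b (D b z (p a))))"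
proof -
  define t where "t = D b z (p a)"
  define s where "s = D a z (p b)"
  have 1: "D (a \<cdot> b) z (p a) = T a b t"
  proof -
    have "D (a \<cdot> b) z (p a) = iv (a \<cdot> b) \<cdot> (T z (p a) a \<cdot> T z (p a) b)" by (rule T_product)
    also have "\<dots> = iv (a \<cdot> b) \<cdot> (a \<cdot> (b \<cdot> t))" by (simp only: p_assoc' T_D[of z "p a" b] t_def mul_e)
    finally show ?thesis by (simp only: T_def)
  qed
  have 2: "D (a \<cdot> b) z (p b) = T b a s"
  proof -
    have "D (a \<cdot> b) z (p b) = iv (a \<cdot> b) \<cdot> (T z (p b) a \<cdot> T z (p b) b)" by (rule T_product)
    also have "\<dots> = iv (a \<cdot> b) \<cdot> ((a \<cdot> s) \<cdot> b)" by (simp only: p_assoc' T_D[of z "p b" a] s_def mul_e2)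
    also have "\<dots> = iv (b \<cdot> a) \<cdot> (b \<cdot> (a \<cdot> s))" by (simp only: comm[of "a \<cdot> s"] comm[of a b])
    finally show ?thesis by (simp only: T_def)
  qed
  have 3: "D (p a) z (a \<cdot> b) = iv (T a b t)" by (subst D_swap) (simp only: 1)
  have 4: "D (p b) z (a \<cdot> b) = iv (T b a s)" by (subst D_swap) (simp only: 2)
  have "T z (a \<cdot> b) (p a) \<cdot> T z (a \<cdot> b) (p b) = p a \<cdot> p b"
    using p_assoc[of "a \<cdot> b"] by (simp only: T_mul p_mul)
  then have A: "(p a \<cdot> iv (T a b t)) \<cdot> (p b \<cdot> iv (T b a s)) = p a \<cdot> p b"
    by (simp only: T_D[of z "a \<cdot> b"] 3 4)
  have B: "(p a \<cdot> iv (T a b t)) \<cdot> (p b \<cdot> T (p a) (p b) (T a b t)) = p a \<cdot> p b"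
    using mul_T_inv[of "p a" "iv (T a b t)" "p b"] by (simp only: iv_iv e_T)
  have "p b \<cdot> iv (T b a s) = p b \<cdot> T (p a) (p b) (T a b t)"
    by (rule cancel[THEN iffD1, OF trans[OF A B[symmetric]], unfolded e_mul])
  then have "e \<cdot> iv (T b a s) = e \<cdot> T (p a) (p b) (T a b t)"
    by (rule cancel[THEN iffD1])
  then have "T a b (iv (T b a s)) = T a b (T (p a) (p b) (T a b t))" by (simp only: e_iv e_T)
  then have "iv s = T a b (T (p a) (p b) (T a b t))" by (simp only: T_iv T_T iv_e)
  then show ?thesis by (simp only: s_def t_def)
qed

lemma polarization': "iv (D b z (p c)) = T c b (T (p c) (p b) (T c b (D c z (p b))))"
proof -
  have "iv (iv (D b z (p c))) = iv (T c b (T (p c) (p b) (T c b (D c z (p b)))))"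
    using polarization[of b "iv c"] by (simp only: p_iv D_iv D_iv2 T_iv2 T_iv)
  then show ?thesis by (metis iv_inj e_iv e_T)
qed

text \<open>\<open>polarization\<close> and \<open>polarization'\<close> express the same element.
  Comparing them at the pair \<open>b\<close>, \<open>c \<cdot> b\<close> gives new information,
  because \<open>T_mul_arg\<close> brings their inner mappings back to those of \<open>b\<close> and
  \<open>c\<close>.\<close>

lemma adjoint_aux: "T (p b) (p c) (T c b (D c z (p b))) = T b c (T (p c) (p b) (D c z (p b)))"
proof -
  define t where "t = D c z (p b)"
  have 1: "D (c \<cdot> b) z (p b) = T b c t"
    unfolding t_def by (rule D_fixed_factor) (rule p_assoc')
  have 2: "D b z (p (c \<cdot> b)) = T (p b) (p c) (D b z (p c))"
  proof -
    have "D (p c \<cdot> p b) z b = T (p b) (p c) (D (p c) z b)"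
      by (rule D_fixed_factor) (simp only: p_assoc e_p)
    then show ?thesis by (simp only: p_mul D_swap[of b z] T_iv)
  qed
  have "T b c (T (p b) (p c) (T b c (T b c t))) = T c b (T (p c) (p b) (T c b (T b c t)))"
    using polarization[of b "c \<cdot> b"] polarization'[of b "c \<cdot> b"] unfolding 1 p_mul
    by (simp only: T_mul_arg) (metis T_mul_arg T_T T_ee e_T)
  then have "T c b (T b c (T (p b) (p c) (T c b t))) = T c b (T c b (T (p c) (p b) t))"
    by (simp only: T_cube T_T T_ee)
  then show ?thesis unfolding t_def[symmetric] by (simp only: T_T T_cube e_T)
qed

lemma adjoint_aux': "T (p c) (p b) (T b c (D c z (p b))) = T c b (T (p b) (p c) (D c z (p b)))"
proof -
  have "iv (T (p c) (p b) (T b c (D c z (p b)))) = iv (T c b (T (p b) (p c) (D c z (p b))))"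
    using adjoint_aux[of b "iv c"] by (simp only: p_iv D_iv T_iv1 T_iv2 T_iv)
  then show ?thesis by (metis iv_inj e_T)
qed

text \<open>The points \<open>a\<close> and \<open>d\<close> below are joined crosswise to the images of \<open>t\<close> under the two inner mappings
\<open>T c b\<close> and \<open>T (p c) (p b)\<close>, which therefore agree at \<open>t\<close>.\<close>
lemma adjoint: "D (p b) z c = D b z (p c)"
proof -
  define t where "t = D c z (p b)"
  define a where "a = T b c (T (p c) (p b) t)"
  define d where "d = T c b (T (p b) (p c) t)"
  have a: "T (p b) (p c) (T c b t) = a" unfolding a_def t_def by (rule adjoint_aux)
  have d: "T (p c) (p b) (T b c t) = d" unfolding d_def t_def by (rule adjoint_aux')
  have third: "T y x u = iv u \<cdot> iv (T x y u)" for x y u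
    using left_inv[of "T x y u" "T y x u"] unfolding T_exp e_T comm[of "iv (T x y u)" "iv u"] by (rule sym)
  have line: "u \<cdot> T y x u = iv (T x y u)" for x y u
    unfolding third[of y x u] by (simp only: left_inv' e_iv)
  have ta: "T c b t \<cdot> a = iv (T (p c) (p b) (T c b t))"
    unfolding a[symmetric] by (rule line)
  have tb: "T (p c) (p b) t \<cdot> d = iv (T (p c) (p b) (T c b t))"
  proof -
    have "T (p c) (p b) (t \<cdot> T b c t) = T (p c) (p b) (iv (T c b t))" by (simp only: line)
    then show ?thesis by (simp only: T_mul T_iv d)
  qed
  have tc: "T (p c) (p b) t \<cdot> a = iv (T c b (T (p c) (p b) t))"
    unfolding a_def by (rule line)
  have td: "T c b t \<cdot> d = iv (T c b (T (p c) (p b) t))"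
  proof -
    have "T c b (t \<cdot> T (p b) (p c) t) = T c b (iv (T (p c) (p b) t))" by (simp only: line)
    then show ?thesis by (simp only: T_mul T_iv d_def)
  qed
  have "e \<cdot> T c b t = e \<cdot> T (p c) (p b) t"
    by (rule collapse[of _ a _ d]) (simp_all only: ta tb tc td)
  then have q: "T c b t = T (p c) (p b) t" by (simp only: e_T)
  have et: "e \<cdot> t = t" by (simp only: t_def e_D)
  have "iv (D b z (p c)) = T c b (T (p c) (p b) (T c b t))"
    unfolding t_def by (rule polarization')
  also have "\<dots> = T c b (T (p b) (p c) t)"
    by (simp only: q T_cube)
  also have "\<dots> = T (p c) (p b) (T b c t)" by (simp only: d d_def)
  also have "T b c t = T (p b) (p c) t"
    unfolding third[of b c t] third[of "p b" "p c" t] q ..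
  finally have "iv (D b z (p c)) = t" by (simp only: T_T et)
  then show ?thesis unfolding t_def by (metis D_swap iv_inj e_D)
qed
end

text \<open>\<open>adjoint\<close> with \<open>z = w\<close> applies to \<open>T w v\<close> and
  \<open>T v w\<close>. The hypothesis, transported by \<open>T v w\<close>, has this mapping in two
  arguments; moved into one argument the two copies become their inverse \<open>T w v\<close> by
  \<open>T_cube\<close>, which is then moved to \<open>q\<close>.\<close>

lemma T_fixed_of_assoc: assumes "T w q z = e \<cdot> z" shows "T w z (T w v q) = T w v q"
proof -
  have *: "D (T w v b) w c = D b w (T w v c)" "D (T v w b) w c = D b w (T v w c)" for b c
    by (rule adjoint; simp only: T_mul T_iv e_T T_fix T_fix')+
  have "T w (T v w q) (T v w z) = e \<cdot> T v w z"
    using arg_cong[OF assms, of "T v w"] by (simp only: T_conj[of v w] T_snd T_ee T_el e_T)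
  then have "D (T v w q) w (T v w z) = e" by (metis T_perm(3) T_perm(1) D_eq_e)
  then have "D q w (T w v z) = e" by (simp only: * T_cube)
  then have "D (T w v q) w z = e" by (simp only: *)
  then show ?thesis by (simp only: D_eq_e e_T)
qed

lemma swap: "z \<cdot> (u \<cdot> x) = T u z (u \<cdot> (z \<cdot> x))"
proof -
  have "T u z (u \<cdot> (z \<cdot> x)) = T u z ((u \<cdot> z) \<cdot> T u z x)" by (simp only: T_mulL[symmetric])
  also have "\<dots> = T u z ((z \<cdot> u) \<cdot> T u z x)" by (simp only: comm[of u z])
  also have "\<dots> = (z \<cdot> u) \<cdot> T z u x" by (simp only: T_mul T_fst T_snd T_cube mul_e mul_e2 e_mul)
  finally show ?thesis by (simp only: T_mulL[symmetric])
qed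

lemma L_mul: "(u \<cdot> n) \<cdot> w = iv u \<cdot> (n \<cdot> (iv u \<cdot> w))"
  by (simp only: moufang3 iv_iv mul_e)

text \<open>Translation by \<open>u \<cdot> n\<close> is a product of translations by
  \<open>iv u\<close>, \<open>n\<close> and \<open>iv u\<close> (\<open>L_mul\<close>). Moving
  \<open>z\<close> through each costs an inner mapping by \<open>swap\<close>; the hypothesis allows
  these to be collected, and the two copies of \<open>T z u\<close> combine to
  \<open>T u z\<close>.\<close>

lemma T_hom: assumes "T z u n = e \<cdot> n" shows "T (u \<cdot> n) z w = T u z (T n z w)"
proof -
  have zu: "T n z u = e \<cdot> u" "T z u z = e \<cdot> z" "T z u u = e \<cdot> u" using T_perm[OF assms] T_fst T_snd by auto
  have "z \<cdot> ((u \<cdot> n) \<cdot> y) = T z u (T n z (T z u ((u \<cdot> n) \<cdot> (z \<cdot> y))))" for y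
  proof -
    have "z \<cdot> ((u \<cdot> n) \<cdot> y) = T z u (iv u \<cdot> (z \<cdot> (n \<cdot> (iv u \<cdot> y))))"
      by (simp only: L_mul swap[of z "iv u"] T_iv1)
    also have "\<dots> = T z u (iv u \<cdot> T n z (n \<cdot> T z u (iv u \<cdot> (z \<cdot> y))))"
      by (simp only: swap[of z n] swap[of z "iv u"] T_iv1)
    also have "\<dots> = T z u (T n z (T z u (iv u \<cdot> (n \<cdot> (iv u \<cdot> (z \<cdot> y))))))"
      by (simp only: T_mul T_iv zu assms iv_e mul_e mul_e2)
    finally show ?thesis by (simp only: L_mul)
  qed
  then have "T (u \<cdot> n) z ((u \<cdot> n) \<cdot> (z \<cdot> y)) = T z u (T n z (T z u ((u \<cdot> n) \<cdot> (z \<cdot> y))))" for y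
    by (simp only: swap[of z "u \<cdot> n"])
  from this[of "iv z \<cdot> (iv (u \<cdot> n) \<cdot> w)"]
  have "T (u \<cdot> n) z w = T z u (T n z (T z u w))"
    by (simp only: left_inv' mul_e2 T_ee)
  also have "T n z (T z u w) = T z u (T n z w)"
    by (simp only: T_conj[of n z z u] T_snd zu) (simp only: T_def mul_e iv_mul mul_e2 iv_e)
  finally show ?thesis by (simp only: T_cube)
qed

lemma T_hom2: assumes "T z u n = e \<cdot> n" shows "T z (u \<cdot> n) w = T z u (T z n w)"
proof -
  have "T z (iv u) (iv n) = e \<cdot> iv n"
    using T_perm(1)[OF assms] by (simp only: T_iv2 T_iv iv_e e_iv)
  from T_hom[OF this, of w] show ?thesis by (simp only: iv_mul[symmetric] T_iv1)
qed

lemma C_mul: "C z q \<Longrightarrow> C z r \<Longrightarrow> C z (q \<cdot> r)"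
  unfolding C_def by (simp add: T_hom2 T_ee)

lemma C_e: "C z e" by (simp add: C_def T_def mul_e3 e_mul mul_e iv_e left_inv)

lemma C_iv: "C z q \<Longrightarrow> C z (iv q)"
  unfolding C_def by (metis T_iv2 T_swap_iff)

lemma C_sym: "C z q \<Longrightarrow> C q z"
  unfolding C_def by (metis T_swap_iff)

lemma C_self: "C z z" by (simp add: C_def T_def lalt left_inv)

lemma C_el: "C z (e \<cdot> q) = C z q" "C (e \<cdot> z) q = C z q" by (simp_all add: C_def T_el)

lemma C_T: "C z q \<Longrightarrow> C (T u v z) (T u v q)"
  unfolding C_def by (metis T_conj T_T e_T T_ee T_mul)

section \<open>The orbit of an element under the inner mappings\<close>

fun inner_orb :: "'a \<Rightarrow> nat \<Rightarrow> 'a set" where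
  "inner_orb z 0 = {e \<cdot> z}"
| "inner_orb z (Suc k) = {T u v q | u v q. q \<in> inner_orb z k}"

text \<open>Associativity of \<open>z\<close>, \<open>w\<close> and \<open>T u v q\<close> is symmetric in \<open>w\<close>, \<open>u\<close>, \<open>v\<close> by the adjointness relation, and
for fixed \<open>u\<close>, \<open>v\<close> it defines a subloop in \<open>w\<close>. So it suffices to test generators, at most one of
which is not in \<open>H\<close>.\<close>
lemma inner_orb_C:
  assumes gen: "\<And>w. e \<cdot> w \<in> gen G"
    and GH: "G \<subseteq> insert y H" and H: "\<And>h h'. h \<in> H \<Longrightarrow> h' \<in> H \<Longrightarrow> T h h' z = e \<cdot> z"
  shows "q \<in> inner_orb z k \<Longrightarrow> C z q"
proof (induction k arbitrary: q)
  case 0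
  then show ?case by (simp add: C_el C_self)
next
  case (Suc k)
  then obtain u0 v0 q0 where q0: "q = T u0 v0 q0" "q0 \<in> inner_orb z k" by auto
  define q' where "q' = q0"
  have Cq: "C z q'" using Suc.IH q0 by (simp add: q'_def)
  then have fq: "T z w q' = e \<cdot> q'" "T z q' w = e \<cdot> w" "T w q' z = e \<cdot> z" "T q' w z = e \<cdot> z" for w
    using T_perm unfolding C_def by blast+
  define R where "R w u v \<longleftrightarrow> T z w (T u v q') = T u v q'" for w u v
  have R_uv: "R w v u" if "R w u v" for w u v
  proof -
    have "T v u q' = iv (T u v q') \<cdot> iv q'" using T_exp[of u v q'] by (metis left_inv e_T)
    then show ?thesis using that by (simp add: R_def T_mul T_iv fq iv_e)
  qed
  have R_D: "R w u v \<longleftrightarrow> T z w (D u v q') = D u v q'" for w u v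
  proof -
    have "T u v q' = q' \<cdot> D u v q'" by (metis T_D D_cyc)
    then have "T z w (T u v q') = q' \<cdot> T z w (D u v q')" by (simp only: T_mul fq mul_e)
    then show ?thesis unfolding R_def \<open>T u v q' = q' \<cdot> D u v q'\<close> by (metis cancel e_T e_D)
  qed
  have p_D: "T v q' u = u \<cdot> D u v q'" for u v by (rule T_D)
  have p_assoc: "T z u (T v q' u) = T v q' u" for u v
  proof -
    have "T z u (T u v q') = T u v q'" by (metis T_fixed_of_assoc T_perm(1) T_swap_iff e_T fq(3))
    then show ?thesis using R_D[of u u v] unfolding R_def p_D by (simp only: T_mul T_snd mul_e)
  qed
  \<comment> \<open>Self-adjointness is used for the endomorphism \<open>p = T v q'\<close>, whose
    hypothesis is \<open>p_assoc\<close>. It is the source of the exchange of \<open>w\<close> and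
    \<open>u\<close> in \<open>R_wu\<close>.\<close>
  have adj: "D (T v q' b) z c = D b z (T v q' c)" for v b c
    by (rule adjoint) (simp_all only: T_mul T_iv e_T p_assoc)
  have R_alt: "R w u v \<longleftrightarrow> D w z (T v q' u) = D w z u" for w u v
  proof -
    have zun: "T z u (D u v q') = e \<cdot> D u v q'"
      using p_assoc[of u v] unfolding p_D T_mul T_snd mul_e by (metis cancel e_T)
    have "T z (T v q' u) w = T z u (T z (D u v q') w)"
      unfolding p_D by (rule T_hom2) (rule zun)
    then have "T z (T v q' u) w = T z u w \<longleftrightarrow> T z (D u v q') w = e \<cdot> w"
      by (metis T_cancel T_ee e_T)
    moreover have "R w u v \<longleftrightarrow> T z (D u v q') w = e \<cdot> w"
      unfolding R_D by (metis T_perm(3) e_D)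
    ultimately show ?thesis by (metis D_def T_D cancel e_T)
  qed
  have R_wu: "R u w v" if "R w u v" for w u v
  proof -
    have "D (T v q' w) z u = D w z u" using that by (simp only: adj R_alt)
    then have "D u z (T v q' w) = D u z w" by (metis D_swap)
    then show ?thesis by (simp only: R_alt)
  qed
  have R_ww: "R w w v" for w v
    unfolding R_def by (metis T_fixed_of_assoc T_perm(1) T_swap_iff e_T fq(3))
  \<comment> \<open>Inner mappings formed in \<open>H\<close> fix \<open>z\<close>, so by
    \<open>T_conj\<close> they map each \<open>inner_orb z k\<close> into itself, and the induction
    hypothesis already covers \<open>T h h' q'\<close>.\<close>
  have R_H: "R w h h'" if "h \<in> H" "h' \<in> H" for w h h'
  proof -
    have "T h h' q \<in> inner_orb z k" if "q \<in> inner_orb z k" for q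
      using that
    proof (induction k arbitrary: q)
      case 0
      then show ?case using H[OF \<open>h \<in> H\<close> \<open>h' \<in> H\<close>] by (simp add: T_ee)
    next
      case (Suc k)
      then show ?case by (auto simp: T_conj[of h h']) blast
    qed
    then have "C z (T h h' q')" using q0 Suc.IH by (simp add: q'_def)
    then show ?thesis unfolding R_def C_def by (metis T_perm(3) e_T)
  qed
  have R_fix: "R w u v \<longleftrightarrow> T z (D u v q') w = e \<cdot> w" for w u v
    unfolding R_D by (metis T_perm(3) e_D)
  have R_gen: "R (e \<cdot> w) u v" if "\<And>g. g \<in> G \<Longrightarrow> R g u v" for w u v
    unfolding R_fix using gen[of w]
  proof (induction rule: gen.induct)
    case (gen_in g)
    then show ?case using that[of g] by (simp add: R_fix T_ee e_mul)
  qed (simp_all add: T_mul T_iv mul_e mul_e2 e_mul e_iv iv_e e_e)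
  have R_el: "R (e \<cdot> w) u v \<longleftrightarrow> R w u v" "R w (e \<cdot> u) v \<longleftrightarrow> R w u v" "R w u (e \<cdot> v) \<longleftrightarrow> R w u v" for w u v
    by (simp_all add: R_def T_el)
  \<comment> \<open>Since only \<open>y\<close> can lie outside \<open>H\<close>, of any three
    generators two lie in \<open>H\<close> or two coincide; the symmetries reduce these cases to
    \<open>R_H\<close> and \<open>R_ww\<close>.\<close>
  have R1: "R a b c" if g: "a \<in> G" "b \<in> G" "c \<in> G" for a b c
  proof -
    consider "b \<in> H \<and> c \<in> H" | "a \<in> H \<and> c \<in> H" | "a \<in> H \<and> b \<in> H" | "a = b" | "b = c" | "a = c"
      using g GH by blast
    then show ?thesis
    proof cases
      case 1 then show ?thesis using R_H by blast
    next
      case 2 then show ?thesis using R_H R_wu by blast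
    next
      case 3 then show ?thesis using R_H R_wu R_uv by blast
    next
      case 4 then show ?thesis using R_ww by blast
    next
      case 5 then show ?thesis using R_ww R_wu R_uv by blast
    next
      case 6 then show ?thesis using R_ww R_wu R_uv by blast
    qed
  qed
  have R_gen': "R w u v" if "\<And>g. g \<in> G \<Longrightarrow> R g u v" for w u v
    using R_gen[OF that] by (simp only: R_el)
  have R2: "R w b c" if "b \<in> G" "c \<in> G" for w b c
    by (rule R_gen') (rule R1[OF _ that])
  have R3: "R w u c" if "c \<in> G" for w u c
    by (rule R_wu, rule R_gen', rule R_wu, rule R2[OF _ that])
  have "R w u v" for w u v
    by (rule R_wu, rule R_uv, rule R_wu, rule R_gen', rule R_wu, rule R_uv, rule R_wu, rule R3)
  then show ?case unfolding C_def q0(1) R_def q'_def[symmetric] by (metis T_perm(3) e_T)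
qed
end

section \<open>Normal subloops, central series and quotients\<close>

context cml begin

text \<open>Invariance under inner mappings is the normality criterion for commutative loops. The
  equivalence also covers the inverse mappings, whose description \<open>T_T\<close> is tied to
  exponent 3.\<close>

definition normal_sub :: "'a set \<Rightarrow> bool" where
  "normal_sub N \<longleftrightarrow> e \<in> N \<and> (\<forall>x\<in>N. e \<cdot> x = x \<and> iv x \<in> N) \<and> (\<forall>x\<in>N. \<forall>y\<in>N. x \<cdot> y \<in> N)
     \<and> (\<forall>a b x. e \<cdot> x = x \<longrightarrow> (T a b x \<in> N \<longleftrightarrow> x \<in> N))"

lemma normal_sub_T: "normal_sub N \<Longrightarrow> e \<cdot> x = x \<Longrightarrow> T a b x \<in> N \<longleftrightarrow> x \<in> N"
  by (simp add: normal_sub_def)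

text \<open>The associator has its argument from the upper central series in the second place: this is the form in which inner mappings are shown to commute with translations modulo the previous term.\<close>
fun loop_ucs :: "'a set \<Rightarrow> nat \<Rightarrow> 'a set" where
  "loop_ucs H 0 = {e}"
| "loop_ucs H (Suc i) = {a \<in> H. e \<cdot> a = a \<and> (\<forall>u\<in>H. \<forall>v\<in>H. D v a u \<in> loop_ucs H i)}"

lemma T_surj: "\<exists>y. e \<cdot> y = y \<and> T a b y = e \<cdot> x"
proof
  have "T a b (iv b \<cdot> (iv a \<cdot> ((a \<cdot> b) \<cdot> x))) = e \<cdot> x"
    by (simp add: T_def left_inv' mul_e2 e_mul left_inv)
  then show "e \<cdot> (iv b \<cdot> (iv a \<cdot> ((a \<cdot> b) \<cdot> x))) = iv b \<cdot> (iv a \<cdot> ((a \<cdot> b) \<cdot> x)) \<and> T a b (iv b \<cdot> (iv a \<cdot> ((a \<cdot> b) \<cdot> x))) = e \<cdot> x"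
    by (simp add: e_mul)
qed

text \<open>In place of associativity, \<open>(x \<cdot> n) \<cdot> m\<close> is rewritten as
  \<open>x \<cdot> (n \<cdot> m')\<close>, where \<open>m'\<close> is the preimage of
  \<open>m\<close> under \<open>T x n\<close> and lies in \<open>N\<close> by normality.\<close>

lemma coset_trans:
  assumes N: "normal_sub N" and "iv x \<cdot> y \<in> N" "iv y \<cdot> z \<in> N" shows "iv x \<cdot> z \<in> N"
proof -
  define n m where "n = iv x \<cdot> y" and "m = iv y \<cdot> z"
  have nmul: "n \<in> N" "m \<in> N" using assms n_def m_def by auto
  obtain m' where m': "e \<cdot> m' = m'" "T x n m' = e \<cdot> m" using T_surj by blast
  have em: "e \<cdot> m = m" by (simp add: m_def e_mul)
  then have "m' \<in> N" using N nmul m' unfolding normal_sub_def by metis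
  have "y \<cdot> m = e \<cdot> z" "x \<cdot> n = e \<cdot> y" by (simp_all add: n_def m_def left_inv')
  then have "e \<cdot> z = (x \<cdot> n) \<cdot> T x n m'" by (metis m' em mul_e)
  also have "\<dots> = x \<cdot> (n \<cdot> m')" by (rule T_mulL[symmetric])
  finally have "iv x \<cdot> z = n \<cdot> m'" by (metis left_inv mul_e2 e_mul)
  then show ?thesis using \<open>m' \<in> N\<close> nmul N unfolding normal_sub_def by metis
qed

lemma coset_sym: "normal_sub N \<Longrightarrow> iv x \<cdot> y \<in> N \<Longrightarrow> iv y \<cdot> x \<in> N"
  unfolding normal_sub_def by (metis comm iv_iv iv_mul mul_e2)

lemma coset_refl: "normal_sub N \<Longrightarrow> iv x \<cdot> x \<in> N"
  by (simp add: normal_sub_def inv_l)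

lemma coset_mul: assumes N: "normal_sub N" and "iv x \<cdot> y \<in> N" shows "iv (x \<cdot> w) \<cdot> (y \<cdot> w) \<in> N"
proof -
  define n where "n = iv x \<cdot> y"
  have "n \<in> N" "x \<cdot> n = e \<cdot> y" using assms by (simp_all add: n_def left_inv')
  have "w \<cdot> (x \<cdot> n) = (w \<cdot> x) \<cdot> T w x n" by (rule T_mulL)
  then have "y \<cdot> w = (x \<cdot> w) \<cdot> T w x n" by (simp only: \<open>x \<cdot> n = e \<cdot> y\<close> mul_e2 comm[of w])
  then have "iv (x \<cdot> w) \<cdot> (y \<cdot> w) = T w x n" by (metis left_inv e_T)
  moreover have "T w x n \<in> N" using N \<open>n \<in> N\<close> unfolding normal_sub_def by metis
  ultimately show ?thesis by simp
qed
end

text \<open>The quotient by a normal subloop lives on the same type, with a choice of coset representatives as operations.\<close>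
locale quot = cml +
  fixes N \<rho>
  assumes N: "normal_sub N"
  defines "\<rho> \<equiv> \<lambda>x. SOME y. iv x \<cdot> y \<in> N"
begin
lemma rho_in: "iv x \<cdot> \<rho> x \<in> N"
  unfolding \<rho>_def by (rule someI[of _ x]) (rule coset_refl[OF N])

lemma rho_eq: "\<rho> x = \<rho> y \<longleftrightarrow> iv x \<cdot> y \<in> N"
proof
  assume "\<rho> x = \<rho> y"
  then show "iv x \<cdot> y \<in> N" using rho_in coset_sym[OF N] coset_trans[OF N] by metis
next
  assume "iv x \<cdot> y \<in> N"
  then have "(\<lambda>z. iv x \<cdot> z \<in> N) = (\<lambda>z. iv y \<cdot> z \<in> N)"
    using coset_sym[OF N] coset_trans[OF N] by blast
  then show "\<rho> x = \<rho> y" unfolding \<rho>_def by simp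
qed

lemma rho_rho [simp]: "\<rho> (\<rho> x) = \<rho> x"
  using rho_in by (metis rho_eq)

lemma rho_el [simp]: "\<rho> (e \<cdot> x) = \<rho> x"
  using N by (simp add: rho_eq iv_e inv_l normal_sub_def)

lemma rho_l [simp]: "\<rho> (\<rho> x \<cdot> y) = \<rho> (x \<cdot> y)"
  unfolding rho_eq by (rule coset_mul[OF N]) (metis rho_rho rho_eq)

lemma rho_r [simp]: "\<rho> (y \<cdot> \<rho> x) = \<rho> (y \<cdot> x)"
  by (metis comm rho_l)

lemma rho_iv [simp]: "\<rho> (iv (\<rho> x)) = \<rho> (iv x)"
proof -
  have "iv (iv (\<rho> x)) \<cdot> iv x = iv x \<cdot> \<rho> x" by (metis comm iv_iv mul_e2)
  then show ?thesis unfolding rho_eq using rho_in by metis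
qed

lemma rho_N: "\<rho> x = \<rho> e \<longleftrightarrow> e \<cdot> x \<in> N"
  by (metis rho_eq iv_ee)

sublocale q: cml "\<lambda>x y. \<rho> (x \<cdot> y)" "\<lambda>x. \<rho> (iv x)" "\<rho> e"
  by unfold_locales (rule arg_cong[OF comm], simp, rule arg_cong[OF moufang_sq], simp_all add: left_inv mul_e e_mul e_e iv_e e_iv)

lemma q_T: "q.T a b u = \<rho> (T a b u)" by (simp add: q.T_def T_def)

lemma q_D: "q.D a b u = \<rho> (D a b u)" by (simp add: q.D_def D_def q_T)

lemma rho_T: "\<rho> (T (\<rho> a) b u) = \<rho> (T a b u)" "\<rho> (T a (\<rho> b) u) = \<rho> (T a b u)" "\<rho> (T a b (\<rho> u)) = \<rho> (T a b u)"
  by (simp_all only: q_T[symmetric]) (simp_all add: q.T_def)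

lemma rho_D: "\<rho> (D (\<rho> a) b u) = \<rho> (D a b u)" "\<rho> (D a (\<rho> b) u) = \<rho> (D a b u)" "\<rho> (D a b (\<rho> u)) = \<rho> (D a b u)"
  by (simp_all only: q_D[symmetric]) (simp_all add: q.D_def rho_T q_T)

lemma q_gen: "x \<in> gen G \<Longrightarrow> \<rho> x \<in> q.gen (\<rho> ` G)"
proof (induction rule: gen.induct)
  case (gen_in g)
  then have "\<rho> (\<rho> e \<cdot> \<rho> g) \<in> q.gen (\<rho> ` G)" by (intro q.gen_in) simp
  then show ?case by simp
next
  case (gen_iv x)
  then show ?case using q.gen_iv by fastforce
next
  case (gen_mul x y)
  then show ?case using q.gen_mul by fastforce
qed (rule q.gen_e)

lemma q_loop_ucs: "x \<in> loop_ucs H i \<Longrightarrow> \<rho> x \<in> q.loop_ucs (\<rho> ` H) i"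
proof (induction i arbitrary: x)
  case (Suc i)
  then show ?case by (auto simp: q_D rho_D)
qed simp
end

locale quot3 = quot + cml3
begin
sublocale q: cml3 "\<lambda>x y. \<rho> (x \<cdot> y)" "\<lambda>x. \<rho> (iv x)" "\<rho> e"
  by unfold_locales (simp add: exp3)
end

section \<open>Central elements in abelian normal subloops\<close>

context cml3 begin

text \<open>By \<open>D_cyc\<close> the associator can be read as
  \<open>D u n (a \<cdot> x)\<close>, where \<open>T_hom2\<close> splits off a trivial mapping. So
  the action on \<open>n\<close> of an inner mapping sees its arguments only modulo elements related
  to \<open>n\<close> by \<open>C\<close>.\<close>

lemma T_C_mul1: assumes "C n x" shows "T (a \<cdot> x) u n = T a u n"
proof -
  have "T n a x = e \<cdot> x" using assms T_perm(3) unfolding C_def by blast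
  then have "T n (a \<cdot> x) u = T n a u" using T_hom2 assms by (simp add: C_def T_ee)
  then have "D u n (a \<cdot> x) = D u n a" by (simp add: D_def)
  then have "D n (a \<cdot> x) u = D n a u" by (metis D_cyc)
  then show ?thesis by (simp add: T_D)
qed

lemma T_C_mul2: assumes "C n x" shows "T u (a \<cdot> x) n = T u a n"
proof -
  have "D n (a \<cdot> x) u = D n a u" by (simp add: D_def T_C_mul1[OF assms])
  then have "D n u (a \<cdot> x) = D n u a" by (metis D_anti)
  then show ?thesis by (simp add: T_D)
qed

lemma C_mul': "C q z \<Longrightarrow> C r z \<Longrightarrow> C (q \<cdot> r) z"
  by (rule C_sym[OF C_mul]; rule C_sym)

lemma C_iv': "C q z \<Longrightarrow> C (iv q) z"
  by (rule C_sym[OF C_iv], rule C_sym)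

text \<open>Descent along the chain \<open>A\<close>: on the elements of \<open>N\<close> centralized by \<open>A i\<close>, the inner mappings \<open>T a u\<close>
with \<open>a\<close> in \<open>A (Suc i)\<close> commute pairwise and depend only on cosets of \<open>N\<close>, so there are finitely many
of them. Replacing an element that is moved by its displacement makes it fixed and keeps the
mappings treated before fixed.\<close>
lemma central_element_exists:
  assumes N: "normal_sub N" and NC: "\<And>n m. n \<in> N \<Longrightarrow> m \<in> N \<Longrightarrow> C n m" and n0: "n0 \<in> N" "n0 \<noteq> e"
    and R: "finite R" and coset_decomposition: "\<And>x. \<exists>r\<in>R. \<exists>n\<in>N. e \<cdot> x = r \<cdot> n"
    and A0: "A 0 \<subseteq> N" and AT: "\<And>i a u v. a \<in> A i \<Longrightarrow> T u v a \<in> A i"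
    and AD: "\<And>i a u v. a \<in> A (Suc i) \<Longrightarrow> D v a u \<in> A i"
    and Ak: "\<And>x. e \<cdot> x \<in> A k"
  shows "\<exists>c\<in>N. c \<noteq> e \<and> (\<forall>u v. T u v c = c)"
proof -
  define W where "W i = {n \<in> N. \<forall>a\<in>A i. C n a}" for i
  have W_N: "n \<in> N" if "n \<in> W i" for n i using that by (simp add: W_def)
  have W_el: "e \<cdot> n = n" if "n \<in> W i" for n i using that N by (simp add: W_def normal_sub_def)
  have W_T: "T u v n \<in> W i" if "n \<in> W i" for u v n i
  proof -
    have "C (T u v n) a" if "a \<in> A i" for a
      using C_T[of n "T v u a" u v] that AT \<open>n \<in> W i\<close> unfolding W_def by (simp add: T_T C_el)
    then show ?thesis using that N unfolding W_def normal_sub_def by blast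
  qed
  have W_D: "D n u v \<in> W i" if "n \<in> W i" for n u v i
    using W_T[OF that, of u v] that N unfolding D_def W_def normal_sub_def
    by (auto intro: C_mul' C_iv')
  have "\<exists>c\<in>W i. c \<noteq> e" for i
  proof (induction i)
    case 0
    then show ?case using n0 NC A0 by (auto simp: W_def)
  next
    case (Suc i)
    then obtain c0 where c0: "c0 \<in> W i" "c0 \<noteq> e" by blast
    obtain r where r: "r x \<in> R" "\<exists>n\<in>N. e \<cdot> x = r x \<cdot> n" for x using coset_decomposition by metis
    have r_eq: "T (r a) (r u) n = T a u n" if "n \<in> N" for a u n
    proof -
      obtain m m' where m: "m \<in> N" "e \<cdot> a = r a \<cdot> m" "m' \<in> N" "e \<cdot> u = r u \<cdot> m'" using r by blast
      have "T a u n = T (r a \<cdot> m) (r u \<cdot> m') n" by (simp add: T_el flip: m(2,4))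
      then show ?thesis by (simp only: T_C_mul1[OF NC[OF that m(1)]] T_C_mul2[OF NC[OF that m(3)]])
    qed
    \<comment> \<open>\<open>T a u\<close> conjugates \<open>T b w\<close> to the inner mapping of
      \<open>b \<cdot> D b a u\<close> and \<open>w \<cdot> D w a u\<close>. The added factors lie
      in \<open>A i\<close>, so they do not affect the action on \<open>W i\<close>.\<close>
    have commute: "T a u (T b w n) = T b w (T a u n)" if "a \<in> A (Suc i)" "n \<in> W i" for a u b w n
    proof -
      have n': "T a u n \<in> W i" by (rule W_T) fact
      have 1: "D b a u \<in> A i" "D w a u \<in> A i" using AD that by auto
      have "T a u (T b w n) = T (b \<cdot> D b a u) (w \<cdot> D w a u) (T a u n)"
        by (simp add: T_conj[of a u] T_D[of a u b] T_D[of a u w])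
      then show ?thesis using n' 1 T_C_mul1 T_C_mul2 by (simp add: W_def)
    qed
    define S where "S = {(r a, r u) | a u. a \<in> A (Suc i)}"
    have "finite S" by (rule finite_subset[of _ "R \<times> R"]) (use R r in \<open>auto simp: S_def\<close>)
    have "F \<subseteq> S \<Longrightarrow> \<exists>c\<in>W i. c \<noteq> e \<and> (\<forall>p q. (p, q) \<in> F \<longrightarrow> T p q c = c)" if "finite F" for F
      using that
    proof (induction F rule: finite_induct)
      case empty
      then show ?case using c0 by auto
    next
      case (insert x F)
      then obtain c where c: "c \<in> W i" "c \<noteq> e" "\<And>p q. (p, q) \<in> F \<Longrightarrow> T p q c = c" by blast
      have "x \<in> S" "F \<subseteq> S" using insert.prems by blast+
      then obtain a u where x: "x = (r a, r u)" and a: "a \<in> A (Suc i)" unfolding S_def by blast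
      show ?case
      proof (cases "T a u c = c")
        case True
        then have "T (r a) (r u) c = c" using r_eq[OF W_N[OF c(1)]] by simp
        then show ?thesis using c unfolding x by (intro bexI[of _ c]) auto
      next
        case False
        let ?d = "D c a u"
        have "?d \<noteq> e" using False W_el[OF c(1)] by (simp add: D_eq_e)
        moreover have d: "?d \<in> W i" by (rule W_D) fact
        moreover have "T a u ?d = ?d" using T_fix_D(1)[of a u c] D_cyc by metis
        moreover have "T p q ?d = ?d" if pq: "(p, q) \<in> F" for p q
        proof -
          obtain b w where bw: "p = r b" "q = r w" "b \<in> A (Suc i)" using pq \<open>F \<subseteq> S\<close> unfolding S_def by blast
          have Tc: "T p q c = c" using c(3) pq by blast
          have pq_eq: "T p q n = T b w n" if "n \<in> W i" for n
            unfolding bw by (rule r_eq[OF W_N[OF that]])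
          have "T p q (T a u c) = T a u (T b w c)"
            unfolding pq_eq[OF W_T[OF c(1)]] by (rule commute[OF bw(3) c(1)])
          then have "T p q (T a u c) = T a u c" "T p q c = c"
            using Tc by (simp_all only: pq_eq[OF c(1)])
          then show ?thesis by (simp add: D_def T_mul T_iv)
        qed
        moreover have "T (r a) (r u) ?d = T a u ?d" by (rule r_eq[OF W_N[OF d]])
        ultimately show ?thesis unfolding x by (intro bexI[of _ ?d]) auto
      qed
    qed
    from this[OF \<open>finite S\<close> order_refl] obtain c where c: "c \<in> W i" "c \<noteq> e" "\<And>p q. (p, q) \<in> S \<Longrightarrow> T p q c = c" by blast
    have "C c a" if a: "a \<in> A (Suc i)" for a
    proof -
      have "T a w c = e \<cdot> c" for w
        using r_eq[OF W_N[OF c(1)], of a w] c(3)[of "r a" "r w"] a W_el[OF c(1)] unfolding S_def by auto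
      then show ?thesis unfolding C_def using T_perm(2) by blast
    qed
    then show ?case using c by (auto simp: W_def)
  qed
  then obtain c where c: "c \<in> W k" "c \<noteq> e" by blast
  have "T u v c = c" for u v
  proof -
    have "C c (e \<cdot> u)" using c Ak by (simp add: W_def)
    then have "T c u v = e \<cdot> v" unfolding C_def T_el by blast
    then have "T u v c = e \<cdot> c" by (rule T_perm(4))
    then show ?thesis by (simp only: W_el[OF c(1)])
  qed
  then show ?thesis using c(2) W_N[OF c(1)] by blast
qed

lemma D_e: "D e u v = e" by (simp add: D_def iv_ee e_e)

lemma D_mid_e: "D v e u = e" by (simp only: D_cyc[of v e u] D_cyc[of u v e] D_e)

lemma loop_ucs_normal_sub: "normal_sub (loop_ucs UNIV i)"
proof (induction i)
  case 0
  have "T a b x = e \<longleftrightarrow> x = e" if "e \<cdot> x = x" for a b x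
    using T_cancel[of a b x e] that by (auto simp: e_e)
  then show ?case by (auto simp: normal_sub_def iv_ee e_e)
next
  case (Suc i)
  let ?Z = "loop_ucs UNIV i"
  \<comment> \<open>Moving the element of the series to the first place makes its associator the
    displacement under an endomorphism, which is easy to evaluate on products.\<close>
  have mem: "x \<in> loop_ucs UNIV (Suc i) \<longleftrightarrow> e \<cdot> x = x \<and> (\<forall>u v. D x u v \<in> ?Z)" for x
    using D_cyc[of x] by (auto simp del: loop_ucs.simps(1))
  have e: "e \<in> ?Z" and iv: "\<And>x. x \<in> ?Z \<Longrightarrow> iv x \<in> ?Z"
    and T: "\<And>x u v. e \<cdot> x = x \<Longrightarrow> T u v x \<in> ?Z \<longleftrightarrow> x \<in> ?Z" using Suc by (auto simp: normal_sub_def)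
  have TD: "T a b (D x u v) = D (T a b x) (T a b u) (T a b v)" for a b x u v
    by (simp only: D_def T_mul T_iv T_conj[of a b u v x])
  show ?case unfolding normal_sub_def
  proof (intro conjI ballI allI impI)
    show "e \<in> loop_ucs UNIV (Suc i)" unfolding mem by (simp add: e_e D_e e)
  next
    fix x assume x: "x \<in> loop_ucs UNIV (Suc i)"
    show "e \<cdot> x = x" "iv x \<in> loop_ucs UNIV (Suc i)" using x iv unfolding mem by (auto simp: D_iv e_iv)
  next
    fix x y assume x: "x \<in> loop_ucs UNIV (Suc i)" and y: "y \<in> loop_ucs UNIV (Suc i)"
    have "D (x \<cdot> y) u v \<in> ?Z" for u v
    proof -
      have 1: "iv (x \<cdot> y) \<cdot> (T u v x \<cdot> y) \<in> ?Z"
        by (rule coset_mul[OF Suc]) (use x in \<open>simp add: mem flip: D_def del: loop_ucs.simps\<close>)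
      have 2: "iv (y \<cdot> T u v x) \<cdot> (T u v y \<cdot> T u v x) \<in> ?Z"
        by (rule coset_mul[OF Suc]) (use y in \<open>simp add: mem flip: D_def del: loop_ucs.simps\<close>)
      show ?thesis using coset_trans[OF Suc 1, of "T u v (x \<cdot> y)"] 2
        by (simp add: D_def T_mul comm)
    qed
    then show "x \<cdot> y \<in> loop_ucs UNIV (Suc i)" by (simp add: mem e_mul del: loop_ucs.simps)
  next
    fix a b x assume x: "e \<cdot> x = x"
    have *: "T a b y \<in> loop_ucs UNIV (Suc i)" if "y \<in> loop_ucs UNIV (Suc i)" for a b y
    proof -
      have "D (T a b y) u v = T a b (D y (T b a u) (T b a v))" for u v
        by (simp only: TD T_T) (simp only: D_def T_el)
      then show ?thesis using that T by (simp add: mem del: loop_ucs.simps)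
    qed
    show "T a b x \<in> loop_ucs UNIV (Suc i) \<longleftrightarrow> x \<in> loop_ucs UNIV (Suc i)"
      using *[of x a b] *[of "T a b x" b a] by (auto simp: T_T x simp del: loop_ucs.simps)
  qed
qed

lemma loop_ucs_Suc: "loop_ucs UNIV i \<subseteq> loop_ucs UNIV (Suc i)"
proof (induction i)
  case 0
  then show ?case by (auto simp: D_mid_e e_e)
next
  case (Suc i)
  then show ?case unfolding loop_ucs.simps(2)[of UNIV "Suc i"] by (auto simp del: loop_ucs.simps simp: loop_ucs.simps(2)[of UNIV i])
qed

lemma loop_ucs_mono: "i \<le> j \<Longrightarrow> loop_ucs UNIV i \<subseteq> loop_ucs UNIV j"
  by (rule lift_Suc_mono_le[of "loop_ucs UNIV"]) (rule loop_ucs_Suc)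

lemma loop_ucs_omega_normal_sub: "normal_sub (\<Union>i. loop_ucs UNIV i)" (is "normal_sub ?Z")
proof -
  have mul: "x \<cdot> y \<in> ?Z" if xy: "x \<in> ?Z" "y \<in> ?Z" for x y
  proof -
    obtain i j where that: "x \<in> loop_ucs UNIV i" "y \<in> loop_ucs UNIV j" using xy by blast
    have "x \<in> loop_ucs UNIV (max i j)" "y \<in> loop_ucs UNIV (max i j)" using that loop_ucs_mono by (meson max.cobounded1 max.cobounded2 subsetD)+
    then show ?thesis using loop_ucs_normal_sub[of "max i j"] unfolding normal_sub_def by blast
  qed
  have T: "(T a b x \<in> (\<Union>i. loop_ucs UNIV i)) = (x \<in> (\<Union>i. loop_ucs UNIV i))" if "e \<cdot> x = x" for a b x
  proof -
    have "T a b x \<in> loop_ucs UNIV i \<longleftrightarrow> x \<in> loop_ucs UNIV i" for i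
      using loop_ucs_normal_sub[of i] that by (simp add: normal_sub_def)
    then show ?thesis by simp
  qed
  have "e \<in> loop_ucs UNIV i" "x \<in> loop_ucs UNIV i \<Longrightarrow> e \<cdot> x = x \<and> iv x \<in> loop_ucs UNIV i" for i x
    using loop_ucs_normal_sub[of i] by (simp_all add: normal_sub_def)
  then have "e \<in> ?Z" "\<And>x. x \<in> ?Z \<Longrightarrow> e \<cdot> x = x \<and> iv x \<in> ?Z"
    by (meson UN_I UN_E UNIV_I)+
  then show ?thesis unfolding normal_sub_def using mul T by simp
qed

text \<open>The relation \<open>C\<close> spreads from \<open>z\<close> to any two elements of the
  orbit by applying an inner mapping to both (\<open>C_T\<close>), the orbit being invariant;
  \<open>C_mul\<close> and \<open>C_iv\<close> then carry it to the generated subloop.\<close>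

lemma inner_orb_normal_sub:
  assumes "\<And>k q. q \<in> inner_orb z k \<Longrightarrow> C z q"
  defines "N \<equiv> gen (\<Union>k. inner_orb z k)"
  shows "normal_sub N" "\<And>n m. n \<in> N \<Longrightarrow> m \<in> N \<Longrightarrow> C n m" "e \<cdot> z \<in> N"
proof -
  have oT: "T u v q \<in> inner_orb z (Suc k)" if "q \<in> inner_orb z k" for u v q k using that by auto
  have o: "C q q'" if "q \<in> inner_orb z k" "q' \<in> inner_orb z k'" for q q' k k'
    using that
  proof (induction k arbitrary: q q' k')
    case 0
    then show ?case using assms(1) by (auto simp: C_el)
  next
    case (Suc k)
    then obtain u v p where q: "q = T u v p" "p \<in> inner_orb z k" by auto
    have "C (T u v p) (T u v (T v u q'))" by (rule C_T) (rule Suc.IH[OF q(2) oT[OF Suc.prems(2)]])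
    then show ?case by (simp add: q T_T C_el)
  qed
  have o': "C n q'" if "n \<in> N" "q' \<in> inner_orb z k'" for n q' k'
    using that unfolding N_def
    by (induction rule: gen.induct) (auto simp: C_el intro: C_e C_sym o C_mul C_iv)
  show "C n m" if "n \<in> N" "m \<in> N" for n m
    using that(2) unfolding N_def
    by (induction rule: gen.induct) (auto simp: C_el intro: C_e C_mul C_iv o'[OF that(1)])
  have 1: "T u v n \<in> N" if "n \<in> N" for u v n
    using that unfolding N_def
  proof (induction rule: gen.induct)
    case (gen_in g)
    then have "e \<cdot> T u v g \<in> N" unfolding N_def using oT by (intro gen.gen_in) blast
    then show ?case by (simp add: T_ee N_def)
  qed (auto simp: T_mul T_iv intro: gen.intros)
  have "T u v x \<in> N \<longleftrightarrow> x \<in> N" if "e \<cdot> x = x" for u v x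
    using 1[of x u v] 1[of "T u v x" v u] that by (auto simp: T_T)
  then show "normal_sub N" unfolding normal_sub_def using gen_el gen_e gen_iv gen_mul N_def by blast
  have "e \<cdot> (e \<cdot> z) \<in> N" unfolding N_def by (rule gen_in, rule UN_I[of 0]) auto
  then show "e \<cdot> z \<in> N" by (simp add: e_mul)
qed

text \<open>Take an element of the first nontrivial term of the upper central series of
  \<open>H\<close>.\<close>

lemma loop_ucs_ex_central:
  assumes "loop_ucs H m = H" "H \<noteq> {e}" and eH: "e \<in> H" shows "\<exists>z\<in>H. z \<noteq> e \<and> (\<forall>h\<in>H. \<forall>h'\<in>H. T h h' z = e \<cdot> z)"
proof -
  define k where "k = (LEAST k. loop_ucs H k \<noteq> {e})"
  have k: "loop_ucs H k \<noteq> {e}" unfolding k_def by (rule LeastI[of _ m]) (use assms in auto)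
  then obtain j where j: "k = Suc j" by (cases k) auto
  have "loop_ucs H j = {e}" using not_less_Least[of j "\<lambda>k. loop_ucs H k \<noteq> {e}"] j k_def by auto
  from eH have "e \<in> loop_ucs H k" using \<open>loop_ucs H j = {e}\<close> by (simp add: j D_mid_e e_e eH)
  then obtain z where z: "z \<in> loop_ucs H k" "z \<noteq> e" using k by blast
  then have "z \<in> H" "\<forall>u\<in>H. \<forall>v\<in>H. D v z u = e" using \<open>loop_ucs H j = {e}\<close> by (auto simp: j)
  then show ?thesis using z(2) by (intro bexI[of _ z]) (auto simp: D_eq_e intro: T_perm)
qed
end

context quot
begin
lemma loop_ucs_pull: assumes "N \<subseteq> loop_ucs UNIV j" shows "\<rho> x \<in> q.loop_ucs UNIV i \<Longrightarrow> e \<cdot> x \<in> loop_ucs UNIV (i + j)"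
proof (induction i arbitrary: x)
  case 0
  then show ?case using assms by (auto simp: rho_N)
next
  case (Suc i)
  have "D v x u \<in> loop_ucs UNIV (i + j)" for u v
    using Suc.IH[of "D v x u"] Suc.prems by (simp add: q_D rho_D)
  moreover have "D v (e \<cdot> x) u = D v x u" for u v by (simp add: D_def T_el)
  ultimately show ?case by (simp add: e_mul)
qed
end

context quot3
begin
lemma q_normal_sub: assumes M: "normal_sub M" shows "q.normal_sub (\<rho> ` M)"
proof -
  have T: "q.T a b x \<in> \<rho> ` M" if "x \<in> \<rho> ` M" for a b x
  proof -
    obtain m where "m \<in> M" "x = \<rho> m" using \<open>x \<in> \<rho> ` M\<close> by blast
    moreover have "T a b m \<in> M" using M \<open>m \<in> M\<close> by (simp add: normal_sub_def)
    ultimately show ?thesis by (auto simp: q_T rho_T)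
  qed
  have "q.T a b x \<in> \<rho> ` M \<longleftrightarrow> x \<in> \<rho> ` M" if "\<rho> (\<rho> e \<cdot> x) = x" for a b x
    using T[of x a b] T[of "q.T a b x" b a] that by (auto simp: q.T_T)
  moreover have "\<rho> e \<in> \<rho> ` M" "\<And>m. m \<in> M \<Longrightarrow> \<rho> (iv m) \<in> \<rho> ` M"
    "\<And>m m'. m \<in> M \<Longrightarrow> m' \<in> M \<Longrightarrow> \<rho> (m \<cdot> m') \<in> \<rho> ` M" using M by (auto simp: normal_sub_def)
  ultimately show ?thesis unfolding q.normal_sub_def by auto
qed

lemma coset_decomposition: "\<exists>n\<in>N. e \<cdot> x = \<rho> x \<cdot> n"
proof -
  have "iv (\<rho> x) \<cdot> x \<in> N" using rho_in coset_sym N by blast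
  moreover have "\<rho> x \<cdot> (iv (\<rho> x) \<cdot> x) = e \<cdot> x" by (rule left_inv')
  ultimately show ?thesis by metis
qed
end

section \<open>Finitely generated loops of exponent 3\<close>

context cml3
begin
context
  fixes N assumes N: "normal_sub N" and central: "\<And>u v n. n \<in> N \<Longrightarrow> T u v n = n" "\<And>u v n. n \<in> N \<Longrightarrow> T n u v = e \<cdot> v"
begin
lemma central_medial: assumes "n \<in> N" "m \<in> N" shows "(a \<cdot> n) \<cdot> (b \<cdot> m) = (a \<cdot> b) \<cdot> (n \<cdot> m)"
proof -
  have "(a \<cdot> n) \<cdot> (b \<cdot> m) = n \<cdot> (a \<cdot> (b \<cdot> m))"
    using T_mulL[of n a "b \<cdot> m"] by (simp add: central assms mul_e2 comm[of a n] e_mul)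
  also have "\<dots> = n \<cdot> (m \<cdot> (a \<cdot> b))"
    using T_mulL[of a b m] by (simp add: central assms comm[of m])
  also have "\<dots> = (n \<cdot> m) \<cdot> (a \<cdot> b)"
    using T_mulL[of n m "a \<cdot> b"] by (simp add: central assms mul_e2 e_mul)
  finally show ?thesis by (simp only: comm[of "n \<cdot> m"])
qed

text \<open>Central elements of exponent 3 behave like vectors over the field with three elements,
  so adjoining \<open>x\<close> amounts to multiplying by \<open>{e, x, iv x}\<close>.\<close>

lemma central_closure:
  assumes "finite K" "K \<subseteq> N"
  shows "\<exists>Z. finite Z \<and> Z \<subseteq> N \<and> K \<subseteq> Z \<and> e \<in> Z \<and> (\<forall>x\<in>Z. iv x \<in> Z) \<and> (\<forall>x\<in>Z. \<forall>y\<in>Z. x \<cdot> y \<in> Z)"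
  using assms
proof (induction K rule: finite_induct)
  case empty
  then show ?case using N by (intro exI[of _ "{e}"]) (auto simp: normal_sub_def iv_ee e_e)
next
  case (insert x K)
  then have "K \<subseteq> N" by simp
  from insert.IH[OF this] obtain Z where "finite Z \<and> Z \<subseteq> N \<and> K \<subseteq> Z \<and> e \<in> Z \<and> (\<forall>x\<in>Z. iv x \<in> Z) \<and> (\<forall>x\<in>Z. \<forall>y\<in>Z. x \<cdot> y \<in> Z)" ..
  then have Z: "finite Z" "Z \<subseteq> N" "K \<subseteq> Z" "e \<in> Z" "\<And>x. x \<in> Z \<Longrightarrow> iv x \<in> Z" "\<And>x y. x \<in> Z \<Longrightarrow> y \<in> Z \<Longrightarrow> x \<cdot> y \<in> Z"
    by simp_all
  have x: "x \<in> N" "e \<cdot> x = x" using insert.prems N by (auto simp: normal_sub_def)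
  define A where "A = {e, x, iv x}"
  have A: "A \<subseteq> N" "e \<in> A" "x \<in> A" "\<And>a. a \<in> A \<Longrightarrow> iv a \<in> A" "\<And>a b. a \<in> A \<Longrightarrow> b \<in> A \<Longrightarrow> a \<cdot> b \<in> A"
    using x N by (auto simp: A_def normal_sub_def iv_ee iv_iv e_iv e_e exp3 inv_l inv_r comm[of _ e])
  show ?case
  proof (intro exI[of _ "(\<lambda>(a, z). a \<cdot> z) ` (A \<times> Z)"] conjI ballI)
    show "finite ((\<lambda>(a, z). a \<cdot> z) ` (A \<times> Z))" using Z by (simp add: A_def)
    show "(\<lambda>(a, z). a \<cdot> z) ` (A \<times> Z) \<subseteq> N" using A(1) Z(2) N unfolding normal_sub_def by (auto 0 0 dest!: subsetD)
    show "insert x K \<subseteq> (\<lambda>(a, z). a \<cdot> z) ` (A \<times> Z)"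
    proof
      fix y assume "y \<in> insert x K"
      show "y \<in> (\<lambda>(a, z). a \<cdot> z) ` (A \<times> Z)"
      proof (cases "y = x")
        case True
        then show ?thesis using A(3) Z(4) by (intro image_eqI[of _ _ "(x, e)"]) (auto simp: comm[of x e] x(2))
      next
        case False
        then have "y \<in> Z" "e \<cdot> y = y" using \<open>y \<in> insert x K\<close> Z(2,3) N unfolding normal_sub_def by auto
        then show ?thesis using A(2) by (intro image_eqI[of _ _ "(e, y)"]) auto
      qed
    qed
    show "e \<in> (\<lambda>(a, z). a \<cdot> z) ` (A \<times> Z)" using A(2) Z(4) e_e by (intro image_eqI[of _ _ "(e, e)"]) auto
  next
    fix y assume "y \<in> (\<lambda>(a, z). a \<cdot> z) ` (A \<times> Z)"
    then obtain a z where "a \<in> A" "z \<in> Z" "y = a \<cdot> z" by auto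
    then show "iv y \<in> (\<lambda>(a, z). a \<cdot> z) ` (A \<times> Z)" using A(4) Z(5) by (intro image_eqI[of _ _ "(iv a, iv z)"]) (auto simp: iv_mul)
  next
    fix y y' assume "y \<in> (\<lambda>(a, z). a \<cdot> z) ` (A \<times> Z)" "y' \<in> (\<lambda>(a, z). a \<cdot> z) ` (A \<times> Z)"
    then obtain a z a' z' where *: "a \<in> A" "z \<in> Z" "y = a \<cdot> z" "a' \<in> A" "z' \<in> Z" "y' = a' \<cdot> z'" by auto
    then have "y \<cdot> y' = (a \<cdot> a') \<cdot> (z \<cdot> z')" using central_medial[of z z' a a'] Z(2) by auto
    moreover have "(a \<cdot> a', z \<cdot> z') \<in> A \<times> Z" using * A(5) Z(6) by auto
    ultimately show "y \<cdot> y' \<in> (\<lambda>(a, z). a \<cdot> z) ` (A \<times> Z)" by (metis (no_types, lifting) case_prod_conv image_eqI)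
  qed
qed
end
end

text \<open>Induction on the class, with the operations arbitrary because it passes to a quotient.
  The quotient by the centre is finite; its representatives times a suitable finite central subloop
  \<open>Z\<close> form a set that contains the generators and is closed under all operations, as in
  Schreier's argument.\<close>

lemma cml3_finite:
  assumes "cml3 mul iv e" "finite G" "\<And>x. mul e x \<in> cml.gen mul iv e G" "\<And>x. mul e x \<in> cml.loop_ucs mul iv e UNIV k"
  shows "finite {x. mul e x = x}"
  using assms
proof (induction k arbitrary: mul iv e G)
  case 0
  interpret cml3 mul iv e by fact
  have "{x. mul e x = x} \<subseteq> {e}" using "0.prems"(4) by auto
  then show ?case by (rule finite_subset) simp
next
  case (Suc k)
  interpret cml3 mul iv e by fact
  define N where "N = loop_ucs UNIV 1"
  interpret quot3 mul iv e N "\<lambda>x. SOME y. mul (iv x) y \<in> N"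
    by unfold_locales (simp_all add: N_def loop_ucs_normal_sub del: loop_ucs.simps)
  define \<rho> where "\<rho> = (\<lambda>x. SOME y. mul (iv x) y \<in> N)"
  have central: "T u v n = n" "T u n v = mul e v" "T n u v = mul e v" if "n \<in> N" for u v n
  proof -
    have "D v n u = e" "mul e n = n" using that by (auto simp: N_def)
    then have "T n u v = mul e v" by (simp add: D_eq_e)
    from T_perm[OF this] this \<open>mul e n = n\<close> show "T u v n = n" "T u n v = mul e v" "T n u v = mul e v" by simp_all
  qed
  have "finite {x. \<rho> (mul (\<rho> e) x) = x}"
    unfolding \<rho>_def
  proof (rule Suc.IH)
    show "cml3 (\<lambda>x y. SOME y'. mul (iv (mul x y)) y' \<in> N) (\<lambda>x. SOME y. mul (iv (iv x)) y \<in> N) (SOME y. mul (iv e) y \<in> N)"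
      by (rule q.cml3_axioms)
    have Zq: "\<rho> x \<in> q.loop_ucs UNIV i" if "x \<in> loop_ucs UNIV (Suc i)" for x i
      using that
    proof (induction i arbitrary: x)
      case 0
      then have "mul e x \<in> N" by (auto simp: N_def)
      then show ?case by (simp add: \<rho>_def rho_N)
    next
      case (Suc i)
      then have "D v x u \<in> loop_ucs UNIV (Suc i)" for u v by simp
      then show ?case using Suc.IH unfolding \<rho>_def by (auto simp: q_D rho_D)
    qed
    show "(SOME y. mul (iv (mul (SOME y. mul (iv e) y \<in> N) x)) y \<in> N) \<in> q.loop_ucs UNIV k" for x
      using Zq[OF Suc.prems(4)[of x]] unfolding \<rho>_def by simp
    show "(SOME y. mul (iv (mul (SOME y. mul (iv e) y \<in> N) x)) y \<in> N) \<in> q.gen (\<rho> ` G)" for x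
      using q_gen[OF Suc.prems(3)[of x]] unfolding \<rho>_def by simp
  qed (use Suc.prems in simp)
  then have finR: "finite (range \<rho>)"
    by (rule finite_subset[rotated]) (auto simp: \<rho>_def)
  define c where "c x = mul (iv (\<rho> x)) x" for x
  have c: "c x \<in> N" "mul e x = mul (\<rho> x) (c x)" for x
    unfolding c_def \<rho>_def using rho_in[of x] coset_sym[OF N] by (auto simp: left_inv')
  \<comment> \<open>These are the central corrections by which the representatives fail to contain
    the generators and \<open>e\<close> and to be closed under products and inverses.\<close>
  define K where "K = c ` (G \<union> {e} \<union> (\<lambda>(x, y). mul x y) ` (range \<rho> \<times> range \<rho>) \<union> iv ` range \<rho>)"
  have "finite K" unfolding K_def using finR Suc.prems by auto
  have KN: "K \<subseteq> N" using c K_def by auto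
  have "\<exists>Z. finite Z \<and> Z \<subseteq> N \<and> K \<subseteq> Z \<and> e \<in> Z \<and> (\<forall>x\<in>Z. iv x \<in> Z) \<and> (\<forall>x\<in>Z. \<forall>y\<in>Z. mul x y \<in> Z)"
    by (rule central_closure[OF N _ _ \<open>finite K\<close> KN]) (use central in auto)
  then obtain Z where "finite Z \<and> Z \<subseteq> N \<and> K \<subseteq> Z \<and> e \<in> Z \<and> (\<forall>x\<in>Z. iv x \<in> Z) \<and> (\<forall>x\<in>Z. \<forall>y\<in>Z. mul x y \<in> Z)" ..
  then have Z: "finite Z" "Z \<subseteq> N" "K \<subseteq> Z" "e \<in> Z" "\<And>x. x \<in> Z \<Longrightarrow> iv x \<in> Z" "\<And>x y. x \<in> Z \<Longrightarrow> y \<in> Z \<Longrightarrow> mul x y \<in> Z"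
    by simp_all
  have medial: "mul (mul a n) (mul b m) = mul (mul a b) (mul n m)" if "n \<in> N" "m \<in> N" for a b n m
    by (rule central_medial[OF N]) (use central that in auto)
  define S where "S = (\<lambda>(r, z). mul r z) ` (range \<rho> \<times> Z)"
  have S: "mul (mul e x) z \<in> S" if "c x \<in> Z" "z \<in> Z" for x z
  proof -
    have "mul (mul e x) z = mul (\<rho> x) (mul (c x) z)"
      using medial[OF subsetD[OF Z(2) that(1)] subsetD[OF Z(2) that(2)], of "\<rho> x" e] unfolding c(2)[of x]
      by (simp only: mul_e2 comm[of "\<rho> x" e] mul_e)
    then show ?thesis using Z(6) that unfolding S_def by force
  qed
  have S': "mul e x \<in> S" if "c x \<in> Z" for x
    using S[OF that Z(4)] by (metis comm e_mul)
  have "x \<in> S" if "x \<in> gen G" for x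
    using that
  proof (induction rule: gen.induct)
    case gen_e
    have "c e \<in> Z" using Z(3) by (auto simp: K_def)
    then show ?case using S'[of e] by (simp add: e_e)
  next
    case (gen_in g)
    then have "c g \<in> Z" using Z(3) by (auto simp: K_def)
    then show ?case using S'[of g] by simp
  next
    case (gen_iv x)
    then obtain r z where "r \<in> range \<rho>" "z \<in> Z" "x = mul r z" by (auto simp: S_def)
    moreover from this have "c (iv r) \<in> Z" using Z(3) by (auto simp: K_def)
    ultimately show ?case using S[of "iv r" "iv z"] Z(5) by (simp add: iv_mul e_iv)
  next
    case (gen_mul x y)
    from gen_mul.IH(1) obtain r z where "r \<in> range \<rho>" "z \<in> Z" "x = mul r z" by (auto simp: S_def)
    moreover from gen_mul.IH(2) obtain r' z' where "r' \<in> range \<rho>" "z' \<in> Z" "y = mul r' z'" by (auto simp: S_def)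
    ultimately have *: "r \<in> range \<rho>" "z \<in> Z" "x = mul r z" "r' \<in> range \<rho>" "z' \<in> Z" "y = mul r' z'" by simp_all
    then have "(\<lambda>(x, y). mul x y) (r, r') \<in> (\<lambda>(x, y). mul x y) ` (range \<rho> \<times> range \<rho>)" by (intro imageI) auto
    then have "c (mul r r') \<in> K" unfolding K_def by (intro imageI) simp
    then have "c (mul r r') \<in> Z" using Z(3) by blast
    then show ?case using S[of "mul r r'" "mul z z'"] Z(6) * medial[of z z' r r'] Z(2) by (simp add: e_mul subset_eq)
  qed
  moreover have "finite S" unfolding S_def using finR Z(1) by auto
  moreover have "x \<in> gen G" if "mul e x = x" for x using Suc.prems(3)[of x] that by simp
  ultimately show ?case using finite_subset[of "{x. mul e x = x}" S] by blast
qed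

text \<open>If \<open>z\<close> were outside the union \<open>Om\<close> of the upper central series, the quotient by \<open>Om\<close> would contain a
nontrivial central element of the image of \<open>N\<close>. Its associators take finitely many values, which lie
in one term of the series, a contradiction.\<close>
lemma cml3_nilpotent_adjoin:
  assumes "cml3 mul iv e" "finite H" "e \<in> H" "\<And>x. x \<in> H \<Longrightarrow> mul e x = x \<and> iv x \<in> H"
    "\<And>x y. x \<in> H \<Longrightarrow> y \<in> H \<Longrightarrow> mul x y \<in> H" "cml.loop_ucs mul iv e H m = H"
    "\<And>x. mul e x \<in> cml.gen mul iv e (insert y H)"
  shows "\<exists>k. \<forall>x. mul e x \<in> cml.loop_ucs mul iv e UNIV k"
  using assms
proof (induction "card H" arbitrary: mul iv e H y rule: less_induct)
  case less
  interpret cml3 mul iv e by fact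
  show ?case
  proof (cases "H = {e}")
    case True
    \<comment> \<open>With \<open>H\<close> trivial the loop is generated by \<open>y\<close> alone,
      and \<open>C y y\<close> spreads to all pairs: the loop is its own centre.\<close>
    have 1: "C y q" if "q \<in> gen (insert y H)" for q
      using that by (induction rule: gen.induct) (auto simp: True C_el C_self intro: C_e C_mul C_iv)
    have 2: "C p q" if "q \<in> gen (insert y H)" "p \<in> gen (insert y H)" for p q
      using that(2) by (induction rule: gen.induct) (auto simp: True C_el intro: 1[OF that(1)] C_e C_sym[OF C_e] C_mul' C_iv')
    have "C (mul e p) (mul e q)" for p q using 2 less.prems(7) by blast
    then have "T p q v = mul e v" for p q v unfolding C_def T_el by blast
    then have "mul e x \<in> loop_ucs UNIV 1" for x by (simp add: e_mul D_eq_e T_el)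
    then show ?thesis by blast
  next
    case False
    obtain z where z: "z \<in> H" "z \<noteq> e" "\<And>h h'. h \<in> H \<Longrightarrow> h' \<in> H \<Longrightarrow> T h h' z = mul e z"
      using loop_ucs_ex_central[OF less.prems(6) False less.prems(3)] by blast
    have orbC: "C z q" if "q \<in> inner_orb z k" for q k
      by (rule inner_orb_C[OF less.prems(7) order_refl z(3) that])
    define N where "N = gen (\<Union>k. inner_orb z k)"
    have N: "normal_sub N" unfolding N_def by (rule inner_orb_normal_sub(1)) (rule orbC)
    have NC: "C n m" if "n \<in> N" "m \<in> N" for n m
      by (rule inner_orb_normal_sub(2)[OF orbC _ _]) (use that in \<open>simp_all add: N_def\<close>)
    have zN: "mul e z \<in> N" unfolding N_def by (rule inner_orb_normal_sub(3)) (rule orbC)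
    define \<rho> where "\<rho> = (\<lambda>x. SOME y. mul (iv x) y \<in> N)"
    interpret quot3 mul iv e N \<rho>
      by unfold_locales (simp_all only: N \<rho>_def)
    have "\<rho> z = \<rho> e" using zN by (simp add: rho_N)
    have "\<exists>k. \<forall>x. \<rho> (mul (\<rho> e) x) \<in> q.loop_ucs UNIV k"
    proof (rule less.hyps)
      have "\<not> inj_on \<rho> H" using \<open>\<rho> z = \<rho> e\<close> z less.prems(3) unfolding inj_on_def by blast
      then show "card (\<rho> ` H) < card H"
        using less.prems(2) by (metis card_image_le eq_card_imp_inj_on le_neq_implies_less)
      show "cml3 (\<lambda>x y. \<rho> (mul x y)) (\<lambda>x. \<rho> (iv x)) (\<rho> e)" by (rule q.cml3_axioms)
      have "\<rho> ` H = \<rho> ` loop_ucs H m" by (simp only: less.prems(6))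
      also have "\<dots> \<subseteq> q.loop_ucs (\<rho> ` H) m" using q_loop_ucs by blast
      also have "q.loop_ucs (\<rho> ` H) m \<subseteq> \<rho> ` H" by (cases m) (use less.prems(3) in auto)
      finally show "q.loop_ucs (\<rho> ` H) m = \<rho> ` H" using \<open>q.loop_ucs (\<rho> ` H) m \<subseteq> \<rho> ` H\<close> by blast
      show "\<rho> (mul (\<rho> e) x) \<in> q.gen (insert (\<rho> y) (\<rho> ` H))" for x
        using q_gen[OF less.prems(7)[of x]] by simp
    qed (use less.prems in auto)
    then obtain k where k: "\<And>x. \<rho> x \<in> q.loop_ucs UNIV k" by auto
    have "finite {x. \<rho> (mul (\<rho> e) x) = x}"
    proof (rule cml3_finite[OF q.cml3_axioms])
      show "finite (\<rho> ` insert y H)" using less.prems(2) by simp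
      show "\<rho> (mul (\<rho> e) x) \<in> q.gen (\<rho> ` insert y H)" for x
        using q_gen[OF less.prems(7)[of x]] by simp
      show "\<rho> (mul (\<rho> e) x) \<in> q.loop_ucs UNIV k" for x using k by simp
    qed
    then have finR: "finite (range \<rho>)" by (rule finite_subset[rotated]) auto
    define Om where "Om = (\<Union>i. loop_ucs UNIV i)"
    have "z \<in> Om"
    proof (rule ccontr)
      assume zO: "z \<notin> Om"
      define \<sigma> where "\<sigma> = (\<lambda>x. SOME y. mul (iv x) y \<in> Om)"
      interpret w: quot3 mul iv e Om \<sigma>
        by unfold_locales (simp_all only: Om_def loop_ucs_omega_normal_sub \<sigma>_def)
      \<comment> \<open>The upper central series of the quotient by \<open>N\<close>, lifted to the
        loop and mapped to the quotient by \<open>Om\<close>. It runs from inside the image of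
        \<open>N\<close> up to everything.\<close>
      define A where "A i = \<sigma> ` {a. \<rho> a \<in> q.loop_ucs UNIV i}" for i
      have "\<exists>c\<in>\<sigma> ` N. c \<noteq> \<sigma> e \<and> (\<forall>u v. w.q.T u v c = c)"
      proof (rule w.q.central_element_exists)
        show "w.q.normal_sub (\<sigma> ` N)" by (rule w.q_normal_sub[OF N])
        show "w.q.C n m" if "n \<in> \<sigma> ` N" "m \<in> \<sigma> ` N" for n m
          using that NC unfolding w.q.C_def C_def by (auto simp: w.q_T w.rho_T)
        show "\<sigma> z \<in> \<sigma> ` N" using zN z(1) less.prems(4) by simp
        show "\<sigma> z \<noteq> \<sigma> e" using zO z(1) less.prems(4) by (simp add: w.rho_N)
        show "finite (range \<rho>)" by fact
        show "\<exists>r\<in>range \<rho>. \<exists>n\<in>\<sigma> ` N. \<sigma> (mul (\<sigma> e) x) = \<sigma> (mul r n)" for x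
        proof -
          obtain n where "n \<in> N" "mul e x = mul (\<rho> x) n" using coset_decomposition by blast
          then have "\<sigma> (mul (\<sigma> e) x) = \<sigma> (mul (\<rho> x) (\<sigma> n))" by simp
          then show ?thesis using \<open>n \<in> N\<close> by blast
        qed
        show "A 0 \<subseteq> \<sigma> ` N"
        proof -
          have "\<sigma> a \<in> \<sigma> ` N" if "\<rho> a = \<rho> e" for a
            using that imageI[of "mul e a" N \<sigma>] by (simp add: rho_N)
          then show ?thesis by (auto simp: A_def)
        qed
        show "w.q.T u v a \<in> A i" if "a \<in> A i" for i a u v
        proof -
          obtain b where b: "a = \<sigma> b" "\<rho> b \<in> q.loop_ucs UNIV i" using \<open>a \<in> A i\<close> by (auto simp: A_def)
          have "q.T u v (\<rho> b) \<in> q.loop_ucs UNIV i"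
            using q.normal_sub_T[OF q.loop_ucs_normal_sub, of "\<rho> b" u v i] b(2) by simp
          then show ?thesis unfolding A_def b by (simp add: w.q_T w.rho_T q_T rho_T)
        qed
        show "w.q.D v a u \<in> A i" if "a \<in> A (Suc i)" for i a u v
        proof -
          obtain b where b: "a = \<sigma> b" "\<rho> b \<in> q.loop_ucs UNIV (Suc i)" using \<open>a \<in> A (Suc i)\<close> by (auto simp: A_def)
          then have "q.D v (\<rho> b) u \<in> q.loop_ucs UNIV i" by simp
          then show ?thesis unfolding A_def b by (simp add: w.q_D w.rho_D q_D rho_D)
        qed
        show "\<sigma> (mul (\<sigma> e) x) \<in> A k" for x using k by (simp add: A_def)
      qed
      then obtain c where c: "c \<in> N" "\<sigma> c \<noteq> \<sigma> e" "\<And>u v. \<sigma> (T u v c) = \<sigma> c"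
        by (auto simp: w.q_T w.rho_T)
      have DO: "D c u v \<in> Om" for u v
        using c(3)[of u v] coset_sym[OF w.N] unfolding w.rho_eq D_def by blast
      have "\<exists>i. D c u v \<in> loop_ucs UNIV i" for u v using DO by (simp add: Om_def)
      then obtain f where f: "\<And>u v. D c u v \<in> loop_ucs UNIV (f u v)" by metis
      define l where "l = Max ((\<lambda>(u, v). f u v) ` (range \<rho> \<times> range \<rho>))"
      have "D c (\<rho> u) (\<rho> v) \<in> loop_ucs UNIV l" for u v
      proof -
        have "f (\<rho> u) (\<rho> v) \<le> l" unfolding l_def by (rule Max_ge) (use finR in auto)
        then show ?thesis using f loop_ucs_mono by blast
      qed
      moreover have "D c u v = D c (\<rho> u) (\<rho> v)" for u v
      proof -
        obtain n n' where n: "n \<in> N" "mul e u = mul (\<rho> u) n" "n' \<in> N" "mul e v = mul (\<rho> v) n'" using coset_decomposition by metis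
        have "T u v c = T (mul (\<rho> u) n) (mul (\<rho> v) n') c" unfolding n(2,4)[symmetric] by (simp add: T_el)
        also have "\<dots> = T (\<rho> u) (\<rho> v) c" by (simp only: T_C_mul1[OF NC[OF c(1) n(1)]] T_C_mul2[OF NC[OF c(1) n(3)]])
        finally show ?thesis by (simp add: D_def)
      qed
      ultimately have "D v c u \<in> loop_ucs UNIV l" for u v by (simp only: D_cyc[of v c u] D_cyc[of u v c])
      moreover have ec: "mul e c = c" using c(1) N by (simp add: normal_sub_def)
      ultimately have "c \<in> loop_ucs UNIV (Suc l)" by simp
      then have "c \<in> Om" unfolding Om_def by blast
      then show False using c(2) ec by (simp add: w.rho_N)
    qed
    then obtain j where j: "z \<in> loop_ucs UNIV j" by (auto simp: Om_def)
    have "inner_orb z i \<subseteq> loop_ucs UNIV j" for i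
    proof (induction i)
      case 0
      then show ?case using j z(1) less.prems(4) by simp
    next
      case (Suc i)
      then show ?case using loop_ucs_normal_sub[of j] unfolding normal_sub_def by (auto simp del: loop_ucs.simps)
    qed
    then have orbZ: "(\<Union>i. inner_orb z i) \<subseteq> loop_ucs UNIV j" by blast
    have "n \<in> loop_ucs UNIV j" if "n \<in> N" for n
      using that unfolding N_def
      by (induction rule: gen.induct) (use loop_ucs_normal_sub[of j] orbZ in \<open>auto simp: normal_sub_def simp del: loop_ucs.simps\<close>)
    then have "mul e x \<in> loop_ucs UNIV (k + j)" for x using loop_ucs_pull k by blast
    then show ?thesis by blast
  qed
qed

section \<open>Restriction to subloops and removal of the exponent condition\<close>

context cml
begin
lemma D_el: "D v (e \<cdot> a) u = D v a u" "D v a (e \<cdot> u) = D v a u" "D (e \<cdot> v) a u = D v a u"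
  by (simp_all add: D_def T_el T_ee iv_e)

lemma gen_el_eq: "gen ((\<lambda>g. e \<cdot> g) ` G) = gen G"
proof
  show "gen G \<subseteq> gen ((\<lambda>g. e \<cdot> g) ` G)"
  proof
    fix x assume "x \<in> gen G" then show "x \<in> gen ((\<lambda>g. e \<cdot> g) ` G)"
      by (induction rule: gen.induct)
        (auto intro: gen.intros simp: e_mul dest: gen_in[of "e \<cdot> _" "(\<lambda>g. e \<cdot> g) ` G", OF imageI])
  qed
  show "gen ((\<lambda>g. e \<cdot> g) ` G) \<subseteq> gen G" by (rule gen_mono) (auto intro: gen_in)
qed

lemma loop_ucs_car: assumes "\<And>x. e \<cdot> x \<in> H" shows "loop_ucs H i = loop_ucs UNIV i"
proof (induction i)
  case (Suc i)
  have "a \<in> H" if "e \<cdot> a = a" for a using assms[of a] that by simp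
  moreover have "(\<forall>u\<in>H. \<forall>v\<in>H. D v a u \<in> loop_ucs UNIV i) \<longleftrightarrow> (\<forall>u v. D v a u \<in> loop_ucs UNIV i)" for a
    using assms D_el by metis
  ultimately show ?case using Suc by auto
qed simp

lemma assoc_D: "D v a u = e \<longleftrightarrow> a \<cdot> (u \<cdot> v) = (a \<cdot> u) \<cdot> v"
proof -
  have "D v a u = e \<longleftrightarrow> e \<cdot> T a u v = e \<cdot> v"
    by (metis D_def T_D comm e_T inv_l mul_e2)
  also have "\<dots> \<longleftrightarrow> (a \<cdot> u) \<cdot> T a u v = (a \<cdot> u) \<cdot> v" by (rule cancel[symmetric])
  finally show ?thesis by (simp only: T_mulL)
qed

lemma loop_ucs_1: "x \<in> loop_ucs UNIV 1 \<longleftrightarrow> e \<cdot> x = x \<and> (\<forall>u v. x \<cdot> (u \<cdot> v) = (x \<cdot> u) \<cdot> v)"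
  by (simp add: assoc_D)

lemma T_inj: "T a b x = T a b y \<Longrightarrow> e \<cdot> x = e \<cdot> y"
  unfolding T_def by (metis cancel e_mul)

lemma loop_ucs_1_normal_sub: "normal_sub (loop_ucs UNIV 1)"
proof -
  have T: "T a b x = x" if "x \<in> loop_ucs UNIV 1" for a b x
  proof -
    have "a \<cdot> (b \<cdot> x) = (a \<cdot> b) \<cdot> x"
      using that[unfolded loop_ucs_1] by (metis comm)
    then show ?thesis using that[unfolded loop_ucs_1] by (simp add: T_def left_inv)
  qed
  have "x \<in> loop_ucs UNIV 1" if "T a b x \<in> loop_ucs UNIV 1" "e \<cdot> x = x" for a b x
  proof -
    have "e \<cdot> x = e \<cdot> T a b x" using T_inj[of a b x "T a b x"] T[OF that(1)] by simp
    then show ?thesis using that by simp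
  qed
  moreover have "iv x \<in> loop_ucs UNIV 1" if x: "x \<in> loop_ucs UNIV 1" for x
  proof -
    have "iv x \<cdot> (u \<cdot> v) = (iv x \<cdot> u) \<cdot> v" for u v
    proof -
      have "x \<cdot> ((iv x \<cdot> u) \<cdot> v) = u \<cdot> v" using x[unfolded loop_ucs_1] by (simp add: left_inv' mul_e)
      then show ?thesis by (metis left_inv e_mul)
    qed
    then show ?thesis unfolding loop_ucs_1 by (simp add: e_iv)
  qed
  moreover have "x \<cdot> y \<in> loop_ucs UNIV 1" if "x \<in> loop_ucs UNIV 1" "y \<in> loop_ucs UNIV 1" for x y
    using that unfolding loop_ucs_1 by (metis e_mul)
  moreover have "e \<in> loop_ucs UNIV 1" unfolding loop_ucs_1 by (simp add: e_e e_mul mul_e)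
  moreover have "e \<cdot> x = x" if "x \<in> loop_ucs UNIV 1" for x using that unfolding loop_ucs_1 by simp
  moreover have "T a b x \<in> loop_ucs UNIV 1" if "x \<in> loop_ucs UNIV 1" for a b x using T[OF that] that by (simp only:)
  ultimately show ?thesis unfolding normal_sub_def by (intro conjI ballI allI impI iffI)
qed
end

text \<open>Elements outside \<open>H\<close> are sent to \<open>e\<close>, so that the restricted
  operations are again total on the type.\<close>

locale restr = cml +
  fixes H r
  assumes eH: "e \<in> H" and elH: "\<And>x. x \<in> H \<Longrightarrow> e \<cdot> x = x" and ivH: "\<And>x. x \<in> H \<Longrightarrow> iv x \<in> H"
    and mulH: "\<And>x y. x \<in> H \<Longrightarrow> y \<in> H \<Longrightarrow> x \<cdot> y \<in> H"
  defines "r \<equiv> \<lambda>x. if x \<in> H then x else e"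
begin
lemma r_in: "r x \<in> H" by (simp add: r_def eH)

lemma r_id: "x \<in> H \<Longrightarrow> r x = x" by (simp add: r_def)

lemma r_simps [simp]: "r (r x) = r x" "r (r x \<cdot> r y) = r x \<cdot> r y" "r (iv (r x)) = iv (r x)" "r e = e" "e \<cdot> r x = r x"
  by (simp_all add: r_id r_in mulH ivH eH elH)

sublocale s: cml "\<lambda>x y. r x \<cdot> r y" "\<lambda>x. iv (r x)" e
proof unfold_locales
  show "r (r x \<cdot> r x) \<cdot> r (r y \<cdot> r z) = r (r x \<cdot> r y) \<cdot> r (r x \<cdot> r z)" for x y z
    unfolding r_simps by (rule moufang_sq)
qed (rule comm, simp_all add: left_inv e_mul e_iv e_e)

lemma s_T: "s.T a b u = T (r a) (r b) (r u)" by (simp add: s.T_def T_def r_id r_in mulH ivH)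

lemma s_D: "s.D a b u = D (r a) (r b) (r u)"
  by (simp add: s.D_def D_def s_T) (simp add: r_id r_in mulH ivH T_def)

lemma s_loop_ucs: "K \<subseteq> H \<Longrightarrow> s.loop_ucs K i = loop_ucs K i"
proof (induction i)
  case (Suc i)
  then have "\<And>x. x \<in> K \<Longrightarrow> r x = x" "\<And>x. x \<in> K \<Longrightarrow> e \<cdot> x = x" using r_id elH by auto
  then show ?case using Suc by (auto simp: s_D)
qed simp

lemma s_gen: "x \<in> gen G \<Longrightarrow> G \<subseteq> H \<Longrightarrow> x \<in> s.gen G \<and> x \<in> H"
proof (induction rule: gen.induct)
  case gen_e
  show ?case using s.gen_e eH by simp
next
  case (gen_in g)
  then have "r e \<cdot> r g \<in> s.gen G" by (intro s.gen_in) simp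
  then show ?case using gen_in by (auto simp: r_id elH)
next
  case (gen_iv x)
  then have "iv (r x) \<in> s.gen G" by (intro s.gen_iv) simp
  then show ?case using gen_iv by (simp add: r_id ivH)
next
  case (gen_mul x y)
  then have "r x \<cdot> r y \<in> s.gen G" by (intro s.gen_mul) simp_all
  then show ?case using gen_mul by (simp add: r_id mulH)
qed
end

locale restr3 = restr + cml3
begin
sublocale s: cml3 "\<lambda>x y. r x \<cdot> r y" "\<lambda>x. iv (r x)" e
  by unfold_locales (simp add: exp3)
end

context cml3
begin
text \<open>\<open>cml3_finite\<close> turns the nilpotency of \<open>gen G\<close> into the
  finiteness that \<open>cml3_nilpotent_adjoin\<close> requires for adjoining \<open>y\<close>. Both
  speak of a whole carrier and are therefore applied to restrictions.\<close>

lemma fgen_nilpotent: "finite G \<Longrightarrow> \<exists>k. loop_ucs (gen G) k = gen G"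
proof (induction G rule: finite_induct)
  case empty
  have "x = e" if "x \<in> gen {}" for x
    using that by (induction rule: gen.induct) (auto simp: iv_ee e_e)
  then have "gen {} = {e}" using gen_e by blast
  then have "loop_ucs (gen {}) 0 = gen {}" by simp
  then show ?case by blast
next
  case (insert y G)
  then obtain m where m: "loop_ucs (gen G) m = gen G" by blast
  define rH where "rH = (\<lambda>x. if x \<in> gen G then x else e)"
  interpret H: restr3 mul iv e "gen G" rH
    by unfold_locales (simp_all add: gen_e gen_el gen_iv gen_mul rH_def)
  have eG: "(\<lambda>g. e \<cdot> g) ` G \<subseteq> gen G" by (auto intro: gen_in)
  have "finite {x. rH e \<cdot> rH x = x}"
  proof (rule cml3_finite[OF H.s.cml3_axioms])
    show "finite ((\<lambda>g. e \<cdot> g) ` G)" using insert by simp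
    show "rH e \<cdot> rH x \<in> H.s.gen ((\<lambda>g. e \<cdot> g) ` G)" for x
      using H.s_gen[of "rH x" "(\<lambda>g. e \<cdot> g) ` G"] eG H.r_in[of x] by (simp add: gen_el_eq)
    have "H.s.loop_ucs UNIV m = loop_ucs (gen G) m"
      using H.s_loop_ucs[OF order_refl] H.s.loop_ucs_car[of "gen G"] H.r_in by simp
    then show "rH e \<cdot> rH x \<in> H.s.loop_ucs UNIV m" for x using H.r_in by (simp add: m)
  qed
  moreover have "gen G \<subseteq> {x. rH e \<cdot> rH x = x}" by (auto simp: H.r_id H.elH)
  ultimately have finH: "finite (gen G)" by (rule finite_subset[rotated])
  let ?K = "gen (insert y G)"
  define rK where "rK = (\<lambda>x. if x \<in> ?K then x else e)"
  interpret K: restr3 mul iv e ?K rK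
    by unfold_locales (simp_all add: gen_e gen_el gen_iv gen_mul rK_def)
  have GK: "gen G \<subseteq> ?K"
  proof
    fix x assume "x \<in> gen G" then show "x \<in> ?K"
      by (induction rule: gen.induct) (auto intro: gen.intros)
  qed
  have "\<exists>k. \<forall>x. rK e \<cdot> rK x \<in> K.s.loop_ucs UNIV k"
  proof (rule cml3_nilpotent_adjoin[OF K.s.cml3_axioms finH])
    show "e \<in> gen G" by (rule gen_e)
    show "rK e \<cdot> rK x = x \<and> iv (rK x) \<in> gen G" if "x \<in> gen G" for x
      using K.r_id[OF subsetD[OF GK that]] gen_el[OF that] gen_iv[OF that] by simp
    show "rK x \<cdot> rK z \<in> gen G" if "x \<in> gen G" "z \<in> gen G" for x z
      using K.r_id[OF subsetD[OF GK that(1)]] K.r_id[OF subsetD[OF GK that(2)]] gen_mul[OF that] by simp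
    show "K.s.loop_ucs (gen G) m = gen G" using K.s_loop_ucs[OF GK] m by simp
    show "rK e \<cdot> rK x \<in> K.s.gen (insert (e \<cdot> y) (gen G))" for x
    proof -
      have "?K \<subseteq> gen (insert (e \<cdot> y) (gen G))"
      proof
        fix x assume "x \<in> ?K" then show "x \<in> gen (insert (e \<cdot> y) (gen G))"
        proof (induction rule: gen.induct)
          case (gen_in g)
          have "e \<cdot> (e \<cdot> y) \<in> gen (insert (e \<cdot> y) (gen G))" by (intro gen.gen_in) simp
          moreover have "e \<cdot> (e \<cdot> g) \<in> gen (insert (e \<cdot> y) (gen G))" if "g \<in> G"
            using that by (intro gen.gen_in) (auto intro: gen.gen_in)
          ultimately show ?case using gen_in by (auto simp: e_mul)
        qed (auto intro: gen.intros)
      qed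
      moreover have "insert (e \<cdot> y) (gen G) \<subseteq> ?K" using GK by (auto intro: gen_in)
      ultimately show ?thesis using K.s_gen[of "rK x"] K.r_in[of x] by (simp add: subset_eq)
    qed
  qed
  then obtain k where "\<And>x. rK x \<in> K.s.loop_ucs UNIV k" by auto
  moreover have "K.s.loop_ucs UNIV k = loop_ucs ?K k"
    using K.s_loop_ucs[OF order_refl] K.s.loop_ucs_car[of ?K] K.r_in by simp
  ultimately have "?K \<subseteq> loop_ucs ?K k" using K.r_id by (metis subsetI)
  moreover have "loop_ucs ?K k \<subseteq> ?K" by (cases k) (auto intro: gen_e)
  ultimately show ?case by blast
qed
end

context cml
begin
theorem fgen_centrally_nilpotent: assumes "finite G" shows "\<exists>k. loop_ucs (gen G) k = gen G"
proof -
  let ?K = "gen G"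
  define r where "r = (\<lambda>x. if x \<in> ?K then x else e)"
  interpret K: restr mul iv e ?K r
    by unfold_locales (simp_all add: gen_e gen_el gen_iv gen_mul r_def)
  define N where "N = K.s.loop_ucs UNIV 1"
  define \<rho> where "\<rho> = (\<lambda>x. SOME y. r (iv (r x)) \<cdot> r y \<in> N)"
  interpret Q: quot "\<lambda>x y. r x \<cdot> r y" "\<lambda>x. iv (r x)" e N \<rho>
    by unfold_locales (simp_all only: N_def K.s.loop_ucs_1_normal_sub \<rho>_def)
  interpret Q3: cml3 "\<lambda>x y. \<rho> (r x \<cdot> r y)" "\<lambda>x. \<rho> (iv (r x))" "\<rho> e"
  proof unfold_locales
    fix x
    have "r (iv (r (r x \<cdot> r x))) \<cdot> r (iv (r x)) \<in> N"
      unfolding N_def K.s.loop_ucs_1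
    proof (intro conjI allI)
      have *: "r (iv (r (r x \<cdot> r x))) \<cdot> r (iv (r x)) = r (iv (r x)) \<cdot> r (r (iv (r x)) \<cdot> r (iv (r x)))"
        by (simp add: iv_mul comm)
      show "r (r (iv (r (r x \<cdot> r x))) \<cdot> r (iv (r x))) \<cdot> r (r u \<cdot> r v) =
         r (r (r (iv (r (r x \<cdot> r x))) \<cdot> r (iv (r x))) \<cdot> r u) \<cdot> r v" for u v
        unfolding * by (rule K.s.cube)
    qed (simp add: K.r_id K.r_in K.mulH K.ivH e_mul)
    then show "\<rho> (r x \<cdot> r x) = \<rho> (iv (r x))" unfolding Q.rho_eq .
  qed
  have genG: "\<rho> (r (\<rho> e) \<cdot> r x) \<in> Q.q.gen (\<rho> ` (\<lambda>g. e \<cdot> g) ` G)" for x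
  proof -
    have "r x \<in> K.s.gen ((\<lambda>g. e \<cdot> g) ` G)"
      using K.s_gen[of "r x" "(\<lambda>g. e \<cdot> g) ` G"] K.r_in[of x] by (auto simp: gen_el_eq intro: gen_in)
    from Q.q_gen[OF this] have "\<rho> (r x) \<in> Q.q.gen (\<rho> ` (\<lambda>g. e \<cdot> g) ` G)" .
    moreover have "\<rho> (r (\<rho> e) \<cdot> r x) = \<rho> (r x)"
      using Q.rho_l[of e x] by simp
    ultimately show ?thesis by simp
  qed
  obtain k where k: "Q.q.loop_ucs (Q.q.gen (\<rho> ` (\<lambda>g. e \<cdot> g) ` G)) k = Q.q.gen (\<rho> ` (\<lambda>g. e \<cdot> g) ` G)"
    using Q3.fgen_nilpotent[of "\<rho> ` (\<lambda>g. e \<cdot> g) ` G"] assms by auto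
  have "\<rho> x \<in> Q.q.loop_ucs UNIV k" for x
    using k Q.q.loop_ucs_car[OF genG, of k] genG[of x] Q.rho_el[of x] by simp
  then have "e \<cdot> r x \<in> K.s.loop_ucs UNIV (k + 1)" for x
    using Q.loop_ucs_pull[of 1 x k] unfolding N_def by simp
  moreover have "K.s.loop_ucs UNIV (k + 1) = loop_ucs ?K (k + 1)"
    using K.s_loop_ucs[OF order_refl, of "k + 1"] K.s.loop_ucs_car[of ?K "k + 1"] K.r_in
    by (simp del: loop_ucs.simps K.s.loop_ucs.simps)
  ultimately have "?K \<subseteq> loop_ucs ?K (k + 1)" using K.r_id K.elH by (metis subsetI)
  moreover have "loop_ucs ?K (k + 1) \<subseteq> ?K" by auto
  ultimately show ?thesis by blast
qed
end

section \<open>Polycyclic groups\<close>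

text \<open>Groups are written additively although they are not commutative, since only the additive notation has a type class for groups.\<close>
inductive_set grp_span :: "'g::group_add set \<Rightarrow> 'g set" for S where
  grp_span_0 [simp]: "0 \<in> grp_span S"
| grp_span_in: "x \<in> S \<Longrightarrow> x \<in> grp_span S"
| grp_span_minus: "x \<in> grp_span S \<Longrightarrow> - x \<in> grp_span S"
| grp_span_add: "x \<in> grp_span S \<Longrightarrow> y \<in> grp_span S \<Longrightarrow> x + y \<in> grp_span S"

definition subgrp :: "'g::group_add set \<Rightarrow> bool" where
  "subgrp H \<longleftrightarrow> 0 \<in> H \<and> (\<forall>x\<in>H. - x \<in> H) \<and> (\<forall>x\<in>H. \<forall>y\<in>H. x + y \<in> H)"

lemma sgpD: "subgrp H \<Longrightarrow> 0 \<in> H" "subgrp H \<Longrightarrow> x \<in> H \<Longrightarrow> - x \<in> H"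
    "subgrp H \<Longrightarrow> x \<in> H \<Longrightarrow> y \<in> H \<Longrightarrow> x + y \<in> H" "subgrp H \<Longrightarrow> x \<in> H \<Longrightarrow> y \<in> H \<Longrightarrow> x - y \<in> H"
  unfolding diff_conv_add_uminus[of x y] by (simp_all add: subgrp_def del: add_uminus_conv_diff)

lemma subgrp_grp_span: "subgrp (grp_span S)"
  by (auto simp: subgrp_def intro: grp_span.intros)

lemma grp_span_least: "S \<subseteq> H \<Longrightarrow> subgrp H \<Longrightarrow> grp_span S \<subseteq> H"
proof
  fix x assume "S \<subseteq> H" "subgrp H" "x \<in> grp_span S"
  show "x \<in> H" using \<open>x \<in> grp_span S\<close> by (induction rule: grp_span.induct) (use \<open>S \<subseteq> H\<close> \<open>subgrp H\<close> in \<open>auto intro: sgpD\<close>)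
qed

lemma grp_span_sup: "S \<subseteq> grp_span S" by (auto intro: grp_span_in)

lemma grp_span_mono: "S \<subseteq> S' \<Longrightarrow> grp_span S \<subseteq> grp_span S'"
  by (rule grp_span_least) (auto intro: grp_span_in subgrp_grp_span)

abbreviation (input) cjg :: "'g::group_add \<Rightarrow> 'g \<Rightarrow> 'g" where "cjg x w \<equiv> - w + x + w"

definition cmt :: "'g::group_add \<Rightarrow> 'g \<Rightarrow> 'g" where "cmt a b = - a + - b + a + b"

definition fgen :: "'g::group_add set \<Rightarrow> bool" where "fgen H \<longleftrightarrow> (\<exists>S. finite S \<and> grp_span S = H)"

lemmas grp_word = add.assoc minus_add diff_conv_add_uminus

lemma cmt_add_l: "cmt (a + b) y = cjg (cmt a y) b + cmt b y"
  by (simp add: cmt_def grp_word del: add_uminus_conv_diff)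

lemma cmt_minus_l: "cmt (- a) y = - cjg (cmt a y) (- a)"
  by (simp add: cmt_def grp_word del: add_uminus_conv_diff)

lemma cmt_add_r: "cmt x (a + b) = cmt x b + cjg (cmt x a) b"
  by (simp add: cmt_def grp_word del: add_uminus_conv_diff)

lemma cmt_minus_r: "cmt x (- a) = - cjg (cmt x a) (- a)"
  by (simp add: cmt_def grp_word del: add_uminus_conv_diff)

lemma cjg_cmt: "cjg x y = x + cmt x y"
  by (simp add: cmt_def grp_word del: add_uminus_conv_diff)

lemma cmt_swap: "cmt y x = - cmt x y"
  by (simp add: cmt_def grp_word del: add_uminus_conv_diff)

lemma cjg_add: "cjg (x + y) w = cjg x w + cjg y w"
  by (simp add: grp_word del: add_uminus_conv_diff)

lemma cjg_minus: "cjg (- x) w = - cjg x w"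
  by (simp add: grp_word del: add_uminus_conv_diff)

lemma cjg_cjg: "cjg (cjg x v) w = cjg x (v + w)"
  by (simp add: grp_word del: add_uminus_conv_diff)

lemma cmt_0_iff: "cmt x y = 0 \<longleftrightarrow> x + y = y + x"
proof -
  have "cmt x y = - (y + x) + (x + y)" by (simp add: cmt_def grp_word del: add_uminus_conv_diff)
  then show ?thesis by (metis add_minus_cancel add.right_neutral left_minus)
qed

definition normal_in :: "'g::group_add set \<Rightarrow> 'g set \<Rightarrow> bool" where
  "normal_in Y N \<longleftrightarrow> subgrp N \<and> N \<subseteq> Y \<and> (\<forall>n\<in>N. \<forall>x\<in>Y. cjg n x \<in> N)"

lemma nrmD: "normal_in Y N \<Longrightarrow> n \<in> N \<Longrightarrow> x \<in> Y \<Longrightarrow> cjg n x \<in> N"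
  by (simp add: normal_in_def)

lemma normal_in_cmt: "normal_in Y N \<Longrightarrow> n \<in> N \<Longrightarrow> x \<in> Y \<Longrightarrow> cmt n x \<in> N"
proof -
  assume *: "normal_in Y N" "n \<in> N" "x \<in> Y"
  have "cmt n x = - n + cjg n x" by (simp add: cmt_def grp_word del: add_uminus_conv_diff)
  then show ?thesis using * sgpD unfolding normal_in_def by metis
qed

fun ucs :: "'g::group_add set \<Rightarrow> nat \<Rightarrow> 'g set" where
  "ucs Y 0 = {0}"
| "ucs Y (Suc m) = {x \<in> Y. \<forall>y\<in>Y. cmt x y \<in> ucs Y m}"

lemma normal_in_centralizer_mod:
  assumes Y: "subgrp Y" and N: "normal_in Y N"
  shows "normal_in Y {x \<in> Y. \<forall>y\<in>Y. cmt x y \<in> N}"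
proof -
  let ?C = "{x \<in> Y. \<forall>y\<in>Y. cmt x y \<in> N}"
  have cjN: "\<And>n x. n \<in> N \<Longrightarrow> x \<in> Y \<Longrightarrow> cjg n x \<in> N" and sN: "subgrp N" using N by (auto simp: normal_in_def)
  have "N \<subseteq> ?C" using N normal_in_cmt by (auto simp: normal_in_def)
  have s: "subgrp ?C" unfolding subgrp_def
  proof (intro conjI ballI)
    show "0 \<in> ?C" using Y sN by (auto simp: cmt_def sgpD)
  next
    fix x assume x: "x \<in> ?C"
    then have "- x \<in> Y" using Y by (simp add: sgpD)
    moreover have "cmt (- x) y \<in> N" if "y \<in> Y" for y unfolding cmt_minus_l
      using x that \<open>- x \<in> Y\<close> by (intro sgpD(2)[OF sN] cjN) auto
    ultimately show "- x \<in> ?C" by blast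
  next
    fix a b assume *: "a \<in> ?C" "b \<in> ?C"
    have "cmt (a + b) y \<in> N" if "y \<in> Y" for y unfolding cmt_add_l
      by (rule sgpD(3)[OF sN cjN]) (use * that in auto)
    then show "a + b \<in> ?C" using * Y by (auto intro: sgpD)
  qed
  have "cjg x y \<in> ?C" if "x \<in> ?C" "y \<in> Y" for x y
    unfolding cjg_cmt using that \<open>N \<subseteq> ?C\<close> by (intro sgpD(3)[OF s]) auto
  then show ?thesis using s by (auto simp: normal_in_def)
qed

lemma ucs_normal_in: "subgrp Y \<Longrightarrow> normal_in Y (ucs Y m)"
proof (induction m)
  case 0
  then show ?case by (auto simp: normal_in_def subgrp_def)
next
  case (Suc m)
  then show ?case using normal_in_centralizer_mod[of Y "ucs Y m"] by simp
qed

text \<open>The set \<open>Z\<close> relaxes the condition on cubes: \<open>UNIV\<close> imposes nothing, \<open>{0}\<close> forces the group to be finite, and the centre is what the count of fixed points needs.\<close>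
inductive polycyc :: "'g::group_add set \<Rightarrow> 'g set \<Rightarrow> bool" for Z where
  polycyc_0: "polycyc Z {0}"
| polycyc_step: "polycyc Z N \<Longrightarrow> (\<And>n. n \<in> N \<Longrightarrow> cjg n w \<in> N \<and> cjg n (- w) \<in> N) \<Longrightarrow> w + w + w \<in> N \<union> Z \<Longrightarrow>
    polycyc Z (grp_span (insert w N))"

lemma polycyc_subgrp: "polycyc Z N \<Longrightarrow> subgrp N"
  by (induction rule: polycyc.induct) (auto simp: subgrp_def intro: grp_span.intros)

lemma polycyc_extend:
  assumes "finite W" and Y: "subgrp Y" and N: "polycyc Z N" "normal_in Y N"
    and W: "\<And>w. w \<in> W \<Longrightarrow> w \<in> Y \<and> (\<forall>x\<in>Y. cmt w x \<in> N) \<and> w + w + w \<in> N \<union> Z"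
  shows "\<exists>N'. polycyc Z N' \<and> normal_in Y N' \<and> N \<subseteq> N' \<and> W \<subseteq> N'"
  using assms(1) W
proof (induction W rule: finite_induct)
  case empty
  then show ?case using N by blast
next
  case (insert w W)
  then obtain N' where N': "polycyc Z N'" "normal_in Y N'" "N \<subseteq> N'" "W \<subseteq> N'" by blast
  have sN': "subgrp N'" using N' polycyc_subgrp by blast
  have w: "w \<in> Y" "\<And>x. x \<in> Y \<Longrightarrow> cmt w x \<in> N'" "w + w + w \<in> N' \<union> Z" using insert.prems N' by blast+
  let ?M = "grp_span (insert w N')"
  have sub: "N' \<subseteq> ?M" "w \<in> ?M" by (auto intro: grp_span_in)
  have "polycyc Z ?M"
    using w by (intro polycyc_step N' conjI nrmD[OF N'(2)] sgpD(2)[OF Y])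
  moreover have "normal_in Y ?M"
    unfolding normal_in_def
  proof (intro conjI ballI)
    show "subgrp ?M" by (rule subgrp_grp_span)
    show "?M \<subseteq> Y" using Y w N' by (intro grp_span_least) (auto simp: normal_in_def)
    fix n x assume "n \<in> ?M" "x \<in> Y"
    show "cjg n x \<in> ?M" using \<open>n \<in> ?M\<close>
    proof (induction rule: grp_span.induct)
      case (grp_span_in y)
      show ?case
      proof (cases "y = w")
        case True
        have "cmt w x \<in> ?M" using w(2)[OF \<open>x \<in> Y\<close>] sub by blast
        then show ?thesis unfolding True cjg_cmt using sub by (intro grp_span_add)
      next
        case False
        then have "cjg y x \<in> N'" using grp_span_in N' \<open>x \<in> Y\<close> by (auto simp: normal_in_def)
        then show ?thesis using sub by blast
      qed
    next
      case (grp_span_minus y)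
      show ?case unfolding cjg_minus by (rule grp_span.grp_span_minus) (rule grp_span_minus.IH)
    next
      case (grp_span_add y z)
      show ?case unfolding cjg_add by (rule grp_span.grp_span_add) (rule grp_span_add.IH)+
    qed simp
  qed
  ultimately show ?case using sub N' by blast
qed

lemma cmt_grp_span:
  assumes N: "normal_in Y N" and Y: "Y = grp_span S" and w: "\<And>s. s \<in> S \<Longrightarrow> cmt w s \<in> N" and x: "x \<in> Y"
  shows "cmt w x \<in> N"
proof -
  have sN: "subgrp N" using N by (simp add: normal_in_def)
  have "x \<in> grp_span S" using x Y by simp
  then show ?thesis
  proof (induction rule: grp_span.induct)
    case grp_span_0
    then show ?case using sN by (simp add: cmt_def sgpD)
  next
    case (grp_span_in s)
    then show ?case using w by blast
  next
    case (grp_span_minus y)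
    then have "cjg (cmt w y) (- y) \<in> N" using Y grp_span.grp_span_minus by (intro nrmD[OF N]) auto
    then show ?case unfolding cmt_minus_r using sN by (rule_tac sgpD)
  next
    case (grp_span_add y z)
    then have "cjg (cmt w y) z \<in> N" using N Y by (auto simp: normal_in_def)
    then show ?case unfolding cmt_add_r by (rule sgpD(3)[OF sN grp_span_add.IH(2)])
  qed
qed

text \<open>Commutators of \<open>W\<close> with the generators lie one term lower and are enclosed
  in \<open>N\<close> by induction. For \<open>w = cmt c s\<close> with \<open>s + s + s\<close>
  central the condition on cubes is automatic: expanding \<open>cmt c (s + s + s) = 0\<close> gives
  \<open>w + w + w\<close> up to commutators that lie in \<open>N\<close>.\<close>

lemma polycyc_nilpotent:
  assumes Y: "Y = grp_span S" and S: "finite S" and central: "\<And>s x. s \<in> S \<Longrightarrow> x \<in> Y \<Longrightarrow> (s + s + s) + x = x + (s + s + s) \<or> Z = UNIV"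
  shows "finite W \<Longrightarrow> W \<subseteq> ucs Y m \<Longrightarrow> (\<And>w. w \<in> W \<Longrightarrow> w + w + w \<in> Z \<or> (\<exists>c\<in>Y. \<exists>s\<in>S. w = cmt c s)) \<Longrightarrow>
    \<exists>N. polycyc Z N \<and> normal_in Y N \<and> W \<subseteq> N"
proof (induction m arbitrary: W)
  case 0
  have "normal_in Y {0}" using Y by (auto simp: normal_in_def subgrp_def)
  then show ?case using 0 polycyc_0 by (intro exI[of _ "{0}"]) auto
next
  case (Suc m)
  have subgrp_Y: "subgrp Y" using Y subgrp_grp_span by blast
  have S_subset_Y: "S \<subseteq> Y" using Y grp_span_sup by blast
  have WX: "W \<subseteq> Y" using Suc.prems by auto
  let ?W = "(\<lambda>(w, s). cmt w s) ` (W \<times> S)"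
  have "\<exists>N. polycyc Z N \<and> normal_in Y N \<and> ?W \<subseteq> N"
  proof (rule Suc.IH)
    show "finite ?W" using Suc.prems S by simp
    show "?W \<subseteq> ucs Y m" using Suc.prems(2) S_subset_Y by auto
    show "w + w + w \<in> Z \<or> (\<exists>c\<in>Y. \<exists>s\<in>S. w = cmt c s)" if "w \<in> ?W" for w using that WX by auto
  qed
  then obtain N where N: "polycyc Z N" "normal_in Y N" "?W \<subseteq> N" by blast
  have sN: "subgrp N" using N polycyc_subgrp by blast
  have cmW: "cmt w x \<in> N" if "w \<in> W" "x \<in> Y" for w x
    by (rule cmt_grp_span[OF N(2) Y _ that(2)]) (use N(3) that(1) in auto)
  have "w + w + w \<in> N \<union> Z" if w: "w \<in> W" for w
  proof (cases "w + w + w \<in> Z")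
    case False
    then obtain c s where cs: "c \<in> Y" "s \<in> S" "w = cmt c s" using Suc.prems(3) w by blast
    have "cmt c (s + s + s) = 0"
      using central[OF cs(2,1)] False by (auto simp: cmt_0_iff)
    moreover have "cmt c (s + s + s) = w + w + cmt w s + w + cmt w (s + s)"
    proof -
      have "cmt c (s + s + s) = w + (cjg w s + cjg (cjg w s) s)"
        by (simp only: cmt_add_r cs(3)[symmetric] cjg_add)
      also have "cjg (cjg w s) s = cjg w (s + s)" by (rule cjg_cjg)
      also have "cjg w s = w + cmt w s" by (rule cjg_cmt)
      also have "cjg w (s + s) = w + cmt w (s + s)" by (rule cjg_cmt)
      finally show ?thesis by (simp only: add.assoc)
    qed
    moreover have "cmt w s \<in> N" "cmt w (s + s) \<in> N" using cmW[OF w] S_subset_Y cs subgrp_Y by (auto intro: sgpD)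
    moreover have "cjg (cmt w s) w \<in> N" using \<open>cmt w s \<in> N\<close> N(2) w WX by (auto simp: normal_in_def)
    moreover have "w + w + w = (w + w + cmt w s + w + cmt w (s + s)) - cmt w (s + s) - cjg (cmt w s) w"
      by (simp add: grp_word del: add_uminus_conv_diff)
    ultimately show ?thesis using sN sgpD by (metis UnI1)
  qed simp
  then have "\<exists>N'. polycyc Z N' \<and> normal_in Y N' \<and> N \<subseteq> N' \<and> W \<subseteq> N'"
    using cmW WX by (intro polycyc_extend[OF Suc.prems(1) subgrp_Y N(1,2)]) blast
  then show ?case by blast
qed

section \<open>Subgroups of polycyclic groups\<close>

fun nmul :: "nat \<Rightarrow> 'g::group_add \<Rightarrow> 'g" where
  "nmul 0 w = 0"
| "nmul (Suc n) w = w + nmul n w"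

lemma nmul_add: "nmul (i + j) w = nmul i w + nmul j w" by (induction i) (simp_all add: add.assoc)

lemma subgrp_nmul: "subgrp H \<Longrightarrow> w \<in> H \<Longrightarrow> nmul n w \<in> H" by (induction n) (auto intro: sgpD)

lemma nmul_comm: "nmul i w + nmul j w = nmul j w + nmul i w" by (metis nmul_add add.commute)

locale cyc_ext =
  fixes N :: "'g::group_add set" and w
  assumes sN: "subgrp N" and cjw: "\<And>n. n \<in> N \<Longrightarrow> cjg n w \<in> N \<and> cjg n (- w) \<in> N"
begin
lemma cjg_nmul: "n \<in> N \<Longrightarrow> cjg n (nmul k w) \<in> N"
proof (induction k arbitrary: n)
  case (Suc k)
  then have "cjg (cjg n w) (nmul k w) \<in> N" using cjw by blast
  then show ?case unfolding cjg_cjg by simp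
qed simp

lemma cjg_nmul': "n \<in> N \<Longrightarrow> cjg n (- nmul k w) \<in> N"
proof (induction k arbitrary: n)
  case (Suc k)
  then have "cjg (cjg n (- nmul k w)) (- w) \<in> N" using cjw by blast
  then show ?case unfolding cjg_cjg by (simp only: nmul.simps minus_add)
qed simp

text \<open>Only natural multiples are at hand, so a negative multiple of \<open>w\<close> is
  expressed through \<open>- x\<close>. The auxiliary set \<open>D\<close> allows differences of
  multiples, and comparing \<open>i\<close> with \<open>j\<close> decides the sign.\<close>

lemma elements: assumes "x \<in> grp_span (insert w N)" shows "\<exists>n\<in>N. \<exists>k. x = n + nmul k w \<or> - x = n + nmul k w"
proof -
  define D where "D = {x. \<exists>n\<in>N. \<exists>i j. x = n + nmul i w - nmul j w}"
  have D1: "- x \<in> D" if x: "x \<in> D" for x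
  proof -
    obtain n i j where n: "n \<in> N" "x = n + nmul i w - nmul j w" using x D_def by auto
    have "- x = (nmul j w - nmul i w) + - n" unfolding n by (simp add: grp_word del: add_uminus_conv_diff)
    also have "\<dots> = cjg (- n) (nmul i w - nmul j w) + nmul j w - nmul i w"
      by (simp add: grp_word del: add_uminus_conv_diff)
    finally have "- x = cjg (cjg (- n) (nmul i w)) (- nmul j w) + nmul j w - nmul i w"
      by (simp only: cjg_cjg diff_conv_add_uminus)
    moreover have "cjg (cjg (- n) (nmul i w)) (- nmul j w) \<in> N" by (intro cjg_nmul cjg_nmul' sgpD[OF sN] n)
    ultimately show ?thesis unfolding D_def by blast
  qed
  have D2: "x + y \<in> D" if x: "x \<in> D" and y: "y \<in> D" for x y
  proof -
    obtain n i j where n: "n \<in> N" "x = n + nmul i w - nmul j w" using x D_def by auto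
    obtain n' i' j' where n': "n' \<in> N" "y = n' + nmul i' w - nmul j' w" using y D_def by auto
    let ?z = "nmul j w - nmul i w"
    have "x + y = n + cjg n' ?z + (nmul i w - nmul j w + nmul i' w - nmul j' w)"
      unfolding n n' by (simp add: grp_word del: add_uminus_conv_diff)
    also have "- nmul j w + nmul i' w = nmul i' w - nmul j w"
      using nmul_comm[of j w i'] by (metis add.assoc add_diff_cancel diff_conv_add_uminus minus_add_cancel)
    then have "nmul i w - nmul j w + nmul i' w - nmul j' w = nmul (i + i') w - nmul (j' + j) w"
      by (simp add: nmul_add grp_word del: add_uminus_conv_diff)
    finally have *: "x + y = n + cjg n' ?z + nmul (i + i') w - nmul (j' + j) w" by (simp add: add.assoc add_diff_eq)
    have "cjg n' ?z = cjg (cjg n' (nmul j w)) (- nmul i w)" by (simp only: cjg_cjg diff_conv_add_uminus)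
    then have "n + cjg n' ?z \<in> N" using cjg_nmul cjg_nmul' n n' sN by (metis sgpD(3))
    then show ?thesis unfolding * D_def by blast
  qed
  have "n \<in> D" if "n \<in> N" for n
    unfolding D_def using that by (auto intro!: bexI[of _ n] exI[of _ 0])
  moreover have "w = 0 + nmul 1 w - nmul 0 w" by simp
  then have "w \<in> D" unfolding D_def using sgpD(1)[OF sN] by blast
  moreover have "0 \<in> D" using calculation(1) sgpD(1)[OF sN] by blast
  moreover have "subgrp D" unfolding subgrp_def using D1 D2 \<open>0 \<in> D\<close> by blast
  ultimately have "x \<in> D" using assms grp_span_least[of "insert w N" D] by blast
  then obtain n i j where n: "n \<in> N" "x = n + nmul i w - nmul j w" using D_def by auto
  show ?thesis
  proof (cases "j \<le> i")
    case True
    then have "x = n + nmul (i - j) w" unfolding n using nmul_add[of "i - j" j w] by (metis add.assoc add_diff_cancel le_add_diff_inverse2)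
    then show ?thesis using n by blast
  next
    case False
    then have "nmul i w - nmul j w = - nmul (j - i) w" using nmul_add[of "j - i" i w] by (simp add: grp_word del: add_uminus_conv_diff)
    then have "x = n - nmul (j - i) w" unfolding n by (metis add_diff_eq diff_conv_add_uminus)
    then have "- x = cjg (- n) (- nmul (j - i) w) + nmul (j - i) w" by (simp add: grp_word del: add_uminus_conv_diff)
    then show ?thesis using cjg_nmul'[of "- n"] n sgpD(2)[OF sN] by blast
  qed
qed

text \<open>Euclidean division: \<open>h\<close> is an element \<open>n0 + nmul d w\<close> of
  \<open>H\<close> with the least positive \<open>d\<close>, and subtracting it repeatedly brings
  the elements of \<open>H\<close> into \<open>N\<close>. If no positive multiple occurs,
  \<open>H\<close> lies in \<open>N\<close> and \<open>h = 0\<close> serves.\<close>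

lemma intersect:
  assumes sH: "subgrp H" and HM: "H \<subseteq> grp_span (insert w N)"
  shows "\<exists>h\<in>H. \<forall>x\<in>H. \<exists>n\<in>H \<inter> N. \<exists>k. x = n + nmul k h \<or> - x = n + nmul k h"
proof (cases "\<exists>k>0. \<exists>n\<in>N. n + nmul k w \<in> H")
  case False
  have "x \<in> N" if xH: "x \<in> H" for x
  proof -
    obtain n k where n: "n \<in> N" "x = n + nmul k w \<or> - x = n + nmul k w" using elements xH HM by blast
    then have "n + nmul k w \<in> H" using xH sgpD(2)[OF sH xH] by metis
    then have "k = 0" using False n by auto
    then show ?thesis using n sN sgpD(2)[OF sN] by (metis add.right_neutral minus_minus nmul.simps(1))
  qed
  then show ?thesis using sgpD(1)[OF sH] by (intro bexI[of _ 0]) (auto intro!: exI[of _ 0])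
next
  case True
  define d where "d = (LEAST k. k > 0 \<and> (\<exists>n\<in>N. n + nmul k w \<in> H))"
  have d: "d > 0" "\<exists>n\<in>N. n + nmul d w \<in> H" using LeastI_ex[OF True] by (auto simp: d_def)
  have dl: "d \<le> k" if "k > 0" "n \<in> N" "n + nmul k w \<in> H" for k n
    unfolding d_def by (rule Least_le) (use that in blast)
  obtain n0 where n0: "n0 \<in> N" "n0 + nmul d w \<in> H" using d by blast
  let ?h = "n0 + nmul d w"
  have main: "\<exists>n'\<in>H \<inter> N. \<exists>j. n + nmul k w = n' + nmul j ?h" if "n \<in> N" "n + nmul k w \<in> H" for n k
    using that
  proof (induction k arbitrary: n rule: less_induct)
    case (less k)
    show ?case
    proof (cases "k = 0")
      case True
      then show ?thesis using less.prems by (intro bexI[of _ n] exI[of _ 0]) auto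
    next
      case False
      then have "d \<le> k" using dl less.prems by blast
      let ?n = "n + cjg (- n0) (- nmul (k - d) w)"
      have *: "n + nmul k w - ?h = ?n + nmul (k - d) w"
        using nmul_add[of "k - d" d w] \<open>d \<le> k\<close> by (simp add: grp_word del: add_uminus_conv_diff)
      have "?n \<in> N" using less.prems n0 by (intro sgpD(3)[OF sN] cjg_nmul' sgpD(2)[OF sN])
      moreover have "?n + nmul (k - d) w \<in> H" unfolding *[symmetric] using less.prems n0 by (intro sgpD(4)[OF sH])
      moreover have "k - d < k" using d(1) False by simp
      ultimately obtain n' j where n': "n' \<in> H \<inter> N" "?n + nmul (k - d) w = n' + nmul j ?h"
        using less.IH[of "k - d" ?n] by blast
      have "n + nmul k w = n' + nmul j ?h + ?h" using *[symmetric] unfolding n'(2) by (simp add: diff_eq_eq)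
      also have "\<dots> = n' + nmul (Suc j) ?h" using nmul_comm[of j ?h 1] by (simp add: add.assoc)
      finally show ?thesis using n'(1) by blast
    qed
  qed
  show ?thesis
  proof (rule bexI[of _ ?h], rule ballI)
    fix x assume "x \<in> H"
    then obtain n k where n: "n \<in> N" "x = n + nmul k w \<or> - x = n + nmul k w" using elements HM by blast
    then have "n + nmul k w \<in> H" using \<open>x \<in> H\<close> sgpD(2)[OF sH \<open>x \<in> H\<close>] by metis
    from main[OF n(1) this] n(2) show "\<exists>n\<in>H \<inter> N. \<exists>k. x = n + nmul k ?h \<or> - x = n + nmul k ?h" by metis
  qed (rule n0)
qed
end

lemma subgrp_Int: "subgrp H \<Longrightarrow> subgrp K \<Longrightarrow> subgrp (H \<inter> K)" by (auto simp: subgrp_def)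

lemma polycyc_subgroup_fgen: assumes "polycyc Z N" shows "subgrp H \<Longrightarrow> H \<subseteq> N \<Longrightarrow> fgen H"
  using assms
proof (induction arbitrary: H rule: polycyc.induct)
  case polycyc_0
  then have "H = grp_span {}" using grp_span_least[of "{}" H] sgpD(1)[of H] by auto
  then show ?case unfolding fgen_def by (metis finite.emptyI)
next
  case (polycyc_step N w)
  have sN: "subgrp N" using polycyc_step polycyc_subgrp by blast
  interpret cyc_ext N w using sN polycyc_step by unfold_locales auto
  obtain h where h: "h \<in> H" "\<And>x. x \<in> H \<Longrightarrow> \<exists>n\<in>H \<inter> N. \<exists>k. x = n + nmul k h \<or> - x = n + nmul k h"
    using intersect[OF polycyc_step.prems] by blast
  have "fgen (H \<inter> N)" using polycyc_step sN by (intro polycyc_step.IH subgrp_Int) auto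
  then obtain S where S: "finite S" "grp_span S = H \<inter> N" unfolding fgen_def by blast
  have "S \<subseteq> H" using S(2) grp_span_sup by blast
  have "grp_span (insert h S) = H"
  proof
    show "grp_span (insert h S) \<subseteq> H" using h(1) \<open>S \<subseteq> H\<close> polycyc_step.prems by (intro grp_span_least) auto
    show "H \<subseteq> grp_span (insert h S)"
    proof
      fix x assume "x \<in> H"
      then obtain n k where n: "n \<in> H \<inter> N" "x = n + nmul k h \<or> - x = n + nmul k h" using h(2) by blast
      have "n \<in> grp_span (insert h S)" using n(1) S(2) grp_span_mono[of S "insert h S"] by blast
      then have "n + nmul k h \<in> grp_span (insert h S)" by (rule grp_span_add) (rule subgrp_nmul[OF subgrp_grp_span grp_span_in], simp)
      then show "x \<in> grp_span (insert h S)" using n(2) grp_span_minus[of "- x"] by auto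
    qed
  qed
  then show ?case unfolding fgen_def using S(1) by (metis finite_insert)
qed

lemma polycyc_torsion_finite: assumes "polycyc Z N"
  shows "subgrp H \<Longrightarrow> H \<subseteq> N \<Longrightarrow> (\<And>x. x \<in> H \<Longrightarrow> \<exists>m>0. nmul m x = 0) \<Longrightarrow> finite H"
  using assms
proof (induction arbitrary: H rule: polycyc.induct)
  case polycyc_0
  then show ?case using finite_subset by blast
next
  case (polycyc_step N w)
  have sN: "subgrp N" using polycyc_step polycyc_subgrp by blast
  interpret cyc_ext N w using sN polycyc_step by unfold_locales auto
  obtain h where h: "h \<in> H" "\<And>x. x \<in> H \<Longrightarrow> \<exists>n\<in>H \<inter> N. \<exists>k. x = n + nmul k h \<or> - x = n + nmul k h"
    using intersect[OF polycyc_step.prems(1,2)] by blast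
  have fin: "finite (H \<inter> N)" using polycyc_step sN by (intro polycyc_step.IH subgrp_Int) auto
  obtain m where m: "m > 0" "nmul m h = 0" using polycyc_step.prems(3) h by blast
  have nmul_mult: "nmul (m * q) h = 0" for q by (induction q) (simp_all add: nmul_add m)
  have nmul_mod: "nmul k h = nmul (k mod m) h" for k
    using nmul_add[of "m * (k div m)" "k mod m" h] nmul_mult by simp
  let ?A = "(\<lambda>(n, k). n + nmul k h) ` ((H \<inter> N) \<times> {..<m})"
  have "H \<subseteq> ?A \<union> uminus ` ?A"
  proof
    fix x assume "x \<in> H"
    then obtain n k where n: "n \<in> H \<inter> N" "x = n + nmul k h \<or> - x = n + nmul k h" using h(2) by blast
    have "n + nmul k h \<in> ?A" by (rule image_eqI[of _ _ "(n, k mod m)"]) (use n nmul_mod m in auto)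
    then have "x \<in> ?A \<or> - x \<in> ?A" using n by metis
    then show "x \<in> ?A \<union> uminus ` ?A"
    proof
      assume "- x \<in> ?A"
      then have "- (- x) \<in> uminus ` ?A" by (rule imageI)
      then show ?thesis by simp
    qed simp
  qed
  then show ?case by (rule finite_subset) (use fin in auto)
qed

section \<open>Counting fixed points on elementary abelian 3-groups\<close>

lemma card_fibers_le:
  fixes \<delta> :: "'g::group_add \<Rightarrow> 'b"
  assumes "finite A" "finite K" "\<And>x y. x \<in> A \<Longrightarrow> y \<in> A \<Longrightarrow> \<delta> x = \<delta> y \<Longrightarrow> x - y \<in> K"
  shows "card A \<le> card K * card (\<delta> ` A)"
proof -
  obtain g where g: "\<And>x. x \<in> A \<Longrightarrow> g (\<delta> x) \<in> A \<and> \<delta> (g (\<delta> x)) = \<delta> x"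
    by (rule that[of "\<lambda>y. SOME x. x \<in> A \<and> \<delta> x = y"]) (metis (mono_tags, lifting) someI_ex)
  have "inj_on (\<lambda>x. (x - g (\<delta> x), \<delta> x)) A" by (rule inj_onI) (metis Pair_inject diff_add_cancel)
  moreover have "(\<lambda>x. (x - g (\<delta> x), \<delta> x)) ` A \<subseteq> K \<times> \<delta> ` A" using g assms(3) by auto
  ultimately have "card A \<le> card (K \<times> \<delta> ` A)" using assms by (intro card_inj_on_le) auto
  then show ?thesis by (simp add: card_cartesian_product)
qed

text \<open>On an elementary abelian 3-group, an operator \<open>w\<close> with trivial cube satisfies \<open>(w - 1)^3 = 0\<close>, and \<open>(w - 1)^2 = 1 + w + w^2\<close> maps into its fixed points.\<close>
lemma card_fixed_cube:
  fixes E :: "'g::group_add set"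
  assumes fin: "finite E" and E: "subgrp E" and ab: "\<And>x y. x \<in> E \<Longrightarrow> y \<in> E \<Longrightarrow> x + y = y + x"
    and e3: "\<And>x. x \<in> E \<Longrightarrow> x + x + x = 0" and w: "\<And>x. x \<in> E \<Longrightarrow> cjg x w \<in> E"
    and w3: "\<And>x. x \<in> E \<Longrightarrow> cjg x (w + w + w) = x"
  shows "card E \<le> card {x \<in> E. cjg x w = x} ^ 3"
proof -
  define \<delta> where "\<delta> x = - x + cjg x w" for x
  let ?K = "{x \<in> E. cjg x w = x}"
  have dE: "\<delta> x \<in> E" if "x \<in> E" for x unfolding \<delta>_def by (intro sgpD(3)[OF E] sgpD(2)[OF E] w that)
  have K: "x - y \<in> ?K" if "x \<in> E" "y \<in> E" "\<delta> x = \<delta> y" for x y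
  proof -
    have "x - y \<in> E" by (intro sgpD(4)[OF E] that)
    have cx: "cjg x w = x + (- y + cjg y w)" using that(3) unfolding \<delta>_def by (metis add_minus_cancel)
    have "cjg (x - y) w = cjg x w + - cjg y w" by (simp only: diff_conv_add_uminus cjg_add cjg_minus)
    also have "\<dots> = x - y" unfolding cx by (simp add: grp_word del: add_uminus_conv_diff)
    finally show ?thesis using \<open>x - y \<in> E\<close> by simp
  qed
  have d2: "\<delta> (\<delta> x) \<in> ?K" if x: "x \<in> E" for x
  proof -
    define y z where "y = cjg x w" and "z = cjg y w"
    have E': "y \<in> E" "z \<in> E" by (simp_all add: y_def z_def w x)
    have yy: "- y + - y = y" using e3[OF E'(1)] by (metis add.assoc add.inverse_unique minus_add)
    have "cjg (- x + y) w = cjg (- x) w + z" unfolding z_def by (rule cjg_add)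
    also have "cjg (- x) w = - y" unfolding y_def by (rule cjg_minus)
    finally have "\<delta> (\<delta> x) = - (- x + y) + (- y + z)" by (simp only: \<delta>_def y_def[symmetric])
    also have "\<dots> = (- y + x) + - y + z" by (simp add: grp_word del: add_uminus_conv_diff)
    also have "- y + x = x + - y" using ab[OF sgpD(2)[OF E E'(1)] x] .
    also have "x + - y + - y + z = x + y + z" using yy by (metis add.assoc)
    finally have *: "\<delta> (\<delta> x) = x + y + z" .
    have "cjg z w = x" unfolding z_def y_def cjg_cjg using w3[OF x] by (simp only: add.assoc)
    then have "cjg (x + y + z) w = y + z + x" by (simp only: cjg_add y_def[symmetric] z_def[symmetric])
    also have "\<dots> = x + (y + z)" by (rule ab[OF sgpD(3)[OF E E'] x])
    finally have "cjg (\<delta> (\<delta> x)) w = \<delta> (\<delta> x)" unfolding * by (simp only: add.assoc)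
    then show ?thesis using dE x by simp
  qed
  have "card E \<le> card ?K * card (\<delta> ` E)" by (rule card_fibers_le) (use fin K in auto)
  also have "card (\<delta> ` E) \<le> card ?K * card (\<delta> ` \<delta> ` E)"
    by (rule card_fibers_le) (use fin K[OF dE dE] in auto)
  also have "card (\<delta> ` \<delta> ` E) \<le> card ?K" using d2 fin by (intro card_mono) auto
  finally show ?thesis by (simp add: power3_eq_cube mult.assoc mult_left_mono)
qed

definition elementary_ops :: "'g::group_add set \<Rightarrow> 'g set \<Rightarrow> 'g set \<Rightarrow> bool" where
  "elementary_ops Z F E \<longleftrightarrow> finite E \<and> subgrp E \<and> (\<forall>x\<in>E. \<forall>y\<in>E. x + y = y + x) \<and> (\<forall>x\<in>E. x + x + x = 0) \<and>
      (\<forall>x\<in>E. \<forall>f\<in>F. cjg x f \<in> E) \<and> (\<forall>x\<in>E. \<forall>z\<in>Z. cjg x z = x)"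

text \<open>The exponent is 3 to the number of steps that build \<open>F\<close>, hence the same for
  all \<open>E\<close>. In a step, the fixed points of \<open>N\<close> are stable under
  \<open>w\<close>, which normalizes \<open>N\<close>, and the cube of \<open>w\<close> acts
  trivially on them because it lies in \<open>N\<close> or \<open>Z\<close>; so
  \<open>card_fixed_cube\<close> applies.\<close>

lemma polycyc_fixed_bound:
  fixes F :: "'g::group_add set"
  assumes "polycyc Z F"
  shows "\<exists>n. \<forall>E. elementary_ops Z F E \<longrightarrow> card E \<le> card {x \<in> E. \<forall>f\<in>F. cjg x f = x} ^ n"
  using assms
proof (induction rule: polycyc.induct)
  case polycyc_0
  then show ?case by (intro exI[of _ 1]) simp
next
  case (polycyc_step N w)
  let ?F = "grp_span (insert w N)"
  obtain n where n: "\<And>E. elementary_ops Z N E \<Longrightarrow> card E \<le> card {x \<in> E. \<forall>f\<in>N. cjg x f = x} ^ n"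
    using polycyc_step.IH by blast
  have FN: "N \<subseteq> ?F" "w \<in> ?F" by (auto intro: grp_span_in)
  show ?case
  proof (intro exI[of _ "3 * n"] allI impI)
    fix E assume "elementary_ops Z ?F E"
    then have E: "finite E" "subgrp E" "\<forall>x\<in>E. \<forall>y\<in>E. x + y = y + x" "\<forall>x\<in>E. x + x + x = 0"
      "\<forall>x\<in>E. \<forall>f\<in>?F. cjg x f \<in> E" "\<forall>x\<in>E. \<forall>z\<in>Z. cjg x z = x" by (simp_all add: elementary_ops_def)
    have "elementary_ops Z N E" using E FN by (auto simp: elementary_ops_def)
    let ?E = "{x \<in> E. \<forall>f\<in>N. cjg x f = x}"
    have "subgrp ?E" unfolding subgrp_def
    proof (intro conjI ballI)
      show "0 \<in> ?E" using E(2) by (simp add: sgpD)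
      show "- x \<in> ?E" if "x \<in> ?E" for x using that E(2) cjg_minus[where x = x] by (auto simp: sgpD simp del: add_uminus_conv_diff)
      show "x + y \<in> ?E" if "x \<in> ?E" "y \<in> ?E" for x y using that E(2) cjg_add[where x = x and y = y] by (auto simp: sgpD)
    qed
    have "card E \<le> card ?E ^ n" by (rule n) fact
    also have "card ?E \<le> card {x \<in> ?E. cjg x w = x} ^ 3"
    proof (rule card_fixed_cube)
      show "finite ?E" using E by simp
      show "subgrp ?E" by fact
      show "x + y = y + x" if "x \<in> ?E" "y \<in> ?E" for x y using that E(3) by blast
      show "x + x + x = 0" if "x \<in> ?E" for x using that E(4) by blast
      show "cjg x w \<in> ?E" if x: "x \<in> ?E" for x
      proof -
        have "cjg (cjg x w) f = cjg x w" if "f \<in> N" for f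
        proof -
          have "cjg (cjg x w) f = cjg (cjg x (cjg f (- w))) w"
            by (simp add: grp_word del: add_uminus_conv_diff)
          also have "cjg x (cjg f (- w)) = x" using x polycyc_step.hyps(2)[OF that] by blast
          finally show ?thesis .
        qed
        then show ?thesis using x E(5) FN by blast
      qed
      show "cjg x (w + w + w) = x" if "x \<in> ?E" for x using that polycyc_step.hyps(3) E(6) by blast
    qed
    also have "{x \<in> ?E. cjg x w = x} = {x \<in> E. \<forall>f\<in>?F. cjg x f = x}"
    proof -
      have "cjg x f = x" if "f \<in> ?F" "\<forall>f\<in>N. cjg x f = x" "cjg x w = x" for x f
        using that(1)
      proof (induction rule: grp_span.induct)
        case (grp_span_minus y)
        have "cjg (cjg x y) (- y) = x" by (simp only: cjg_cjg) simp
        then show ?case by (simp only: grp_span_minus.IH)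
      next
        case (grp_span_add y z)
        then show ?case by (simp only: cjg_cjg[symmetric])
      qed (use that in auto)
      then show ?thesis using FN by blast
    qed
    finally show "card E \<le> card {x \<in> E. \<forall>f\<in>?F. cjg x f = x} ^ (3 * n)"
      by (simp add: power_mult power_mono)
  qed
qed

text \<open>Collecting the letters moves three copies of the commutator, which commutes with
  \<open>a\<close> and \<open>b\<close>, to the right, where they cancel.\<close>

lemma cube_add_class2:
  fixes a b :: "'g::group_add"
  assumes "cmt b a + a = a + cmt b a" "cmt b a + b = b + cmt b a" "cmt b a + cmt b a + cmt b a = 0"
  shows "(a + b) + (a + b) + (a + b) = (a + a + a) + (b + b + b)"
proof -
  define k where "k = cmt b a"
  have ka: "k + (a + x) = a + (k + x)" "k + (b + x) = b + (k + x)" for x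
    using assms by (metis k_def add.assoc)+
  have k3: "k + (k + (k + x)) = x" for x using assms(3) by (simp add: k_def flip: add.assoc)
  have ba: "b + (a + x) = a + (b + (k + x))" for x
    unfolding k_def by (simp add: cmt_def grp_word del: add_uminus_conv_diff)
  have "(a + b) + (a + b) + (a + b) = a + (b + (a + (b + (a + b))))" by (simp only: add.assoc)
  also have "\<dots> = a + (b + (a + (a + (b + (k + b)))))" by (simp only: ba)
  also have "\<dots> = a + (a + (b + (k + (a + (b + (k + b))))))" by (simp only: ba)
  also have "\<dots> = a + (a + (b + (a + (b + (k + (k + b))))))" by (simp only: ka)
  also have "\<dots> = a + (a + (a + (b + (k + (b + (k + (k + b)))))))" by (simp only: ba)
  also have "\<dots> = a + (a + (a + (b + (b + (k + (k + (k + b)))))))" by (simp only: ka)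
  also have "\<dots> = (a + a + a) + (b + b + b)" by (simp only: k3 add.assoc)
  finally show ?thesis .
qed

lemma commute_minus: assumes "x + y = y + x" shows "- x + y = y + - (x::'g::group_add)"
proof -
  have "- x + (x + y) + - x = - x + (y + x) + - x" by (simp only: assms)
  then show ?thesis by (simp add: grp_word del: add_uminus_conv_diff)
qed

lemma grp_span_abelian:
  assumes "\<And>x y. x \<in> S \<Longrightarrow> y \<in> S \<Longrightarrow> x + y = y + x" "x \<in> grp_span S" "y \<in> grp_span S" shows "x + y = y + x"
proof -
  have sC: "subgrp {z. y + z = z + y}" for y :: "'a"
    unfolding subgrp_def using commute_minus[of _ y] by (auto simp del: add_uminus_conv_diff) (metis add.assoc)
  have "grp_span S \<subseteq> {z. y + z = z + y}" if "y \<in> S" for y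
    using assms(1) that by (intro grp_span_least sC) auto
  then have "z + x = x + z" if "z \<in> S" for z using subsetD[OF _ assms(2)] that by blast
  then have "S \<subseteq> {z. x + z = z + x}" by auto
  then have "grp_span S \<subseteq> {z. x + z = z + x}" by (intro grp_span_least sC)
  then show ?thesis using assms(3) by blast
qed

lemma cube_conj: "x + x + x = 0 \<Longrightarrow> cjg x w + cjg x w + cjg x w = (0::'g::group_add)"
  by (simp only: cjg_add[symmetric]) simp

lemma cube_minus: "x + x + x = 0 \<Longrightarrow> - x + - x + - x = (0::'g::group_add)"
  by (metis add.assoc minus_add neg_equal_0_iff_equal)

lemma cmt_conj: "cmt (cjg c w) x = cjg (cmt c (cjg x (- w))) w"
  by (simp add: cmt_def grp_word del: add_uminus_conv_diff)

lemma cmt_eq_diff: assumes "cmt x v = cmt y v" shows "cjg (x - y) v = x - y"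
proof -
  have "cjg x v = x + cmt y v" using assms by (simp only: cjg_cmt)
  moreover have "cjg (x - y) v = cjg x v + - cjg y v" by (simp only: diff_conv_add_uminus cjg_add cjg_minus)
  ultimately show ?thesis by (simp only: cjg_cmt[of v y]) (simp add: grp_word del: add_uminus_conv_diff)
qed

lemma cjg_fixed_grp_span: assumes "\<And>s. s \<in> S \<Longrightarrow> cjg x s = x" "f \<in> grp_span S" shows "cjg x f = x"
  using assms(2)
proof (induction rule: grp_span.induct)
  case (grp_span_minus y)
  have "cjg (cjg x y) (- y) = x" by (simp only: cjg_cjg) simp
  then show ?case by (simp only: grp_span_minus.IH)
next
  case (grp_span_add y z)
  then show ?case by (simp only: cjg_cjg[symmetric])
qed (use assms in auto)

definition elementary :: "'g::group_add set \<Rightarrow> bool" where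
  "elementary E \<longleftrightarrow> (\<forall>x\<in>E. \<forall>y\<in>E. x + y = y + x) \<and> (\<forall>x\<in>E. x + x + x = 0)"

section \<open>Bounding the derived group\<close>
text \<open>Used with \<open>Y\<close> generated by finitely many translations, \<open>J\<close> the
  inversion of the loop and \<open>P\<close> the part of the derived group in \<open>Y\<close>. The
  conditions on cubes concern \<open>J\<close> and \<open>s + J\<close> in place of the generators
  \<open>s\<close>, because it is for these that they can be proved.\<close>

locale jgroup =
  fixes Y P S :: "'g::group_add set" and J m
  assumes Y: "Y = grp_span S" and nil: "Y = ucs Y m" and JJ: "J + J = 0" and J_Y: "\<And>x. x \<in> Y \<Longrightarrow> cjg x J \<in> Y"
    and finP: "finite P" and nP: "normal_in Y P" and J_P: "\<And>x. x \<in> P \<Longrightarrow> cjg x J \<in> P"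
    and cubeJ: "\<And>c. c \<in> P \<Longrightarrow> cmt J c + cmt J c + cmt J c = 0"
    and cubeS: "\<And>s c. s \<in> S \<Longrightarrow> c \<in> P \<Longrightarrow> cmt (s + J) c + cmt (s + J) c + cmt (s + J) c = 0"
begin
lemma subgrp_Y: "subgrp Y" unfolding Y by (rule subgrp_grp_span)

lemma S_subset_Y: "S \<subseteq> Y" unfolding Y by (rule grp_span_sup)

lemma minus_J: "- J = J" using JJ by (simp add: minus_unique)

lemma cjJJ: "cjg (cjg x J) J = x" by (simp only: cjg_cjg JJ) simp

lemma subgrp_P: "subgrp P" using nP by (simp add: normal_in_def)

lemma P_subset_Y: "P \<subseteq> Y" using nP by (simp add: normal_in_def)

text \<open>The subgroups are normalized by \<open>J\<close> as well as by \<open>Y\<close>, so that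
  commutators of \<open>C E\<close> with \<open>J\<close> and \<open>s + J\<close> stay in
  \<open>C E\<close>.\<close>

definition admissible where
  "admissible E \<longleftrightarrow> E \<subseteq> P \<and> normal_in Y E \<and> (\<forall>x\<in>E. cjg x J \<in> E) \<and> elementary E"

definition C where "C E = {c \<in> P. \<forall>y\<in>E. c + y = y + c}"

end

locale jgroup_max = jgroup +
  fixes E assumes E: "admissible E" and max: "\<And>E'. admissible E' \<Longrightarrow> E \<subseteq> E' \<Longrightarrow> E' = E"
begin
lemma sE: "subgrp E" and EP: "E \<subseteq> P" and nE: "normal_in Y E" and EJ: "\<And>x. x \<in> E \<Longrightarrow> cjg x J \<in> E"
  and Eab: "\<And>x y. x \<in> E \<Longrightarrow> y \<in> E \<Longrightarrow> x + y = y + x" and E3: "\<And>x. x \<in> E \<Longrightarrow> x + x + x = 0"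
  using E by (auto simp: admissible_def normal_in_def elementary_def)

lemma C_cjg: assumes "c \<in> C E" "cjg c v \<in> P" "\<And>y. y \<in> E \<Longrightarrow> cjg y (- v) \<in> E" shows "cjg c v \<in> C E"
proof -
  have "cjg c v + y = y + cjg c v" if "y \<in> E" for y
  proof -
    have "c + cjg y (- v) = cjg y (- v) + c" using assms(1,3) that by (simp add: C_def)
    then have "cjg (c + cjg y (- v)) v = cjg (cjg y (- v) + c) v" by simp
    then show ?thesis by (simp add: grp_word del: add_uminus_conv_diff)
  qed
  then show ?thesis using assms(2) by (simp add: C_def)
qed

lemma nC: "normal_in Y (C E)"
proof -
  have "subgrp (C E)" unfolding subgrp_def
  proof (intro conjI ballI)
    show "0 \<in> C E" using subgrp_P by (simp add: C_def sgpD)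
    show "- x \<in> C E" if "x \<in> C E" for x
      using that sgpD(2)[OF subgrp_P] commute_minus[of x] unfolding C_def by (simp del: add_uminus_conv_diff)
    show "x + y \<in> C E" if "x \<in> C E" "y \<in> C E" for x y
      using that subgrp_P unfolding C_def by (auto simp: sgpD) (metis add.assoc)
  qed
  moreover have "cjg c x \<in> C E" if "c \<in> C E" "x \<in> Y" for c x
  proof (rule C_cjg[OF that(1)])
    show "cjg c x \<in> P" using that by (intro nrmD[OF nP]) (auto simp: C_def)
    show "cjg y (- x) \<in> E" if "y \<in> E" for y
      by (rule nrmD[OF nE that sgpD(2)[OF subgrp_Y \<open>x \<in> Y\<close>]])
  qed
  moreover have "C E \<subseteq> Y" using P_subset_Y by (auto simp: C_def)
  ultimately show ?thesis by (simp add: normal_in_def)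
qed

lemma CJ: "c \<in> C E \<Longrightarrow> cjg c J \<in> C E"
  by (rule C_cjg) (use J_P EJ in \<open>auto simp: C_def minus_J\<close>)

lemma EC: "E \<subseteq> C E" using EP Eab by (auto simp: C_def)

lemma sC: "subgrp (C E)" using nC by (simp add: normal_in_def)

text \<open>The upper central series of \<open>C E\<close> above \<open>E\<close> under the action
  of \<open>Y\<close>. By \<open>ucs_U\<close> the nilpotency of \<open>Y\<close> makes it reach all
  of \<open>C E\<close>.\<close>

fun U where "U 0 = E" | "U (Suc i) = {c \<in> C E. \<forall>x\<in>Y. cmt c x \<in> U i}"

lemma U_C: "U i \<subseteq> C E" by (cases i) (use EC in auto)

lemma U_normal_in: "normal_in Y (U i)"
proof (induction i)
  case 0
  then show ?case using nE by simp
next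
  case (Suc i)
  have "U (Suc i) = C E \<inter> {x \<in> Y. \<forall>y\<in>Y. cmt x y \<in> U i}" using nC by (auto simp: normal_in_def)
  then show ?case using nC normal_in_centralizer_mod[OF subgrp_Y Suc] by (auto simp: normal_in_def subgrp_def)
qed

lemma ucs_U: "ucs Y i \<inter> C E \<subseteq> U i"
proof (induction i)
  case 0
  then show ?case using sgpD(1)[OF sE] by auto
next
  case (Suc i)
  then show ?case using normal_in_cmt[OF nC] by auto
qed

lemma C_comm: "c \<in> C E \<Longrightarrow> y \<in> E \<Longrightarrow> y + c = c + y" by (simp add: C_def)

lemma cube_add: assumes "a \<in> C E" "b \<in> C E" "cmt b a \<in> E"
  shows "(a + b) + (a + b) + (a + b) = (a + a + a) + (b + b + b)"
  using assms C_comm E3 by (intro cube_add_class2) auto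

definition V where "V = {c \<in> C E. c + c + c = 0 \<and> (\<forall>x\<in>Y. cmt c x \<in> E)}"

lemma V_add: assumes "a \<in> V" "b \<in> V" shows "a + b \<in> V"
proof -
  have ab: "a \<in> C E" "b \<in> C E" "cmt b a \<in> E" "a \<in> Y" "b \<in> Y" "a + a + a = 0" "b + b + b = 0"
    using assms P_subset_Y by (auto simp: V_def C_def)
  have "cmt (a + b) x \<in> E" if "x \<in> Y" for x
    unfolding cmt_add_l using assms that ab(5) by (intro sgpD(3)[OF sE] nrmD[OF nE]) (auto simp: V_def)
  moreover have "(a + b) + (a + b) + (a + b) = 0" using cube_add[OF ab(1-3)] ab(6,7) by simp
  ultimately show ?thesis using sgpD(3)[OF sC ab(1,2)] by (simp add: V_def)
qed

lemma V_minus: assumes "a \<in> V" shows "- a \<in> V"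
proof -
  have a: "a \<in> C E" "- a \<in> Y" "a + a + a = 0" using assms P_subset_Y sgpD(2)[OF subgrp_Y] by (auto simp: V_def C_def)
  have "cmt (- a) x \<in> E" if "x \<in> Y" for x
    unfolding cmt_minus_l using assms that a(2) by (intro sgpD(2)[OF sE] nrmD[OF nE]) (auto simp: V_def)
  then show ?thesis using cube_minus[OF a(3)] sgpD(2)[OF sC a(1)] unfolding V_def by blast
qed

lemma V_J: assumes "a \<in> V" shows "cjg a J \<in> V"
proof -
  have "cmt (cjg a J) x \<in> E" if "x \<in> Y" for x
  proof -
    have "cmt (cjg a J) x = cjg (cmt a (cjg x J)) J"
      using cmt_conj[where c = a and w = J and x = x] by (simp only: minus_J)
    moreover have "cmt a (cjg x J) \<in> E" using assms J_Y[OF that] by (simp add: V_def)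
    ultimately show ?thesis using EJ by simp
  qed
  then show ?thesis using assms cube_conj CJ unfolding V_def by blast
qed

text \<open>Adjoining \<open>d\<close> to \<open>E\<close> preserves admissibility only if
  \<open>J\<close> preserves the result. So \<open>c\<close> is split into the eigenparts
  \<open>c + cjg c J\<close> and \<open>- c + cjg c J\<close> of the involution; maximality puts
  both into \<open>E\<close>, hence also \<open>c + c\<close>, and then \<open>c\<close>, whose
  order divides 3.\<close>

lemma V_subset: "V \<subseteq> E"
proof
  fix c assume c: "c \<in> V"
  have no: "d \<in> E" if d: "d \<in> V" and dJ: "cjg d J \<in> grp_span (insert d E)" for d
  proof -
    let ?E = "grp_span (insert d E)"
    have sub: "insert d E \<subseteq> ?E" by (rule grp_span_sup)
    have dC: "d \<in> C E" "d + d + d = 0" using d by (auto simp: V_def)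
    have ab: "x + y = y + x" if "x \<in> ?E" "y \<in> ?E" for x y
      by (rule grp_span_abelian[OF _ that]) (use Eab C_comm[OF dC(1)] C_comm[OF dC(1), symmetric] in auto)
    have "x + x + x = 0" if "x \<in> ?E" for x using that
    proof (induction rule: grp_span.induct)
      case (grp_span_add x y)
      have "cmt y x = 0" unfolding cmt_0_iff by (rule ab) (use grp_span_add in auto)
      then have "(x + y) + (x + y) + (x + y) = (x + x + x) + (y + y + y)"
        by (intro cube_add_class2) auto
      then show ?case using grp_span_add by simp
    qed (use dC E3 cube_minus in auto)
    then have "elementary ?E" using ab by (auto simp: elementary_def)
    moreover have "?E \<subseteq> P" using dC EP by (intro grp_span_least subgrp_P) (auto simp: C_def)
    moreover have gen: "cjg x v \<in> ?E" if "x \<in> ?E" "\<And>y. y \<in> insert d E \<Longrightarrow> cjg y v \<in> ?E" for x v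
      using that(1)
    proof (induction rule: grp_span.induct)
      case (grp_span_in x) then show ?case by (rule that(2))
    next
      case (grp_span_minus x) show ?case unfolding cjg_minus by (rule grp_span.grp_span_minus) (rule grp_span_minus.IH)
    next
      case (grp_span_add x y) show ?case unfolding cjg_add by (rule grp_span.grp_span_add) (rule grp_span_add.IH)+
    qed simp
    moreover have "normal_in Y ?E"
      unfolding normal_in_def
    proof (intro conjI ballI)
      fix n x assume n: "n \<in> ?E" and x: "x \<in> Y"
      show "cjg n x \<in> ?E"
      proof (rule gen[OF n])
        fix y assume "y \<in> insert d E"
        then show "cjg y x \<in> ?E"
        proof
          assume "y = d"
          have "cmt d x \<in> E" using d x by (simp add: V_def)
          then show ?thesis unfolding \<open>y = d\<close> cjg_cmt by (intro grp_span_add[OF grp_span_in grp_span_in]) auto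
        next
          assume "y \<in> E" then show ?thesis using nrmD[OF nE _ x] sub by blast
        qed
      qed
    qed (use calculation P_subset_Y in \<open>auto intro: subgrp_grp_span\<close>)
    ultimately have "admissible ?E" unfolding admissible_def using dJ EJ sub by blast
    then have "?E = E" using max sub by blast
    then show "d \<in> E" using sub by blast
  qed
  have c': "cjg c J \<in> V" by (rule V_J) fact
  have cX: "c \<in> Y" "cjg c J \<in> Y" using c c' P_subset_Y by (auto simp: V_def C_def)
  have d1: "c + cjg c J \<in> E"
  proof (rule no)
    show "c + cjg c J \<in> V" using c c' by (rule V_add)
    have "cjg (c + cjg c J) J = cjg c J + cjg (cjg c J) J" by (rule cjg_add)
    also have "\<dots> = cjg c J + c" by (simp only: cjJJ)
    also have "cjg c J + c = (c + cjg c J) + cmt (cjg c J) c" by (simp add: cmt_def grp_word del: add_uminus_conv_diff)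
    also have "\<dots> \<in> grp_span (insert (c + cjg c J) E)"
      by (rule grp_span_add[OF grp_span_in grp_span_in]) (use c' cX in \<open>auto simp: V_def\<close>)
    finally show "cjg (c + cjg c J) J \<in> grp_span (insert (c + cjg c J) E)" .
  qed
  have d2: "- c + cjg c J \<in> E"
  proof (rule no)
    show "- c + cjg c J \<in> V" by (rule V_add[OF V_minus[OF c] c'])
    have "cjg (- c + cjg c J) J = cjg (- c) J + cjg (cjg c J) J" by (rule cjg_add)
    also have "\<dots> = - cjg c J + c" by (simp only: cjJJ cjg_minus)
    also have "\<dots> = - (- c + cjg c J)" by (simp only: minus_add[of "- c"] minus_minus)
    finally have "cjg (- c + cjg c J) J = - (- c + cjg c J)" .
    then show "cjg (- c + cjg c J) J \<in> grp_span (insert (- c + cjg c J) E)"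
      by (simp only:) (intro grp_span_minus grp_span_in, simp)
  qed
  have "(c + cjg c J) - (- c + cjg c J) = c + c" by (simp add: grp_word del: add_uminus_conv_diff)
  then have cc: "c + c \<in> E" using sgpD(4)[OF sE d1 d2] by simp
  have "c + c + c = 0" using c by (simp add: V_def)
  then have "- (c + c) = c" by (rule minus_unique)
  then show "c \<in> E" using sgpD(2)[OF sE cc] by (simp only:)
qed

text \<open>Alperin: choose the least \<open>i\<close> such that \<open>U i\<close> has an element of order 3 outside \<open>E\<close>. Conjugating it
multiplies it by a commutator from the term below, and comparing cubes in a group of class 2 puts
that commutator into \<open>E\<close>. So the element lies in \<open>V\<close>, against the maximality of \<open>E\<close>.\<close>
lemma exponent3_in_E: assumes c: "c \<in> C E" "c + c + c = 0" shows "c \<in> E"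
proof (rule ccontr)
  assume "c \<notin> E"
  have "c \<in> U m" using ucs_U[of m] c(1) nC nil by (auto simp: normal_in_def)
  then have ex: "\<exists>i. \<exists>c. c \<in> U i \<and> c + c + c = 0 \<and> c \<notin> E" using c \<open>c \<notin> E\<close> by blast
  define i where "i = (LEAST i. \<exists>c. c \<in> U i \<and> c + c + c = 0 \<and> c \<notin> E)"
  obtain c where c: "c \<in> U i" "c + c + c = 0" "c \<notin> E" using LeastI_ex[OF ex] unfolding i_def by blast
  have least: "x \<in> E" if "x \<in> U l" "x + x + x = 0" "l < i" for x l
    using not_less_Least[of l "\<lambda>i. \<exists>c. c \<in> U i \<and> c + c + c = 0 \<and> c \<notin> E"] that unfolding i_def by blast
  have cC: "c \<in> C E" using c U_C by blast
  obtain j where j: "i = Suc j" using c by (cases i) auto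
  have centralizer_criterion: "u \<in> E" if "u \<in> U l" "l < i" "cmt u c \<in> E" "c + u = cjg c v" for u l v
  proof -
    have "(c + u) + (c + u) + (c + u) = (c + c + c) + (u + u + u)"
      using that U_C cC by (intro cube_add) auto
    moreover have "(c + u) + (c + u) + (c + u) = 0" unfolding that(4) by (rule cube_conj) fact
    ultimately have "u + u + u = 0" using c(2) by simp
    then show ?thesis using least that by blast
  qed
  have cX: "c \<in> Y" using cC P_subset_Y by (auto simp: C_def)
  \<comment> \<open>The class 2 hypothesis of \<open>centralizer_criterion\<close> has to be earned
    by induction: \<open>cmt u c\<close> lies one term lower than \<open>u\<close>, and conjugation
    by \<open>u\<close> multiplies \<open>c\<close> by the inverse of this commutator, to which the
    criterion applies.\<close>
  have A: "cmt u c \<in> E" if "u \<in> U l" "l < i" for u l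
    using that
  proof (induction l arbitrary: u)
    case 0
    then have "cmt u c = 0" unfolding cmt_0_iff using C_comm[OF cC] by simp
    then show ?case using sgpD(1)[OF sE] by simp
  next
    case (Suc l)
    let ?w = "cmt u c"
    have w: "?w \<in> U l" using Suc.prems cX by simp
    have sUl: "- ?w \<in> U l"
    proof -
      have "subgrp (U l)" using U_normal_in by (simp add: normal_in_def)
      then show ?thesis using w sgpD(2) by blast
    qed
    have "cmt (- ?w) c \<in> E" using Suc.IH[OF sUl] Suc.prems by simp
    moreover have "c + - ?w = cjg c u" by (simp add: cmt_def grp_word del: add_uminus_conv_diff)
    ultimately have "- ?w \<in> E" using centralizer_criterion[OF sUl] Suc.prems by simp
    then have "- (- ?w) \<in> E" by (rule sgpD(2)[OF sE])
    then show ?case by simp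
  qed
  have "cmt c x \<in> E" if x: "x \<in> Y" for x
  proof -
    have u: "cmt c x \<in> U j" using c(1) x j by simp
    then show ?thesis using centralizer_criterion[OF u _ A[OF u] cjg_cmt[symmetric]] j by simp
  qed
  then have "c \<in> V" using cC c(2) by (simp add: V_def)
  then show False using V_subset c(3) by blast
qed

text \<open>Commutators with \<open>J\<close> and \<open>s + J\<close> have cube \<open>0\<close>
  and stay in \<open>C E\<close>, so \<open>exponent3_in_E\<close> applies to them;
  \<open>cmt_add_r\<close> then isolates the contribution of the generator \<open>s\<close>.\<close>

lemma commutators_in_E: assumes "c \<in> C E" "x \<in> Y" shows "cmt c x \<in> E"
proof -
  have cP: "c \<in> P" using assms by (simp add: C_def)
  have J: "cmt c J \<in> E" if c: "c \<in> C E" for c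
  proof -
    have cP: "c \<in> P" using c by (simp add: C_def)
    have "cmt J c = - cjg c J + c" by (simp add: cmt_def grp_word del: add_uminus_conv_diff)
    then have "cmt J c \<in> C E" using CJ[OF c] sC c sgpD by metis
    then have "cmt J c \<in> E" by (rule exponent3_in_E) (rule cubeJ[OF cP])
    then show ?thesis unfolding cmt_swap[of c J] by (rule sgpD(2)[OF sE])
  qed
  have S: "cmt c s \<in> E" if c: "c \<in> C E" and s: "s \<in> S" for c s
  proof -
    have cP: "c \<in> P" using c by (simp add: C_def)
    have "cmt (s + J) c = - cjg (cjg c s) J + c" by (simp add: cmt_def grp_word del: add_uminus_conv_diff)
    moreover have "cjg (cjg c s) J \<in> C E" using s S_subset_Y by (intro CJ nrmD[OF nC] c) auto
    ultimately have "cmt (s + J) c \<in> C E" using sC c sgpD by metis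
    then have "cmt (s + J) c \<in> E" by (rule exponent3_in_E) (rule cubeS[OF s cP])
    then have "- cmt (s + J) c \<in> E" by (rule sgpD(2)[OF sE])
    then have "cmt c (s + J) \<in> E" by (simp only: cmt_swap[of c])
    then have "- cmt c J + cmt c (s + J) \<in> E" using sgpD(2,3)[OF sE] J[OF c] by blast
    then have "cjg (cmt c s) J \<in> E" unfolding cmt_add_r by simp
    then show ?thesis using EJ[of "cjg (cmt c s) J"] by (simp only: cjJJ)
  qed
  show ?thesis by (rule cmt_grp_span[OF nE Y _ assms(2)]) (rule S[OF assms(1)])
qed
end

context jgroup
begin
lemma admissible_exists: "\<exists>E. admissible E \<and> (\<forall>E'. admissible E' \<and> E \<subseteq> E' \<longrightarrow> E' = E)"
proof -
  have "admissible {0}" unfolding admissible_def normal_in_def elementary_def subgrp_def using sgpD(1)[OF subgrp_P] sgpD(1)[OF subgrp_Y] by auto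
  moreover have "finite {E. admissible E}"
    by (rule finite_subset[of _ "Pow P"]) (use finP in \<open>auto simp: admissible_def\<close>)
  ultimately obtain E where "admissible E" "\<forall>E'\<in>{E. admissible E}. E \<subseteq> E' \<longrightarrow> E = E'"
    using finite_has_maximal[of "{E. admissible E}"] by blast
  then show ?thesis by blast
qed

text \<open>The bound does not mention \<open>S\<close> or \<open>Y\<close>; this uniformity is its
  purpose. \<open>E\<close> is bounded by its fixed points, \<open>C E\<close> modulo fixed points
  by its commutators with \<open>S0\<close>, which lie in \<open>E\<close>, and \<open>P\<close>
  modulo \<open>C E\<close> by its action on \<open>E\<close>.\<close>

lemma card_bound:
  assumes S0: "S0 \<subseteq> S" "finite S0"
    and n: "\<And>E. elementary_ops Z (grp_span S0) E \<Longrightarrow> card E \<le> card {x \<in> E. \<forall>f\<in>grp_span S0. cjg x f = x} ^ n"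
    and Z: "\<And>x z. x \<in> P \<Longrightarrow> z \<in> Z \<Longrightarrow> cjg x z = x"
    and b: "finite B" "{x \<in> P. \<forall>f\<in>grp_span S0. cjg x f = x} \<subseteq> B"
  shows "card P \<le> (card B * (card B ^ n) ^ card S0) * (card B ^ n) ^ (card B ^ n)"
proof -
  obtain E where E: "admissible E" and max: "\<And>E'. admissible E' \<Longrightarrow> E \<subseteq> E' \<Longrightarrow> E' = E" using admissible_exists by blast
  interpret jgroup_max Y P S J m E
    by unfold_locales (use E max in auto)
  let ?F = "grp_span S0"
  have FX: "?F \<subseteq> Y" unfolding Y by (rule grp_span_mono) (rule S0)
  have fE: "finite E" using EP finP finite_subset by blast
  have "elementary_ops Z ?F E"
    unfolding elementary_ops_def using fE sE E EP Z FX nrmD[OF nE] unfolding admissible_def elementary_def by blast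
  then have "card E \<le> card {x \<in> E. \<forall>f\<in>?F. cjg x f = x} ^ n" by (rule n)
  also have "\<dots> \<le> card B ^ n" using b EP by (intro power_mono card_mono) auto
  finally have cE: "card E \<le> card B ^ n" .
  have T_fixed_of_assoc: "1 \<le> card E" using sgpD(1)[OF sE] fE by (simp add: card_gt_0_iff Suc_le_eq) blast
  let ?C = "C E"
  have CP: "?C \<subseteq> P" by (auto simp: C_def)
  have "card ?C \<le> card B * card ((\<lambda>c. restrict (cmt c) S0) ` ?C)"
  proof (rule card_fibers_le)
    show "finite ?C" using CP finP finite_subset by blast
    fix x y assume xy: "x \<in> ?C" "y \<in> ?C" "restrict (cmt x) S0 = restrict (cmt y) S0"
    have "cmt x s = cmt y s" if "s \<in> S0" for s using fun_cong[OF xy(3), of s] that by simp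
    then have "cjg (x - y) f = x - y" if "f \<in> ?F" for f using cjg_fixed_grp_span cmt_eq_diff that by blast
    moreover have "x - y \<in> P" using xy CP by (intro sgpD(4)[OF subgrp_P]) auto
    ultimately show "x - y \<in> B" using b by blast
  qed (rule b)
  also have "card ((\<lambda>c. restrict (cmt c) S0) ` ?C) \<le> card (S0 \<rightarrow>\<^sub>E E)"
    using commutators_in_E S0 S_subset_Y fE by (intro card_mono finite_PiE) auto
  also have "card (S0 \<rightarrow>\<^sub>E E) = card E ^ card S0" using S0 by (simp add: card_PiE)
  also have "\<dots> \<le> (card B ^ n) ^ card S0" using cE by (rule power_mono) simp
  finally have cC: "card ?C \<le> card B * (card B ^ n) ^ card S0" by simp
  have "card P \<le> card ?C * card ((\<lambda>p. restrict (\<lambda>x. cjg x p) E) ` P)"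
  proof (rule card_fibers_le)
    show "finite ?C" using CP finP finite_subset by blast
    fix p q assume pq: "p \<in> P" "q \<in> P" "restrict (\<lambda>x. cjg x p) E = restrict (\<lambda>x. cjg x q) E"
    have "(p - q) + y = y + (p - q)" if "y \<in> E" for y
    proof -
      have "cjg y p = cjg y q" using fun_cong[OF pq(3), of y] that by simp
      then have "p + cjg y p + - q = p + cjg y q + - q" by simp
      then show ?thesis by (simp add: grp_word del: add_uminus_conv_diff)
    qed
    then show "p - q \<in> ?C" using sgpD(4)[OF subgrp_P pq(1,2)] by (simp add: C_def)
  qed (rule finP)
  also have "card ((\<lambda>p. restrict (\<lambda>x. cjg x p) E) ` P) \<le> card (E \<rightarrow>\<^sub>E E)"
    using nrmD[OF nE] P_subset_Y fE by (intro card_mono finite_PiE) auto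
  also have "card (E \<rightarrow>\<^sub>E E) = card E ^ card E" using fE by (simp add: card_PiE)
  also have "\<dots> \<le> (card B ^ n) ^ card E" using cE by (rule power_mono) simp
  also have "\<dots> \<le> (card B ^ n) ^ (card B ^ n)" using cE T_fixed_of_assoc by (intro power_increasing) auto
  finally have "card P \<le> card ?C * (card B ^ n) ^ (card B ^ n)" by simp
  also have "\<dots> \<le> (card B * (card B ^ n) ^ card S0) * (card B ^ n) ^ (card B ^ n)"
    using cC by (rule mult_le_mono1)
  finally show ?thesis .
qed
end

section \<open>The multiplication group\<close>
text \<open>Permutations of the whole type become an instance of \<open>group_add\<close>, so that
  the additive group theory applies; mappings of the carrier are extended by the identity.\<close>

typedef 'a bijection = "{f :: 'a \<Rightarrow> 'a. bij f}"
  morphisms app Abs_bijection by (rule exI[of _ id]) simp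

lemma bij_app: "bij (app p)" using app by blast

instantiation bijection :: (type) group_add
begin
definition "0 = Abs_bijection id"

definition "p + q = Abs_bijection (app p \<circ> app q)"

definition "- p = Abs_bijection (inv_into UNIV (app p))"

definition "p - q = p + - (q :: 'a bijection)"

lemma app_0: "app (0 :: 'a bijection) = id" by (simp add: zero_bijection_def Abs_bijection_inverse)

lemma app_add: "app (p + q) = app p \<circ> app (q :: 'a bijection)"
  by (simp add: plus_bijection_def Abs_bijection_inverse bij_app bij_comp)

lemma app_minus: "app (- p) = inv_into UNIV (app (p :: 'a bijection))"
  by (simp add: uminus_bijection_def Abs_bijection_inverse bij_app bij_imp_bij_inv)

instance
proof
  show "p + q + r = p + (q + r)" for p q r :: "'a bijection"
    by (simp add: app_inject[symmetric] app_add comp_assoc)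
  show "0 + p = p" for p :: "'a bijection" by (simp add: app_inject[symmetric] app_add app_0)
  show "p + 0 = p" for p :: "'a bijection" by (simp add: app_inject[symmetric] app_add app_0)
  show "- p + p = 0" for p :: "'a bijection"
    by (simp add: app_inject[symmetric] app_add app_0 app_minus bij_app bij_is_inj)
  show "p + - q = p - q" for p q :: "'a bijection" by (simp add: minus_bijection_def)
qed
end

lemma bijection_eqI: "(\<And>x. app p x = app q x) \<Longrightarrow> p = q"
  by (simp add: app_inject[symmetric] fun_eq_iff)

lemma app_simps [simp]: "app 0 x = x" "app (p + q) x = app p (app q x)"
  by (simp_all add: app_0 app_add)

context cml
begin

definition Lp :: "'a \<Rightarrow> 'a bijection" where "Lp h = Abs_bijection (\<lambda>x. if e \<cdot> x = x then h \<cdot> x else x)"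

definition Jp :: "'a bijection" where "Jp = Abs_bijection (\<lambda>x. if e \<cdot> x = x then iv x else x)"

lemma app_Lp: "app (Lp h) x = (if e \<cdot> x = x then h \<cdot> x else x)"
proof -
  have "bij (\<lambda>x. if e \<cdot> x = x then h \<cdot> x else x)"
    by (rule o_bij[of "\<lambda>x. if e \<cdot> x = x then iv h \<cdot> x else x"])
      (auto simp: fun_eq_iff left_inv left_inv' e_mul)
  then show ?thesis by (simp add: Lp_def Abs_bijection_inverse)
qed

lemma app_Jp: "app Jp x = (if e \<cdot> x = x then iv x else x)"
proof -
  have "bij (\<lambda>x. if e \<cdot> x = x then iv x else x)"
    by (rule o_bij[of "\<lambda>x. if e \<cdot> x = x then iv x else x"]) (auto simp: fun_eq_iff iv_iv e_iv)
  then show ?thesis by (simp add: Jp_def Abs_bijection_inverse)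
qed

lemma Lp_e: "Lp e = 0" by (rule bijection_eqI) (simp add: app_Lp)

lemma Lp_el: "Lp (e \<cdot> h) = Lp h" by (rule bijection_eqI) (simp add: app_Lp mul_e)

lemma Lp_iv: "Lp (iv h) = - Lp h"
proof -
  have "Lp h + Lp (iv h) = 0" by (rule bijection_eqI) (simp add: app_Lp left_inv' e_mul)
  then show ?thesis by (metis minus_unique)
qed

lemma Lp_inner: "Lp x + Lp y + Lp x = Lp (x \<cdot> (y \<cdot> x))"
proof -
  have "x \<cdot> (y \<cdot> x) = (x \<cdot> x) \<cdot> y" by (metis comm lalt)
  then show ?thesis by (intro bijection_eqI) (simp add: app_Lp e_mul moufang)
qed

definition cubed :: "'a \<Rightarrow> 'a" where "cubed x = x \<cdot> (x \<cdot> x)"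

lemma Lp_cubed: "Lp x + Lp x + Lp x = Lp (cubed x)"
  unfolding Lp_inner cubed_def ..

lemma cubed_assoc: "cubed x \<cdot> (u \<cdot> v) = (cubed x \<cdot> u) \<cdot> v" unfolding cubed_def by (rule cube)

lemma Lp_cubed_comm: "Lp (cubed x) + Lp y = Lp y + Lp (cubed x)"
  by (rule bijection_eqI) (simp add: app_Lp e_mul, metis cubed_assoc comm)

lemma Lp_nuclear: "Lp (cubed x) + Lp y = Lp (cubed x \<cdot> y)"
  by (rule bijection_eqI) (simp add: app_Lp e_mul cubed_assoc)

text \<open>\<open>x \<cdot> y\<close> is
  \<open>cubed y \<cdot> (iv y \<cdot> (x \<cdot> iv y))\<close>. The second factor is handled by
  \<open>Lp_inner\<close>, and the nuclear cube splits off. Hence the translations by a subloop lie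
  in the group generated by the translations by its generators.\<close>

lemma Lp_mul: "Lp (x \<cdot> y) = - Lp y + Lp x + - Lp y + (Lp y + Lp y + Lp y)"
proof -
  have *: "cubed y \<cdot> (iv y \<cdot> (x \<cdot> iv y)) = x \<cdot> y"
  proof -
    have 1: "y \<cdot> (y \<cdot> (iv y \<cdot> (x \<cdot> iv y))) = e \<cdot> x"
      by (simp only: left_inv' mul_e2 comm[of x "iv y"])
    have "cubed y \<cdot> w = y \<cdot> (y \<cdot> (y \<cdot> w))" for w unfolding cubed_def by (metis comm lalt moufang)
    then show ?thesis by (simp only: 1 mul_e2 comm[of y x])
  qed
  have "- Lp y + Lp x + - Lp y + (Lp y + Lp y + Lp y) = Lp (iv y \<cdot> (x \<cdot> iv y)) + Lp (cubed y)"
    unfolding Lp_cubed Lp_iv[symmetric] Lp_inner ..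
  also have "\<dots> = Lp (cubed y \<cdot> (iv y \<cdot> (x \<cdot> iv y)))" by (simp only: Lp_cubed_comm[symmetric] Lp_nuclear)
  finally show ?thesis by (simp only: *)
qed

lemma JJ: "Jp + Jp = 0" by (rule bijection_eqI) (simp add: app_Jp iv_iv e_iv)

lemma minus_Jp: "- Jp = Jp" using JJ by (simp add: minus_unique)

lemma JLJ: "Jp + Lp x + Jp = - Lp x"
  unfolding Lp_iv[symmetric] by (rule bijection_eqI) (simp add: app_Jp app_Lp e_mul e_iv iv_mul iv_iv mul_e2)

lemma LJ: "Jp + Lp x = - Lp x + Jp"
proof -
  have "Jp + Lp x + Jp + Jp = - Lp x + Jp" by (simp only: JLJ)
  then show ?thesis by (simp only: add.assoc JJ) simp
qed

lemma Lp_T: "(- Lp (a \<cdot> b) + Lp a + Lp b) + Lp v = Lp (T a b v) + (- Lp (a \<cdot> b) + Lp a + Lp b)"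
proof (rule bijection_eqI)
  have 1: "app (- Lp (a \<cdot> b) + Lp a + Lp b) x = (if e \<cdot> x = x then T a b x else x)" for x
    by (simp add: Lp_iv[symmetric] app_Lp e_mul T_def)
  show "app ((- Lp (a \<cdot> b) + Lp a + Lp b) + Lp v) x = app (Lp (T a b v) + (- Lp (a \<cdot> b) + Lp a + Lp b)) x" for x
    unfolding app_simps(2)[of _ "Lp v"] app_simps(2)[of "Lp (T a b v)"] 1 by (simp add: app_Lp e_mul T_mul)
qed

text \<open>An inner mapping of \<open>n\<close> conjugates \<open>Lp v\<close> to \<open>Lp (v \<cdot> d)\<close> with \<open>d\<close> one step down, hence it commutes with the translations modulo the previous term.\<close>
lemma loop_ucs_ucs:
  assumes H: "\<And>x. x \<in> H \<Longrightarrow> iv x \<in> H" and Y: "Y = grp_span (Lp ` H)"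
  shows "n \<in> loop_ucs H i \<Longrightarrow> Lp n \<in> ucs Y (2 * i)"
proof (induction i arbitrary: n)
  case 0
  then show ?case by (simp add: Lp_e)
next
  case (Suc i)
  let ?U = "ucs Y (2 * i)" and ?W = "ucs Y (Suc (2 * i))"
  have sY: "subgrp Y" unfolding Y by (rule subgrp_grp_span)
  have nU: "normal_in Y ?U" and nW: "normal_in Y ?W" using ucs_normal_in[OF sY] by blast+
  have sU: "subgrp ?U" and sW: "subgrp ?W" using nU nW by (simp_all add: normal_in_def)
  have LH: "Lp h \<in> Y" if "h \<in> H" for h unfolding Y using that by (intro grp_span_in) simp
  have n: "n \<in> H" "\<And>u v. u \<in> H \<Longrightarrow> v \<in> H \<Longrightarrow> D v n u \<in> loop_ucs H i" using Suc.prems by auto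
  \<comment> \<open>One step of the loop series costs two steps of the group series, which explains
    the factor 2: inner mappings formed with \<open>n\<close> fall into the intermediate term
    \<open>?W\<close>, and then \<open>Lp n\<close> commutes with translations modulo
    \<open>?W\<close>.\<close>
  have I: "- Lp (n \<cdot> u) + Lp n + Lp u \<in> ?W" if u: "u \<in> H" for u
  proof -
    let ?I = "- Lp (n \<cdot> u) + Lp n + Lp u"
    have LnuY: "Lp (n \<cdot> u) \<in> Y" unfolding Lp_mul
      using LH[OF n(1)] LH[OF u] by (intro sgpD(3)[OF sY] sgpD(2)[OF sY])
    have IY: "?I \<in> Y" using LnuY LH[OF n(1)] LH[OF u] by (intro sgpD(3)[OF sY] sgpD(2)[OF sY])
    have "cmt (- ?I) (Lp v) \<in> ?U" if v: "v \<in> H" for v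
    proof -
      define d where "d = Lp (D v n u)"
      have d: "d \<in> ?U" unfolding d_def by (rule Suc.IH) (rule n(2)[OF u v])
      have "?I + Lp v = Lp (v \<cdot> D v n u) + ?I" unfolding T_D[symmetric] by (rule Lp_T)
      then have "?I + Lp v + - ?I = - d + Lp v + - d + (d + d + d)"
        unfolding Lp_mul d_def[symmetric] by (simp add: grp_word del: add_uminus_conv_diff)
      then have "- (?I + Lp v + - ?I) + Lp v = - (d + d + d) + d + cjg d (Lp v)"
        by (simp add: grp_word del: add_uminus_conv_diff)
      moreover have "\<dots> \<in> ?U"
        using d LH[OF v] nrmD[OF nU] by (intro sgpD(3)[OF sU, of _ "cjg d (Lp v)"] sgpD(3)[OF sU, of _ d] sgpD(2)[OF sU] sgpD(3)[OF sU d] d)  (auto intro: sgpD(3)[OF sU d])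
      moreover have "cmt (- ?I) (Lp v) = - (?I + Lp v + - ?I) + Lp v"
        by (simp add: cmt_def grp_word del: add_uminus_conv_diff)
      ultimately show ?thesis by (simp only:)
    qed
    then have "cmt (- ?I) y \<in> ?U" if "y \<in> Y" for y
      by (intro cmt_grp_span[OF nU Y _ that]) auto
    then have "- ?I \<in> ?W" using sgpD(2)[OF sY IY] by simp
    then have "- (- ?I) \<in> ?W" by (rule sgpD(2)[OF sW])
    then show ?thesis by (simp only: minus_minus)
  qed
  \<comment> \<open>Up to sign and conjugation by \<open>Lp u\<close>, this commutator is the inner
    mapping of \<open>n\<close> and \<open>iv u\<close>. The sign of \<open>Lp u\<close> is
    corrected afterwards by exchanging \<open>u\<close> and \<open>iv u\<close>.\<close>
  have "cmt (Lp n) (- Lp u) \<in> ?W" if u: "u \<in> H" for u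
  proof -
    define I' where "I' = - Lp (n \<cdot> iv u) + Lp n + Lp (iv u)"
    have "Lp n + - Lp u = Lp (n \<cdot> iv u) + I'" unfolding I'_def Lp_iv by (simp add: grp_word del: add_uminus_conv_diff)
    also have "Lp (n \<cdot> iv u) = Lp u + Lp n + Lp u + (- Lp u + - Lp u + - Lp u)"
      by (simp only: Lp_mul Lp_iv minus_minus)
    also have "Lp u + Lp n + Lp u + (- Lp u + - Lp u + - Lp u) + I' = Lp u + Lp n + - Lp u + - Lp u + I'"
      by (simp add: grp_word del: add_uminus_conv_diff)
    finally have eq0: "Lp n + - Lp u = Lp u + Lp n + - Lp u + - Lp u + I'" .
    have eq: "Lp n + - Lp u = (Lp u + Lp n + - Lp u) + (- Lp u + I')"
      unfolding eq0 by (simp only: add.assoc)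
    have "- (Lp u + Lp n + - Lp u) + (Lp n + - Lp u) = - Lp u + I'"
      unfolding eq by (rule minus_add_cancel)
    then have "- (Lp u + Lp n + - Lp u) + (Lp n + - Lp u) + Lp u = cjg I' (Lp u)" by (simp only:)
    then have "cjg I' (Lp u) = - (Lp u + Lp n + - Lp u) + Lp n"
      by (simp add: add.assoc)
    then have "cmt (Lp n) (- Lp u) = - cjg I' (Lp u)"
      by (simp add: cmt_def grp_word del: add_uminus_conv_diff)
    moreover have "cjg I' (Lp u) \<in> ?W" by (rule nrmD[OF nW I[OF H[OF u], folded I'_def] LH[OF u]])
    ultimately show ?thesis using sgpD(2)[OF sW] by simp
  qed
  from this[OF H] have "cmt (Lp n) (Lp u) \<in> ?W" if "u \<in> H" for u
  proof -
    have "cmt (Lp n) (- Lp (iv u)) \<in> ?W" by (rule \<open>\<And>u. u \<in> H \<Longrightarrow> cmt (Lp n) (- Lp (iv u)) \<in> ?W\<close>[OF that])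
    then show ?thesis by (simp only: Lp_iv minus_minus)
  qed
  then have "cmt (Lp n) y \<in> ?W" if "y \<in> Y" for y
    by (intro cmt_grp_span[OF nW Y _ that]) auto
  then show ?case using LH[OF n(1)] by simp
qed

lemma grp_span_gen: "grp_span (Lp ` gen S) = grp_span (Lp ` S)"
proof
  show "grp_span (Lp ` gen S) \<subseteq> grp_span (Lp ` S)"
  proof (rule grp_span_least[OF _ subgrp_grp_span], rule image_subsetI)
    fix x assume "x \<in> gen S"
    then show "Lp x \<in> grp_span (Lp ` S)"
    proof (induction rule: gen.induct)
      case gen_e then show ?case by (simp add: Lp_e)
    next
      case (gen_in g) then show ?case unfolding Lp_el by (intro grp_span_in) simp
    next
      case (gen_iv x) then show ?case unfolding Lp_iv by (intro grp_span_minus)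
    next
      case (gen_mul x y) then show ?case unfolding Lp_mul by (intro grp_span_add grp_span_minus)
    qed
  qed
  have "Lp ` S \<subseteq> Lp ` gen S" using Lp_el gen_in by (metis image_subsetI imageI)
  then show "grp_span (Lp ` S) \<subseteq> grp_span (Lp ` gen S)" by (rule grp_span_mono)
qed

lemma grp_span_nilpotent: assumes "finite S" shows "\<exists>m. grp_span (Lp ` S) = ucs (grp_span (Lp ` S)) m"
proof -
  let ?Y = "grp_span (Lp ` S)"
  obtain k where k: "loop_ucs (gen S) k = gen S" using fgen_centrally_nilpotent[OF assms] by blast
  have Y: "?Y = grp_span (Lp ` gen S)" by (rule grp_span_gen[symmetric])
  have "Lp ` gen S \<subseteq> ucs ?Y (2 * k)" using loop_ucs_ucs[OF gen_iv Y] k by auto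
  moreover have "normal_in ?Y (ucs ?Y (2 * k))" by (rule ucs_normal_in) (rule subgrp_grp_span)
  ultimately have "?Y \<subseteq> ucs ?Y (2 * k)" using grp_span_least[of "Lp ` gen S"] Y by (simp add: normal_in_def)
  then show ?thesis using \<open>normal_in ?Y (ucs ?Y (2 * k))\<close> by (auto simp: normal_in_def)
qed

section \<open>The derived group of the multiplication group\<close>

abbreviation M where "M \<equiv> grp_span (range Lp)"

definition M_der where "M_der = grp_span {cmt a b | a b. a \<in> M \<and> b \<in> M}"

lemma Lp_cubed_central: "x \<in> M \<Longrightarrow> Lp (cubed y) + x = x + Lp (cubed y)"
proof (induction rule: grp_span.induct)
  case (grp_span_in x) then show ?case using Lp_cubed_comm by auto
next
  case (grp_span_minus x) then show ?case using commute_minus[of x "Lp (cubed y)"] by (simp del: add_uminus_conv_diff)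
next
  case (grp_span_add x z) then show ?case by (metis add.assoc)
qed simp

lemma cubed_mul: "cubed (x \<cdot> y) = cubed x \<cdot> cubed y"
proof -
  have 1: "(x \<cdot> y) \<cdot> (x \<cdot> y) = x \<cdot> (x \<cdot> (y \<cdot> y))" by (rule moufang_sq_nest)
  have c: "y \<cdot> (y \<cdot> (y \<cdot> w)) = cubed y \<cdot> w" for y w unfolding cubed_def by (metis comm lalt moufang)
  have "cubed (x \<cdot> y) = x \<cdot> (x \<cdot> (y \<cdot> (x \<cdot> (y \<cdot> y))))" unfolding cubed_def 1 by (rule moufang_sq_nest)
  also have "y \<cdot> (x \<cdot> (y \<cdot> y)) = ((y \<cdot> y) \<cdot> x) \<cdot> y" by (rule moufang)
  also have "\<dots> = y \<cdot> ((y \<cdot> y) \<cdot> x)" by (rule comm)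
  also have "\<dots> = y \<cdot> (y \<cdot> (y \<cdot> x))" by (simp only: lalt[of y x])
  also have "\<dots> = cubed y \<cdot> x" by (rule c)
  also have "\<dots> = x \<cdot> cubed y" by (rule comm)
  also have "x \<cdot> (x \<cdot> (x \<cdot> cubed y)) = cubed x \<cdot> cubed y" by (rule c)
  finally show ?thesis .
qed

lemma cubed_iv: "cubed (iv x) = iv (cubed x)" unfolding cubed_def by (simp only: iv_mul)

lemma sM: "subgrp M" by (rule subgrp_grp_span)

lemma LM: "Lp h \<in> M" by (auto intro: grp_span_in)

lemma cmM: "a \<in> M \<Longrightarrow> b \<in> M \<Longrightarrow> cmt a b \<in> M"
  unfolding cmt_def by (intro grp_span_add grp_span_minus)

lemma M1M: "M_der \<subseteq> M" unfolding M_der_def by (rule grp_span_least[OF _ sM]) (auto intro: cmM)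

lemma sM1: "subgrp M_der" unfolding M_der_def by (rule subgrp_grp_span)

lemma cmt_M_der: "a \<in> M \<Longrightarrow> b \<in> M \<Longrightarrow> cmt a b \<in> M_der" unfolding M_der_def by (intro grp_span_in) blast

lemma cjg_cmt_dist: "cjg (cmt a b) w = cmt (cjg a w) (cjg b w)"
  by (simp add: cmt_def grp_word del: add_uminus_conv_diff)

lemma cjg_grp_span: assumes "\<And>x. x \<in> S \<Longrightarrow> cjg x w \<in> grp_span S'" "x \<in> grp_span S" shows "cjg x w \<in> grp_span S'"
  using assms(2)
proof (induction rule: grp_span.induct)
  case (grp_span_in x) then show ?case by (rule assms(1))
next
  case (grp_span_minus x) show ?case unfolding cjg_minus by (rule grp_span.grp_span_minus) (rule grp_span_minus.IH)
next
  case (grp_span_add x y) show ?case unfolding cjg_add by (rule grp_span.grp_span_add) (rule grp_span_add.IH)+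
qed simp

lemma J_grp_span: "x \<in> grp_span (Lp ` S) \<Longrightarrow> cjg x Jp \<in> grp_span (Lp ` S)"
proof (rule cjg_grp_span)
  fix x assume "x \<in> Lp ` S"
  then obtain s where "s \<in> S" "x = Lp s" by blast
  then show "cjg x Jp \<in> grp_span (Lp ` S)" unfolding minus_Jp by (simp only: JLJ) (intro grp_span_minus grp_span_in, simp)
qed

lemma M_der_cjg: assumes "c \<in> M_der" "\<And>x. x \<in> M \<Longrightarrow> cjg x w \<in> M" shows "cjg c w \<in> M_der"
  unfolding M_der_def
proof (rule cjg_grp_span)
  show "c \<in> grp_span {cmt a b |a b. a \<in> M \<and> b \<in> M}" using assms(1) by (simp add: M_der_def)
  fix x assume "x \<in> {cmt a b |a b. a \<in> M \<and> b \<in> M}"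
  then obtain a b where "x = cmt a b" "a \<in> M" "b \<in> M" by blast
  then have "cjg x w = cmt (cjg a w) (cjg b w)" "cjg a w \<in> M" "cjg b w \<in> M" using cjg_cmt_dist assms(2) by auto
  then show "cjg x w \<in> grp_span {cmt a b |a b. a \<in> M \<and> b \<in> M}" by (intro grp_span_in) blast
qed

lemma M_der_J: "c \<in> M_der \<Longrightarrow> cjg c Jp \<in> M_der" by (erule M_der_cjg) (erule J_grp_span)

lemma M_der_M: "c \<in> M_der \<Longrightarrow> x \<in> M \<Longrightarrow> cjg c x \<in> M_der"
  by (erule M_der_cjg) (intro sgpD(3)[OF sM] sgpD(2)[OF sM])

section \<open>Cubes of commutators with involutions\<close>

definition nuclear where "nuclear q \<longleftrightarrow> e \<cdot> q = q \<and> (\<forall>u v. q \<cdot> (u \<cdot> v) = (q \<cdot> u) \<cdot> v)"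

lemma nuclear_loop_ucs: "nuclear q \<longleftrightarrow> q \<in> loop_ucs UNIV 1" unfolding loop_ucs_1 nuclear_def ..

lemma nuclear_mul: "nuclear p \<Longrightarrow> nuclear q \<Longrightarrow> nuclear (p \<cdot> q)" and nuclear_iv: "nuclear p \<Longrightarrow> nuclear (iv p)"
  using loop_ucs_1_normal_sub unfolding nuclear_loop_ucs normal_sub_def by blast+

lemma nuclear_cubed: "nuclear (cubed x)" unfolding nuclear_def using cubed_assoc by (simp add: cubed_def e_mul)

text \<open>Conjugation by \<open>c\<close> permutes the involutions \<open>Lp h + Jp\<close> and multiplies the cubes of their parameters by a
fixed nuclear element. Nuclear elements commute, so this factor is trivial on the derived group; and
two such involutions with parameters of equal cube have a product of order 3.\<close>
definition shifts where
  "shifts c q \<longleftrightarrow> (\<forall>h. \<exists>h'. cjg (Lp h + Jp) c = Lp h' + Jp \<and> cubed h' = cubed h \<cdot> q)"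

definition shifts_by where "shifts_by c q \<longleftrightarrow> nuclear q \<and> shifts c q \<and> shifts (- c) (iv q)"

lemma shifts_add: assumes "shifts c p" "shifts d q" "nuclear p" "nuclear q" shows "shifts (c + d) (p \<cdot> q)"
  unfolding shifts_def
proof
  fix h
  obtain h' where h': "cjg (Lp h + Jp) c = Lp h' + Jp" "cubed h' = cubed h \<cdot> p" using assms shifts_def by meson
  obtain h'' where h'': "cjg (Lp h' + Jp) d = Lp h'' + Jp" "cubed h'' = cubed h' \<cdot> q" using assms shifts_def by meson
  have "cjg (Lp h + Jp) (c + d) = cjg (cjg (Lp h + Jp) c) d" by (rule cjg_cjg[symmetric])
  also have "\<dots> = Lp h'' + Jp" by (simp only: h'(1) h''(1))
  finally have "cjg (Lp h + Jp) (c + d) = Lp h'' + Jp" .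
  moreover have "cubed h'' = cubed h \<cdot> (p \<cdot> q)" unfolding h'' h' by (rule cubed_assoc[symmetric])
  ultimately show "\<exists>h'. cjg (Lp h + Jp) (c + d) = Lp h' + Jp \<and> cubed h' = cubed h \<cdot> (p \<cdot> q)" by blast
qed

lemma shifts_by_add: assumes "shifts_by c p" "shifts_by d q" shows "shifts_by (c + d) (p \<cdot> q)"
proof -
  have "shifts (- d + - c) (iv q \<cdot> iv p)" using assms by (intro shifts_add) (auto simp: shifts_by_def nuclear_iv)
  then show ?thesis using assms shifts_add nuclear_mul unfolding shifts_by_def by (simp add: minus_add iv_mul comm[of "iv q"] del: add_uminus_conv_diff)
qed

lemma shifts_by_minus: "shifts_by c q \<Longrightarrow> shifts_by (- c) (iv q)"
  unfolding shifts_by_def by (simp add: nuclear_iv iv_iv) (simp add: nuclear_def)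

text \<open>Because the inversion inverts translations, conjugating by \<open>Lp y\<close> turns the
  parameter \<open>h\<close> into \<open>iv y \<cdot> (h \<cdot> iv y)\<close>, and cubing respects
  products.\<close>

lemma shifts_Lp: "shifts (Lp y) (cubed (iv y) \<cdot> cubed (iv y))"
  unfolding shifts_def
proof
  fix h
  have "cjg (Lp h + Jp) (Lp y) = - Lp y + Lp h + (Jp + Lp y)" by (simp only: add.assoc)
  also have "\<dots> = Lp (iv y) + Lp h + Lp (iv y) + Jp" by (simp only: LJ Lp_iv add.assoc)
  also have "\<dots> = Lp (iv y \<cdot> (h \<cdot> iv y)) + Jp" by (simp only: Lp_inner)
  finally have "cjg (Lp h + Jp) (Lp y) = Lp (iv y \<cdot> (h \<cdot> iv y)) + Jp" .
  moreover have "cubed (iv y \<cdot> (h \<cdot> iv y)) = cubed h \<cdot> (cubed (iv y) \<cdot> cubed (iv y))"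
    unfolding cubed_mul using cubed_assoc comm by metis
  ultimately show "\<exists>h'. cjg (Lp h + Jp) (Lp y) = Lp h' + Jp \<and> cubed h' = cubed h \<cdot> (cubed (iv y) \<cdot> cubed (iv y))" by blast
qed

lemma shifts_by_ex: "c \<in> M \<Longrightarrow> \<exists>q. shifts_by c q"
proof (induction rule: grp_span.induct)
  case grp_span_0
  have "shifts (Lp e) (cubed (iv e) \<cdot> cubed (iv e))" by (rule shifts_Lp)
  then have "shifts 0 e" by (simp add: Lp_e iv_ee cubed_def e_e)
  then have "shifts_by 0 e" unfolding shifts_by_def by (simp add: iv_ee nuclear_def e_e e_mul mul_e)
  then show ?case by blast
next
  case (grp_span_in x)
  then obtain y where y: "x = Lp y" by blast
  have "iv (cubed (iv y) \<cdot> cubed (iv y)) = cubed (iv (iv y)) \<cdot> cubed (iv (iv y))" by (simp only: iv_mul cubed_iv)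
  then have "shifts_by (Lp y) (cubed (iv y) \<cdot> cubed (iv y))"
    unfolding shifts_by_def using shifts_Lp[of y] shifts_Lp[of "iv y"] nuclear_mul nuclear_cubed by (simp add: Lp_iv)
  then show ?case unfolding y by blast
next
  case (grp_span_minus x) then show ?case using shifts_by_minus by blast
next
  case (grp_span_add x y) then show ?case using shifts_by_add by blast
qed

lemma shifts_by_M_der: "c \<in> M_der \<Longrightarrow> shifts_by c e"
  unfolding M_der_def
proof (induction rule: grp_span.induct)
  case grp_span_0
  have "shifts (Lp e) (cubed (iv e) \<cdot> cubed (iv e))" by (rule shifts_Lp)
  then have "shifts 0 e" by (simp add: Lp_e iv_ee cubed_def e_e)
  then show ?case unfolding shifts_by_def by (simp add: iv_ee nuclear_def e_e e_mul mul_e)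
next
  case (grp_span_in x)
  then obtain a b where x: "x = cmt a b" "a \<in> M" "b \<in> M" by blast
  obtain p q where pq: "shifts_by a p" "shifts_by b q" using shifts_by_ex x by blast
  have "shifts_by x (iv p \<cdot> iv q \<cdot> p \<cdot> q)"
    unfolding x(1) cmt_def by (intro shifts_by_add shifts_by_minus pq)
  moreover have "iv p \<cdot> iv q \<cdot> p \<cdot> q = e"
  proof -
    have "iv p \<cdot> iv q \<cdot> p = e \<cdot> iv q" using pq by (metis comm left_inv')
    then show ?thesis by (metis mul_e inv_l)
  qed
  ultimately show ?case by simp
next
  case (grp_span_minus x) then show ?case using shifts_by_minus iv_ee by metis
next
  case (grp_span_add x y) then show ?case using shifts_by_add e_e by metis
qed

text \<open>\<open>Lp_inner\<close> folds the word into a single translation followed by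
  \<open>Lp (iv k)\<close>. The equality of the nuclear cubes reduces the parameter of that
  translation to \<open>k\<close>.\<close>

lemma cube_TT: assumes "cubed h = cubed k"
  shows "(Lp h + - Lp k) + (Lp h + - Lp k) + (Lp h + - Lp k) = 0"
proof -
  let ?k = "iv k"
  have "(Lp h + - Lp k) + (Lp h + - Lp k) + (Lp h + - Lp k) = Lp h + (Lp ?k + Lp h + Lp ?k) + Lp h + Lp ?k"
    by (simp only: Lp_iv add.assoc)
  also have "\<dots> = Lp (h \<cdot> ((?k \<cdot> (h \<cdot> ?k)) \<cdot> h)) + Lp ?k" by (simp only: Lp_inner)
  also have "h \<cdot> ((?k \<cdot> (h \<cdot> ?k)) \<cdot> h) = e \<cdot> k"
  proof -
    have c: "y \<cdot> (y \<cdot> (y \<cdot> w)) = cubed y \<cdot> w" for y w unfolding cubed_def by (metis comm lalt moufang)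
    have "?k \<cdot> (h \<cdot> ?k) = h \<cdot> (?k \<cdot> ?k)" by (metis comm lalt)
    then have "h \<cdot> ((?k \<cdot> (h \<cdot> ?k)) \<cdot> h) = h \<cdot> (h \<cdot> (h \<cdot> (?k \<cdot> ?k)))" by (simp only: comm[of _ h])
    also have "\<dots> = cubed k \<cdot> (?k \<cdot> ?k)" by (simp only: c assms)
    also have "\<dots> = k \<cdot> (k \<cdot> (k \<cdot> (?k \<cdot> ?k)))" by (simp only: c)
    also have "\<dots> = e \<cdot> k" by (simp only: left_inv' mul_e2 inv_r) (rule comm)
    finally show ?thesis .
  qed
  finally show ?thesis by (simp only: Lp_el Lp_iv) simp
qed

text \<open>\<open>Lp h + Jp\<close> is an involution, so its commutator with \<open>c\<close> is
  its product with its conjugate \<open>Lp h' + Jp\<close>, that is \<open>Lp h + - Lp h'\<close>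
  with \<open>h\<close> and \<open>h'\<close> of equal cube.\<close>

lemma cube_cmt: assumes "c \<in> M_der"
  shows "cmt (Lp h + Jp) c + cmt (Lp h + Jp) c + cmt (Lp h + Jp) c = 0"
proof -
  have "shifts c e" using shifts_by_M_der[OF assms] by (simp add: shifts_by_def)
  then obtain h' where h': "cjg (Lp h + Jp) c = Lp h' + Jp" "cubed h' = cubed h \<cdot> e" unfolding shifts_def by blast
  have "cubed h' = cubed h" using h'(2) by (simp add: comm[of _ e]) (simp add: cubed_def e_mul)
  have inv: "- (Lp h + Jp) = Lp h + Jp" using LJ[of "iv h"] by (simp only: minus_add minus_Jp Lp_iv minus_minus)
  have "cmt (Lp h + Jp) c = - (Lp h + Jp) + cjg (Lp h + Jp) c" by (simp only: cmt_def add.assoc)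
  also have "\<dots> = (Lp h + Jp) + (Lp h' + Jp)" by (simp only: inv h'(1))
  also have "\<dots> = Lp h + (Jp + Lp h') + Jp" by (simp only: add.assoc)
  also have "\<dots> = Lp h + - Lp h' + (Jp + Jp)" by (simp only: LJ add.assoc)
  finally have "cmt (Lp h + Jp) c = Lp h + - Lp h'" by (simp only: JJ) simp
  then show ?thesis using cube_TT[OF \<open>cubed h' = cubed h\<close>[symmetric]] by (simp only:)
qed
end

section \<open>Finiteness of the derived group\<close>

lemma fgE: assumes "fgen H" obtains S where "finite S" "H = grp_span S"
  using assms unfolding fgen_def by metis

lemma polycyc_exp3_finite: "polycyc {0} N \<Longrightarrow> finite N"
proof (induction rule: polycyc.induct)
  case (polycyc_step N w)
  have sN: "subgrp N" using polycyc_step polycyc_subgrp by blast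
  interpret cyc_ext N w using sN polycyc_step by unfold_locales auto
  have w3: "w + w + w \<in> N" using polycyc_step.hyps(3) sgpD(1)[OF sN] by auto
  let ?A = "(\<lambda>(n, k). n + nmul k w) ` (N \<times> {..<3})"
  have red: "n + nmul k w \<in> ?A" if "n \<in> N" for n k
    using that
  proof (induction k arbitrary: n rule: less_induct)
    case (less k)
    show ?case
    proof (cases "k < 3")
      case True
      then show ?thesis using less.prems by (intro image_eqI[of _ _ "(n, k)"]) auto
    next
      case False
      then have "nmul k w = nmul 3 w + nmul (k - 3) w" using nmul_add[of 3 "k - 3" w] by simp
      then have "n + nmul k w = (n + (w + w + w)) + nmul (k - 3) w" by (simp add: numeral_3_eq_3 add.assoc)
      then show ?thesis using less.IH[of "k - 3" "n + (w + w + w)"] False sgpD(3)[OF sN less.prems w3] by simp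
    qed
  qed
  have "grp_span (insert w N) \<subseteq> ?A \<union> uminus ` ?A"
  proof
    fix x assume "x \<in> grp_span (insert w N)"
    then obtain n k where "n \<in> N" "x = n + nmul k w \<or> - x = n + nmul k w" using elements by blast
    then have "x \<in> ?A \<or> - x \<in> ?A" using red by metis
    then show "x \<in> ?A \<union> uminus ` ?A"
    proof
      assume "- x \<in> ?A"
      then have "- (- x) \<in> uminus ` ?A" by (rule imageI)
      then show ?thesis by simp
    qed simp
  qed
  then show ?case by (rule finite_subset) (use polycyc_step in auto)
qed simp

lemma finite_torsion: assumes "finite N" "subgrp N" "x \<in> N" shows "\<exists>m>0. nmul m x = 0"
proof -
  have "range (\<lambda>k. nmul k x) \<subseteq> N" using subgrp_nmul assms by blast
  then have "finite (range (\<lambda>k. nmul k x))" using assms finite_subset by blast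
  then have "\<not> inj (\<lambda>k. nmul k x)" using finite_imageD infinite_UNIV_nat by blast
  then obtain i j where "nmul i x = nmul j x" "i \<noteq> j" unfolding inj_def by blast
  then obtain a d where "nmul (a + d) x = nmul a x" "d > 0"
    by (metis add_diff_inverse_nat linorder_neqE_nat not_less_iff_gr_or_eq zero_less_diff)
  then have "nmul a x + nmul d x = nmul a x + 0" by (simp add: nmul_add)
  then have "nmul d x = 0" by (simp only: add_left_cancel)
  then show ?thesis using \<open>d > 0\<close> by blast
qed

lemma grp_span_finite_support: "x \<in> grp_span B \<Longrightarrow> \<exists>B'. finite B' \<and> B' \<subseteq> B \<and> x \<in> grp_span B'"
proof (induction rule: grp_span.induct)
  case grp_span_0
  then show ?case by (intro exI[of _ "{}"]) auto
next
  case (grp_span_in x)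
  then show ?case by (intro exI[of _ "{x}"]) (auto intro: grp_span.grp_span_in)
next
  case (grp_span_minus x)
  then show ?case using grp_span.grp_span_minus by blast
next
  case (grp_span_add x y)
  then obtain A B' where "finite A" "A \<subseteq> B" "x \<in> grp_span A" "finite B'" "B' \<subseteq> B" "y \<in> grp_span B'" by blast
  then have "x \<in> grp_span (A \<union> B')" "y \<in> grp_span (A \<union> B')" using grp_span_mono[of A "A \<union> B'"] grp_span_mono[of B' "A \<union> B'"] by blast+
  then show ?case using \<open>finite A\<close> \<open>finite B'\<close> \<open>A \<subseteq> B\<close> \<open>B' \<subseteq> B\<close> grp_span.grp_span_add
    by (intro exI[of _ "A \<union> B'"]) auto
qed

context cml
begin
lemma finite_support: assumes "finite A" "A \<subseteq> M" shows "\<exists>S. finite S \<and> A \<subseteq> grp_span (Lp ` S)"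
  using assms
proof (induction A rule: finite_induct)
  case (insert x A)
  then obtain S where S: "finite S" "A \<subseteq> grp_span (Lp ` S)" by auto
  obtain B where B: "finite B" "B \<subseteq> range Lp" "x \<in> grp_span B" using grp_span_finite_support[of x "range Lp"] insert.prems by auto
  obtain S' where S': "finite S'" "B = Lp ` S'" using finite_subset_image[OF B(1,2)] by blast
  have "grp_span (Lp ` S) \<subseteq> grp_span (Lp ` (S \<union> S'))" "grp_span (Lp ` S') \<subseteq> grp_span (Lp ` (S \<union> S'))" by (rule grp_span_mono, blast)+
  then have "insert x A \<subseteq> grp_span (Lp ` (S \<union> S'))" using S B S' by blast
  then show ?case using S S' by (intro exI[of _ "S \<union> S'"]) auto
qed auto

definition centre where "centre = {z \<in> M. \<forall>x\<in>M. z + x = x + z}"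

lemma grp_span_polycyc:
  assumes "finite S" shows "polycyc centre (grp_span (Lp ` S))"
proof -
  let ?Y = "grp_span (Lp ` S)"
  have YM: "?Y \<subseteq> M" by (rule grp_span_mono) auto
  obtain m where m: "?Y = ucs ?Y m" using grp_span_nilpotent[OF assms] by blast
  have c: "w + w + w \<in> centre" if w: "w \<in> Lp ` S" for w
  proof -
    obtain s where s: "w = Lp s" using w by blast
    have "Lp s + Lp s + Lp s = Lp (cubed s)" by (rule Lp_cubed)
    then show ?thesis unfolding s centre_def using Lp_cubed_central LM by auto
  qed
  have "\<exists>N. polycyc centre N \<and> normal_in ?Y N \<and> Lp ` S \<subseteq> N"
  proof (rule polycyc_nilpotent[OF refl])
    show "Lp ` S \<subseteq> ucs ?Y m" unfolding m[symmetric] by (rule grp_span_sup)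
    show "s + s + s + x = x + (s + s + s) \<or> centre = UNIV" if "s \<in> Lp ` S" "x \<in> ?Y" for s x
      using c[OF that(1)] that(2) YM by (auto simp: centre_def)
    show "w + w + w \<in> centre \<or> (\<exists>c\<in>?Y. \<exists>s\<in>Lp ` S. w = cmt c s)" if "w \<in> Lp ` S" for w using c[OF that] by blast
  qed (use assms in auto)
  then obtain N where N: "polycyc centre N" "normal_in ?Y N" "Lp ` S \<subseteq> N" by blast
  then have "N = ?Y" using grp_span_least[of "Lp ` S" N] by (auto simp: normal_in_def)
  then show ?thesis using N by simp
qed

text \<open>An element of \<open>M_der\<close> involves finitely many translations. In the nilpotent
  group they generate, \<open>polycyc_nilpotent\<close> with \<open>Z = {0}\<close> encloses the
  commutators of generators in a normal subgroup, which is finite by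
  \<open>polycyc_exp3_finite\<close> and contains all commutators.\<close>

lemma M_der_torsion: assumes "c \<in> M_der" shows "\<exists>m>0. nmul m c = 0"
proof -
  obtain B where B: "finite B" "B \<subseteq> {cmt a b | a b. a \<in> M \<and> b \<in> M}" "c \<in> grp_span B"
    using grp_span_finite_support assms unfolding M_der_def by blast
  have "\<forall>x\<in>B. \<exists>a b. a \<in> M \<and> b \<in> M \<and> x = cmt a b" using B(2) by blast
  then obtain f g where fgen: "\<And>x. x \<in> B \<Longrightarrow> f x \<in> M \<and> g x \<in> M \<and> x = cmt (f x) (g x)" by metis
  obtain S where S: "finite S" "f ` B \<union> g ` B \<subseteq> grp_span (Lp ` S)"
    using finite_support[of "f ` B \<union> g ` B"] B(1) fgen by blast
  let ?Y = "grp_span (Lp ` S)"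
  have sY: "subgrp ?Y" by (rule subgrp_grp_span)
  obtain m where m: "?Y = ucs ?Y m" using grp_span_nilpotent[OF S(1)] by blast
  let ?W = "(\<lambda>(a, b). cmt a b) ` (Lp ` S \<times> Lp ` S)"
  have LY: "Lp ` S \<subseteq> ?Y" by (rule grp_span_sup)
  have YM: "?Y \<subseteq> M" by (rule grp_span_mono) auto
  have "\<exists>N. polycyc {0} N \<and> normal_in ?Y N \<and> ?W \<subseteq> N"
  proof (rule polycyc_nilpotent[OF refl])
    have "?W \<subseteq> ?Y" using LY unfolding cmt_def by (auto intro!: grp_span_add grp_span_minus simp del: add_uminus_conv_diff)
    then show "?W \<subseteq> ucs ?Y m" using m by simp
    show "s + s + s + x = x + (s + s + s) \<or> {0} = UNIV" if "s \<in> Lp ` S" "x \<in> ?Y" for s x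
      using that YM Lp_cubed_central Lp_cubed by auto
    show "w + w + w \<in> {0} \<or> (\<exists>c\<in>?Y. \<exists>s\<in>Lp ` S. w = cmt c s)" if "w \<in> ?W" for w using that LY by auto
  qed (use S in auto)
  then obtain N where N: "polycyc {0} N" "normal_in ?Y N" "?W \<subseteq> N" by blast
  have sN: "subgrp N" using N(2) by (simp add: normal_in_def)
  have 1: "cmt s y \<in> N" if "s \<in> Lp ` S" "y \<in> ?Y" for s y
    by (rule cmt_grp_span[OF N(2) refl _ that(2)]) (use N(3) that(1) in auto)
  have "cmt y s \<in> N" if "s \<in> Lp ` S" "y \<in> ?Y" for s y
    unfolding cmt_swap[of y s] by (rule sgpD(2)[OF sN 1[OF that]])
  then have "cmt y y' \<in> N" if "y \<in> ?Y" "y' \<in> ?Y" for y y'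
    using that by (intro cmt_grp_span[OF N(2) refl _ that(2)]) auto
  moreover have "f x \<in> ?Y" "g x \<in> ?Y" if "x \<in> B" for x using S(2) that by blast+
  ultimately have "cmt (f x) (g x) \<in> N" if "x \<in> B" for x using that by blast
  then have "B \<subseteq> N" using fgen by fastforce
  then have "c \<in> N" using grp_span_least[OF _ sN] B(3) by blast
  then show ?thesis using finite_torsion[OF polycyc_exp3_finite[OF N(1)] sN] by blast
qed

text \<open>The intersections of \<open>M_der\<close> with groups generated by finitely many
  translations are finite and exhaust it. All those for \<open>S\<close> containing
  \<open>S0\<close> obey the same bound \<open>K\<close>, so an infinite \<open>M_der\<close> would
  have a subset that is too large.\<close>

lemma M_der_bounded:
  assumes S0: "finite S0" and B: "finite B" "{x \<in> M_der. \<forall>f\<in>grp_span (Lp ` S0). cjg x f = x} \<subseteq> B"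
  shows "finite M_der"
proof -
  obtain n where n: "\<And>E. elementary_ops centre (grp_span (Lp ` S0)) E \<Longrightarrow> card E \<le> card {x \<in> E. \<forall>f\<in>grp_span (Lp ` S0). cjg x f = x} ^ n"
    using polycyc_fixed_bound[OF grp_span_polycyc[OF S0]] by blast
  define K where "K = (card B * (card B ^ n) ^ card (Lp ` S0)) * (card B ^ n) ^ (card B ^ n)"
  have bound: "finite (grp_span (Lp ` S) \<inter> M_der) \<and> card (grp_span (Lp ` S) \<inter> M_der) \<le> K" if S: "finite S" "S0 \<subseteq> S" for S
  proof -
    let ?Y = "grp_span (Lp ` S)"
    let ?P = "?Y \<inter> M_der"
    have sY: "subgrp ?Y" by (rule subgrp_grp_span)
    have YM: "?Y \<subseteq> M" by (rule grp_span_mono) auto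
    have subgrp_P: "subgrp ?P" using sY sM1 by (rule subgrp_Int)
    have fP: "finite ?P" by (rule polycyc_torsion_finite[OF grp_span_polycyc[OF S(1)] subgrp_P]) (use M_der_torsion in auto)
    obtain m where m: "?Y = ucs ?Y m" using grp_span_nilpotent[OF S(1)] by blast
    interpret jgroup ?Y ?P "Lp ` S" Jp m
    proof
      show "?Y = ucs ?Y m" by (rule m)
      show "Jp + Jp = 0" by (rule JJ)
      show "cjg x Jp \<in> ?Y" if "x \<in> ?Y" for x using that by (rule J_grp_span)
      show "finite ?P" by (rule fP)
      show "normal_in ?Y ?P" unfolding normal_in_def
      proof (intro conjI ballI subgrp_P)
        fix c x assume "c \<in> ?P" "x \<in> ?Y"
        moreover from this have "cjg c x \<in> ?Y" by (intro sgpD(3)[OF sY] sgpD(2)[OF sY]) auto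
        ultimately show "cjg c x \<in> ?P" using M_der_M YM by blast
      qed simp
      show "cjg x Jp \<in> ?P" if "x \<in> ?P" for x using that M_der_J J_grp_span by blast
      show "cmt Jp c + cmt Jp c + cmt Jp c = 0" if "c \<in> ?P" for c using cube_cmt[of c e] that by (simp add: Lp_e)
      show "cmt (s + Jp) c + cmt (s + Jp) c + cmt (s + Jp) c = 0" if "s \<in> Lp ` S" "c \<in> ?P" for s c
        using cube_cmt[of c] that by auto
    qed (rule refl)
    have "card ?P \<le> K" unfolding K_def
    proof (rule card_bound[OF _ _ n])
      show "cjg x z = x" if "x \<in> ?P" "z \<in> centre" for x z
      proof -
        have "z + x = x + z" using that M1M unfolding centre_def by blast
        then have "- z + (z + x) = - z + x + z" by (simp only: add.assoc)
        then show ?thesis by simp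
      qed
    qed (use S0 S B in auto)
    then show ?thesis using fP by blast
  qed
  show ?thesis
  proof (rule ccontr)
    assume "infinite M_der"
    then obtain A where A: "A \<subseteq> M_der" "finite A" "card A = Suc K" using infinite_arbitrarily_large by metis
    obtain S where S: "finite S" "A \<subseteq> grp_span (Lp ` S)" using finite_support[OF A(2)] A(1) M1M by blast
    have "A \<subseteq> grp_span (Lp ` (S \<union> S0)) \<inter> M_der" using A(1) S(2) grp_span_mono[of "Lp ` S" "Lp ` (S \<union> S0)"] by blast
    then have "card A \<le> K" using bound[of "S \<union> S0"] S(1) S0 by (meson card_mono finite_UnI le_trans sup_ge2)
    then show False using A(3) by simp
  qed
qed

lemma fgen_abelian_polycyc: assumes "fgen A" "\<And>x y. x \<in> A \<Longrightarrow> y \<in> A \<Longrightarrow> x + y = y + x" shows "polycyc UNIV A"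
proof -
  obtain S where S: "finite S" "A = grp_span S" using assms(1) by (rule fgE)
  have "\<exists>N. polycyc UNIV N \<and> normal_in A N \<and> S \<subseteq> N"
  proof (rule polycyc_nilpotent[OF S(2,1), of UNIV S 1])
    show "S \<subseteq> ucs A 1" using assms(2) S grp_span_sup by (auto simp: cmt_0_iff)
  qed (use S in auto)
  then obtain N where N: "polycyc UNIV N" "normal_in A N" "S \<subseteq> N" by blast
  then have "N = A" using grp_span_least[of S N] S by (auto simp: normal_in_def)
  then show ?thesis using N by simp
qed

section \<open>Finitely generated centralizers\<close>

definition centralizer where "centralizer F = {x \<in> M. \<forall>f\<in>F. cjg x f = x}"

lemma subgrp_centralizer: "subgrp (centralizer F)"
  unfolding subgrp_def
proof (intro conjI ballI)
  show "0 \<in> centralizer F" by (simp add: centralizer_def)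
  show "- x \<in> centralizer F" if "x \<in> centralizer F" for x
    using that unfolding centralizer_def by (simp only: mem_Collect_eq cjg_minus) (auto intro: grp_span_minus)
  show "x + y \<in> centralizer F" if "x \<in> centralizer F" "y \<in> centralizer F" for x y
    using that unfolding centralizer_def by (simp only: mem_Collect_eq cjg_add) (auto intro: grp_span_add)
qed

theorem M_fgen_if_centralizer_fgen:
  assumes F: "F \<subseteq> M" "fgen F" and C: "fgen (centralizer F)" "\<And>x y. x \<in> centralizer F \<Longrightarrow> y \<in> centralizer F \<Longrightarrow> x + y = y + x"
  shows "fgen M"
proof -
  obtain A where A: "finite A" "F = grp_span A" using F(2) by (rule fgE)
  \<comment> \<open>\<open>F\<close> is enlarged to a group generated by translations, to which the
    bounds apply. This can only shrink the centralizer, which stays finitely generated inside a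
    polycyclic abelian group.\<close>
  obtain S0 where S0: "finite S0" "A \<subseteq> grp_span (Lp ` S0)" using finite_support[OF A(1)] F(1) A(2) grp_span_sup by blast
  let ?F = "grp_span (Lp ` S0)"
  have FF: "F \<subseteq> ?F" unfolding A(2) using S0(2) by (rule grp_span_least[OF _ subgrp_grp_span])
  let ?C = "centralizer ?F"
  have CC: "?C \<subseteq> centralizer F" using FF by (auto simp: centralizer_def)
  have pcC: "polycyc UNIV (centralizer F)" by (rule fgen_abelian_polycyc[OF C])
  have "fgen ?C" by (rule polycyc_subgroup_fgen[OF pcC subgrp_centralizer CC])
  then obtain G where G: "finite G" "?C = grp_span G" by (rule fgE)
  have "{x \<in> M_der. \<forall>f\<in>?F. cjg x f = x} = ?C \<inter> M_der" using M1M by (auto simp: centralizer_def)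
  moreover have "finite (?C \<inter> M_der)"
    by (rule polycyc_torsion_finite[OF pcC subgrp_Int[OF subgrp_centralizer sM1]]) (use CC M_der_torsion in auto)
  ultimately have fM1: "finite M_der" using M_der_bounded[OF S0(1)] by auto
  \<comment> \<open>Elements of \<open>M\<close> with the same commutators with the generators of
    \<open>?F\<close> differ by an element of \<open>?C\<close>. As \<open>M_der\<close> is finite,
    only finitely many values occur, so representatives for them together with \<open>G\<close>
    generate \<open>M\<close>.\<close>
  define \<delta> where "\<delta> x = restrict (cmt x) (Lp ` S0)" for x
  have "\<delta> ` M \<subseteq> Lp ` S0 \<rightarrow>\<^sub>E M_der" unfolding \<delta>_def using cmt_M_der LM by auto
  then have fd: "finite (\<delta> ` M)" using finite_PiE[of "Lp ` S0" "\<lambda>_. M_der"] fM1 S0(1) finite_subset by blast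
  define g where "g y = (SOME x. x \<in> M \<and> \<delta> x = y)" for y
  have g: "g (\<delta> x) \<in> M \<and> \<delta> (g (\<delta> x)) = \<delta> x" if "x \<in> M" for x
    unfolding g_def by (rule someI[of _ x]) (use that in simp)
  have "M \<subseteq> grp_span (G \<union> g ` \<delta> ` M)"
  proof
    fix x assume x: "x \<in> M"
    let ?y = "g (\<delta> x)"
    have "cmt x s = cmt ?y s" if "s \<in> Lp ` S0" for s
      using fun_cong[OF conjunct2[OF g[OF x]], of s] that by (simp add: \<delta>_def)
    then have "cjg (x - ?y) f = x - ?y" if "f \<in> ?F" for f using cjg_fixed_grp_span[OF _ that] cmt_eq_diff by blast
    then have "x - ?y \<in> ?C" using sgpD(4)[OF sM x] g[OF x] by (simp add: centralizer_def)
    then have "x - ?y \<in> grp_span (G \<union> g ` \<delta> ` M)" using G(2) grp_span_mono[of G "G \<union> g ` \<delta> ` M"] by blast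
    moreover have "?y \<in> grp_span (G \<union> g ` \<delta> ` M)" using x by (intro grp_span_in) blast
    ultimately have "x - ?y + ?y \<in> grp_span (G \<union> g ` \<delta> ` M)" by (rule grp_span_add)
    then show "x \<in> grp_span (G \<union> g ` \<delta> ` M)" by simp
  qed
  moreover have "grp_span (G \<union> g ` \<delta> ` M) \<subseteq> M"
  proof (rule grp_span_least[OF _ sM])
    have "G \<subseteq> M" using G grp_span_sup by (auto simp: centralizer_def)
    then show "G \<union> g ` \<delta> ` M \<subseteq> M" using g by blast
  qed
  ultimately have "grp_span (G \<union> g ` \<delta> ` M) = M" by blast
  moreover have "finite (G \<union> g ` \<delta> ` M)" using G(1) fd by blast
  ultimately show ?thesis unfolding fgen_def by blast
qed

lemma subgroup_fgen: assumes "F \<subseteq> M" "fgen F" "subgrp H" "H \<subseteq> F" shows "fgen H"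
proof -
  obtain A where A: "finite A" "F = grp_span A" using assms(2) by (rule fgE)
  obtain S where S: "finite S" "A \<subseteq> grp_span (Lp ` S)" using finite_support[OF A(1)] assms(1) A(2) grp_span_sup by blast
  have "F \<subseteq> grp_span (Lp ` S)" unfolding A(2) using S(2) by (rule grp_span_least[OF _ subgrp_grp_span])
  then show ?thesis using polycyc_subgroup_fgen[OF grp_span_polycyc[OF S(1)] assms(3)] assms(4) by blast
qed
end

section \<open>Finiteness conditions\<close>

context group
begin

definition commutant :: "'a set \<Rightarrow> 'a set" where
  "commutant F = {x \<in> carrier G. \<forall>f\<in>F. x \<otimes> f = f \<otimes> x}"

lemma commutant_subgroup: assumes "F \<subseteq> carrier G" shows "subgroup (commutant F) G"
proof
  show "commutant F \<subseteq> carrier G" by (auto simp: commutant_def)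
  show "\<one> \<in> commutant F" using assms by (auto simp: commutant_def)
next
  fix x y assume xy: "x \<in> commutant F" "y \<in> commutant F"
  have "(x \<otimes> y) \<otimes> f = f \<otimes> (x \<otimes> y)" if "f \<in> F" for f
  proof -
    have c: "x \<in> carrier G" "y \<in> carrier G" "f \<in> carrier G" "x \<otimes> f = f \<otimes> x" "y \<otimes> f = f \<otimes> y"
      using xy that assms by (auto simp: commutant_def)
    have "(x \<otimes> y) \<otimes> f = x \<otimes> (f \<otimes> y)" using c by (simp add: m_assoc)
    also have "\<dots> = f \<otimes> (x \<otimes> y)" using c by (simp flip: m_assoc)
    finally show ?thesis .
  qed
  then show "x \<otimes> y \<in> commutant F" using xy by (auto simp: commutant_def)
next
  fix x assume x: "x \<in> commutant F"
  have "inv x \<otimes> f = f \<otimes> inv x" if "f \<in> F" for f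
  proof -
    have c: "x \<in> carrier G" "f \<in> carrier G" "x \<otimes> f = f \<otimes> x" using x that assms by (auto simp: commutant_def)
    have "f = x \<otimes> (f \<otimes> inv x)" using c by (simp flip: m_assoc) (simp add: m_assoc)
    then show ?thesis using c by (metis inv_solve_left inv_closed m_closed)
  qed
  then show "inv x \<in> commutant F" using x by (auto simp: commutant_def)
qed

text \<open>Zorn's lemma is applied to commuting subsets, not subgroups: whatever commutes with
  \<open>H\<close> and a maximal \<open>T\<close> could be added to \<open>T\<close>. So
  \<open>T\<close> is a commutant and thereby a subgroup.\<close>

lemma self_centralizing_exists:
  assumes H: "H \<subseteq> carrier G" and T0: "T0 \<subseteq> commutant H" "\<And>x y. x \<in> T0 \<Longrightarrow> y \<in> T0 \<Longrightarrow> x \<otimes> y = y \<otimes> x"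
  shows "\<exists>T. T0 \<subseteq> T \<and> T \<subseteq> commutant H \<and> (\<forall>x\<in>T. \<forall>y\<in>T. x \<otimes> y = y \<otimes> x) \<and> commutant (H \<union> T) = T"
proof -
  let ?A = "{T. T0 \<subseteq> T \<and> T \<subseteq> commutant H \<and> (\<forall>x\<in>T. \<forall>y\<in>T. x \<otimes> y = y \<otimes> x)}"
  have "\<exists>T\<in>?A. \<forall>Y\<in>?A. T \<subseteq> Y \<longrightarrow> Y = T"
  proof (rule subset_Zorn_nonempty)
    show "?A \<noteq> {}" using T0 by blast
    fix c assume c: "c \<noteq> {}" "subset.chain ?A c"
    then have cA: "c \<subseteq> ?A" and lin: "\<And>a b. a \<in> c \<Longrightarrow> b \<in> c \<Longrightarrow> a \<subseteq> b \<or> b \<subseteq> a"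
      unfolding subset_chain_def by blast+
    have "x \<otimes> y = y \<otimes> x" if "x \<in> \<Union>c" "y \<in> \<Union>c" for x y
    proof -
      obtain a b where ab: "a \<in> c" "x \<in> a" "b \<in> c" "y \<in> b" using \<open>x \<in> \<Union>c\<close> \<open>y \<in> \<Union>c\<close> by blast
      then show ?thesis using lin[OF ab(1,3)] cA by blast
    qed
    moreover have "T0 \<subseteq> \<Union>c" "\<Union>c \<subseteq> commutant H" using cA c(1) by blast+
    ultimately show "\<Union>c \<in> ?A" by simp
  qed
  then obtain T where TA: "T \<in> ?A" and max: "\<forall>Y\<in>?A. T \<subseteq> Y \<longrightarrow> Y = T" ..
  from TA have T: "T0 \<subseteq> T" "T \<subseteq> commutant H" "\<forall>x\<in>T. \<forall>y\<in>T. x \<otimes> y = y \<otimes> x" by simp_all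
  have "commutant (H \<union> T) = T"
  proof
    show "T \<subseteq> commutant (H \<union> T)" using T by (auto simp: commutant_def)
    show "commutant (H \<union> T) \<subseteq> T"
    proof
      fix x assume x: "x \<in> commutant (H \<union> T)"
      have "x \<in> commutant H" "\<And>y. y \<in> T \<Longrightarrow> x \<otimes> y = y \<otimes> x" using x by (auto simp: commutant_def)
      then have "insert x T \<in> ?A" using T by auto
      then have "insert x T = T" using bspec[OF max, of "insert x T"] by blast
      then show "x \<in> T" by blast
    qed
  qed
  then show ?thesis using T by blast
qed

lemma commutator_eq: assumes "a \<in> carrier G" "b \<in> carrier G" shows "commutator G a b = inv (b \<otimes> a) \<otimes> (a \<otimes> b)"
  using assms by (simp add: commutator_def inv_mult_group m_assoc)

lemma central_cancel:
  assumes "u \<in> carrier G" "w \<in> carrier G" "z \<in> carrier G" "z \<otimes> u = u \<otimes> z" "z \<otimes> w = w \<otimes> z"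
  shows "inv (u \<otimes> z) \<otimes> (w \<otimes> z) = inv u \<otimes> w" "(w \<otimes> z) \<otimes> inv (u \<otimes> z) = w \<otimes> inv u"
proof -
  have "inv (u \<otimes> z) \<otimes> (w \<otimes> z) = inv (z \<otimes> u) \<otimes> (z \<otimes> w)" using assms(4,5) by simp
  also have "\<dots> = inv u \<otimes> (inv z \<otimes> (z \<otimes> w))" using assms(1-3) by (simp add: inv_mult_group m_assoc)
  also have "inv z \<otimes> (z \<otimes> w) = w" using assms(1-3) by (simp flip: m_assoc)
  finally show "inv (u \<otimes> z) \<otimes> (w \<otimes> z) = inv u \<otimes> w" .
  have "(w \<otimes> z) \<otimes> inv (u \<otimes> z) = w \<otimes> (z \<otimes> (inv z \<otimes> inv u))" using assms(1-3) by (simp add: inv_mult_group m_assoc)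
  also have "z \<otimes> (inv z \<otimes> inv u) = inv u" using assms(1-3) by (simp flip: m_assoc)
  finally show "(w \<otimes> z) \<otimes> inv (u \<otimes> z) = w \<otimes> inv u" .
qed

section \<open>Products of a subgroup with an abelian subgroup of its centralizer\<close>

context
  fixes H B assumes H: "subgroup H G" and B: "subgroup B G" and BH: "B \<subseteq> commutant H"
    and Bab: "\<And>x y. x \<in> B \<Longrightarrow> y \<in> B \<Longrightarrow> x \<otimes> y = y \<otimes> x"
begin
definition "K = (\<lambda>(h, b). h \<otimes> b) ` (H \<times> B)"

lemma HBcar: "h \<in> H \<Longrightarrow> h \<in> carrier G" "b \<in> B \<Longrightarrow> b \<in> carrier G"
  using H B subgroup.mem_carrier by metis+

lemma HBcomm: "h \<in> H \<Longrightarrow> b \<in> B \<Longrightarrow> b \<otimes> h = h \<otimes> b" using BH by (auto simp: commutant_def)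

lemma K_mult: assumes "h \<in> H" "b \<in> B" "h' \<in> H" "b' \<in> B"
  shows "(h \<otimes> b) \<otimes> (h' \<otimes> b') = (h \<otimes> h') \<otimes> (b \<otimes> b')"
proof -
  have c: "h \<in> carrier G" "b \<in> carrier G" "h' \<in> carrier G" "b' \<in> carrier G" using assms HBcar by auto
  have "(h \<otimes> b) \<otimes> (h' \<otimes> b') = h \<otimes> ((b \<otimes> h') \<otimes> b')" using c by (simp add: m_assoc)
  also have "b \<otimes> h' = h' \<otimes> b" using assms HBcomm by blast
  finally show ?thesis using c by (simp add: m_assoc)
qed

lemma K_I: "h \<in> H \<Longrightarrow> b \<in> B \<Longrightarrow> h \<otimes> b \<in> K" by (auto simp: K_def)

lemma K_E: assumes "k \<in> K" obtains h b where "h \<in> H" "b \<in> B" "k = h \<otimes> b" using assms by (auto simp: K_def)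

lemma H_K: "H \<subseteq> K"
proof
  fix h assume "h \<in> H"
  then have "h \<otimes> \<one> \<in> K" using B by (intro K_I) (auto simp: subgroup.one_closed)
  then show "h \<in> K" using HBcar \<open>h \<in> H\<close> by simp
qed

lemma B_K: "B \<subseteq> K"
proof
  fix b assume "b \<in> B"
  then have "\<one> \<otimes> b \<in> K" using H by (intro K_I) (auto simp: subgroup.one_closed)
  then show "b \<in> K" using HBcar \<open>b \<in> B\<close> by simp
qed

lemma K_subgroup: "subgroup K G"
proof
  show "K \<subseteq> carrier G" using HBcar by (auto elim!: K_E)
  show "\<one> \<in> K" using H_K H subgroup.one_closed by blast
  show "x \<otimes> y \<in> K" if "x \<in> K" "y \<in> K" for x y
    using that H B by (elim K_E) (auto simp: K_mult intro!: K_I subgroup.m_closed)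
  show "inv x \<in> K" if x: "x \<in> K" for x
  proof -
    obtain h b where hb: "h \<in> H" "b \<in> B" "x = h \<otimes> b" using x by (rule K_E)
    have "inv x = inv (b \<otimes> h)" unfolding hb(3) HBcomm[OF hb(1,2)] ..
    also have "\<dots> = inv h \<otimes> inv b" using hb HBcar by (simp add: inv_mult_group)
    finally show ?thesis using hb H B by (auto intro!: K_I subgroup.m_inv_closed)
  qed
qed

lemma commutant_K: "commutant K \<subseteq> commutant (H \<union> B)" using H_K B_K by (auto simp: commutant_def)

text \<open>Elements of \<open>B\<close> are central in the product and cancel. Two conventions for
  commutators occur: \<open>commutator\<close> in the lower central series and the one of
  \<open>derived_set\<close> in the derived series.\<close>

lemma K_quot: assumes "h \<in> H" "b \<in> B" "h' \<in> H" "b' \<in> B"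
  shows "commutator G (h \<otimes> b) (h' \<otimes> b') = commutator G h h'"
    "(h \<otimes> b) \<otimes> (h' \<otimes> b') \<otimes> inv (h \<otimes> b) \<otimes> inv (h' \<otimes> b') = h \<otimes> h' \<otimes> inv h \<otimes> inv h'"
proof -
  have c: "h \<in> carrier G" "b \<in> carrier G" "h' \<in> carrier G" "b' \<in> carrier G" using assms HBcar by auto
  have m: "h \<otimes> h' \<in> H" "h' \<otimes> h \<in> H" "b \<otimes> b' \<in> B" using assms H B by (auto intro: subgroup.m_closed)
  have 1: "(h \<otimes> b) \<otimes> (h' \<otimes> b') = (h \<otimes> h') \<otimes> (b \<otimes> b')" "(h' \<otimes> b') \<otimes> (h \<otimes> b) = (h' \<otimes> h) \<otimes> (b \<otimes> b')"
    using K_mult[OF assms] K_mult[OF assms(3,4,1,2)] Bab[OF assms(2,4)] by simp_all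
  note 2 = central_cancel[OF HBcar(1)[OF m(2)] HBcar(1)[OF m(1)] HBcar(2)[OF m(3)] HBcomm[OF m(2,3)] HBcomm[OF m(1,3)]]
  show "commutator G (h \<otimes> b) (h' \<otimes> b') = commutator G h h'"
    using c 2(1) by (simp add: commutator_eq 1)
  have 3: "x \<otimes> y \<otimes> inv x \<otimes> inv y = (x \<otimes> y) \<otimes> inv (y \<otimes> x)" if "x \<in> carrier G" "y \<in> carrier G" for x y
    using that by (simp add: inv_mult_group m_assoc)
  have "(h \<otimes> b) \<otimes> (h' \<otimes> b') \<otimes> inv (h \<otimes> b) \<otimes> inv (h' \<otimes> b')
      = ((h \<otimes> b) \<otimes> (h' \<otimes> b')) \<otimes> inv ((h' \<otimes> b') \<otimes> (h \<otimes> b))"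
    by (rule 3) (use c in auto)
  also have "\<dots> = (h \<otimes> h') \<otimes> inv (h' \<otimes> h)" unfolding 1 by (rule 2(2))
  also have "\<dots> = h \<otimes> h' \<otimes> inv h \<otimes> inv h'" by (rule 3[symmetric, OF c(1,3)])
  finally show "(h \<otimes> b) \<otimes> (h' \<otimes> b') \<otimes> inv (h \<otimes> b) \<otimes> inv (h' \<otimes> b') = h \<otimes> h' \<otimes> inv h \<otimes> inv h'" .
qed

lemma lcs_H: "lcs G H i \<subseteq> H"
proof (induction i)
  case (Suc i)
  have "commutator G a h \<in> H" if "a \<in> lcs G H i" "h \<in> H" for a h
    using that Suc H unfolding commutator_def by (auto intro!: subgroup.m_closed subgroup.m_inv_closed)
  then show ?case unfolding lcs.simps by (intro generate_subgroup_incl[OF _ H]) blast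
qed simp

lemma lcs_K: "lcs G K (Suc i) = lcs G H (Suc i)"
proof (induction i)
  case 0
  have "(\<Union>a\<in>K. \<Union>h\<in>K. {commutator G a h}) = (\<Union>a\<in>H. \<Union>h\<in>H. {commutator G a h})"
  proof
    have "commutator G x y \<in> (\<Union>a\<in>H. \<Union>h\<in>H. {commutator G a h})" if xy: "x \<in> K" "y \<in> K" for x y
    proof -
      obtain h b where 1: "h \<in> H" "b \<in> B" "x = h \<otimes> b" using xy(1) by (rule K_E)
      obtain h' b' where 2: "h' \<in> H" "b' \<in> B" "y = h' \<otimes> b'" using xy(2) by (rule K_E)
      show ?thesis unfolding 1 2 K_quot(1)[OF 1(1,2) 2(1,2)] using 1(1) 2(1) by blast
    qed
    then show "(\<Union>a\<in>K. \<Union>h\<in>K. {commutator G a h}) \<subseteq> (\<Union>a\<in>H. \<Union>h\<in>H. {commutator G a h})" by blast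
  qed (use H_K in blast)
  then show ?case by simp
next
  case (Suc i)
  have "commutator G a (h \<otimes> b) = commutator G a h" if "a \<in> H" "h \<in> H" "b \<in> B" for a h b
    using K_quot(1)[of a \<one> h b] that subgroup.one_closed[OF B] HBcar by simp
  then have "(\<Union>a\<in>lcs G H (Suc i). \<Union>h\<in>K. {commutator G a h}) = (\<Union>a\<in>lcs G H (Suc i). \<Union>h\<in>H. {commutator G a h})"
    using H_K lcs_H[of "Suc i"] by (auto elim!: K_E simp del: lcs.simps) blast+
  then show ?case using Suc by (simp only: lcs.simps(2)[of _ _ "Suc i"])
qed

lemma derived_K: "(derived G ^^ Suc i) K = (derived G ^^ Suc i) H"
proof -
  have "derived_set G K = derived_set G H"
  proof
    have "x \<otimes> y \<otimes> inv x \<otimes> inv y \<in> derived_set G H" if xy: "x \<in> K" "y \<in> K" for x y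
    proof -
      obtain h b where 1: "h \<in> H" "b \<in> B" "x = h \<otimes> b" using xy(1) by (rule K_E)
      obtain h' b' where 2: "h' \<in> H" "b' \<in> B" "y = h' \<otimes> b'" using xy(2) by (rule K_E)
      show ?thesis unfolding 1 2 K_quot(2)[OF 1(1,2) 2(1,2)] using 1(1) 2(1) by blast
    qed
    then show "derived_set G K \<subseteq> derived_set G H" by blast
    show "derived_set G H \<subseteq> derived_set G K" by (rule mono_derived_set[OF H_K])
  qed
  then have "derived G K = derived G H" by (simp only: derived_def)
  then show ?thesis by (simp only: funpow_Suc_right comp_apply)
qed

lemma nontrivial_K: "H \<noteq> {\<one>} \<Longrightarrow> K \<noteq> {\<one>}"
  using H_K subgroup.one_closed[OF H] by blast

text \<open>For \<open>n = 1\<close> the term of index \<open>n - 1\<close> is the group itself,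
  where \<open>lcs_K\<close> and \<open>derived_K\<close> say nothing; there nontriviality passes
  from \<open>H\<close> to the larger group.\<close>

lemma class_K:
  "n > 0 \<Longrightarrow> nilpotent_class G H n \<Longrightarrow> nilpotent_class G K n"
  "n > 0 \<Longrightarrow> solvable_class G H n \<Longrightarrow> solvable_class G K n"
proof -
  show "nilpotent_class G K n" if "n > 0" "nilpotent_class G H n"
  proof (cases "n - 1")
    case 0
    then have "n = Suc 0" using that by simp
    then show ?thesis using that lcs_K[of 0] nontrivial_K K_subgroup by (simp add: nilpotent_class_def)
  next
    case (Suc i)
    then have "n = Suc (Suc i)" by simp
    then show ?thesis using that lcs_K[of "Suc i"] lcs_K[of i] K_subgroup by (simp add: nilpotent_class_def del: lcs.simps)
  qed
  show "solvable_class G K n" if "n > 0" "solvable_class G H n"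
  proof (cases "n - 1")
    case 0
    then have "n = Suc 0" using that by simp
    then show ?thesis using that derived_K[of 0] nontrivial_K K_subgroup by (simp add: solvable_class_def)
  next
    case (Suc i)
    then have "n = Suc (Suc i)" by simp
    then show ?thesis using that derived_K[of "Suc i"] derived_K[of i] K_subgroup
      by (simp only: solvable_class_def diff_Suc_Suc diff_zero) simp
  qed
qed
end

end

text \<open>The two properties of the multiplication group from which the equivalence of (2) with (4)-(7) follows.\<close>
locale fin_group = group +
  assumes centralizer_criterion: "\<And>F. subgroup F G \<Longrightarrow> fin_gen G F \<Longrightarrow> fin_gen G (commutant F) \<Longrightarrow>
        (\<And>x y. x \<in> commutant F \<Longrightarrow> y \<in> commutant F \<Longrightarrow> x \<otimes> y = y \<otimes> x) \<Longrightarrow> fin_gen G (carrier G)"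
    and noetherian: "\<And>F H. subgroup F G \<Longrightarrow> fin_gen G F \<Longrightarrow> subgroup H G \<Longrightarrow> H \<subseteq> F \<Longrightarrow> fin_gen G H"
begin
theorem finiteness_conditions:
  shows "fin_gen G (carrier G) \<longleftrightarrow> (\<forall>N. N \<lhd> G \<longrightarrow> fin_gen G N)" (is "?P \<longleftrightarrow> ?Q4")
    "fin_gen G (carrier G) \<longleftrightarrow> (\<exists>A. maximal_abelian_sub G A \<and> fin_gen G A)"
    "n > 0 \<Longrightarrow> nilpotent_class G H n \<Longrightarrow> fin_gen G (carrier G) \<longleftrightarrow> (\<forall>H. nilpotent_class G H n \<longrightarrow> fin_gen G H)"
    "n > 0 \<Longrightarrow> solvable_class G H n \<Longrightarrow> fin_gen G (carrier G) \<longleftrightarrow> (\<forall>H. solvable_class G H n \<longrightarrow> fin_gen G H)"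
    "fin_gen G (carrier G) \<Longrightarrow> group_max_cond G"
proof -
  have all: "fin_gen G H" if "?P" "subgroup H G" for H
    using noetherian[OF subgroup_self that] subgroup.subset[OF that(2)] by blast
  have "carrier G \<lhd> G" by (rule normal_invI[OF subgroup_self]) simp
  then show "?P \<longleftrightarrow> ?Q4" using all normal_imp_subgroup by blast
  \<comment> \<open>\<open>T\<close> is chosen with \<open>commutant (H \<union> T) = T\<close>, so
    the commutant of \<open>K H T\<close> lies in the abelian group \<open>T\<close>, which is part
    of \<open>K H T\<close>. If the latter is finitely generated, so is its commutant by
    \<open>noetherian\<close>, and the criterion applies.\<close>
  have class_case: "?P" if H: "subgroup H G" and fgen: "\<And>B. subgroup B G \<Longrightarrow> B \<subseteq> commutant H \<Longrightarrow>
      (\<And>x y. x \<in> B \<Longrightarrow> y \<in> B \<Longrightarrow> x \<otimes> y = y \<otimes> x) \<Longrightarrow> fin_gen G (K H B)" for H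
  proof -
    have Hc: "H \<subseteq> carrier G" by (rule subgroup.subset[OF H])
    obtain T where T: "T \<subseteq> commutant H" "\<And>x y. x \<in> T \<Longrightarrow> y \<in> T \<Longrightarrow> x \<otimes> y = y \<otimes> x" "commutant (H \<union> T) = T"
      using self_centralizing_exists[OF Hc, of "{}"] by auto
    have Tc: "T \<subseteq> carrier G" using T(1) by (auto simp: commutant_def)
    have sT: "subgroup T G" using commutant_subgroup[of "H \<union> T"] Hc Tc T(3) by simp
    have sK: "subgroup (K H T) G" and TK: "T \<subseteq> K H T" and cK: "commutant (K H T) \<subseteq> T"
      using K_subgroup[OF H sT T(1,2)] B_K[OF H sT T(1,2)] commutant_K[OF H sT T(1,2)] T(3) by auto
    have fK: "fin_gen G (K H T)" by (rule fgen[OF sT T(1,2)])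
    have "fin_gen G (commutant (K H T))"
      by (rule noetherian[OF sK fK commutant_subgroup[OF subgroup.subset[OF sK]]]) (use cK TK in blast)
    then show ?thesis using centralizer_criterion[OF sK fK] cK T(2) by blast
  qed
  show "?P \<longleftrightarrow> (\<forall>H. nilpotent_class G H n \<longrightarrow> fin_gen G H)" if "n > 0" "nilpotent_class G H n"
    using all class_case[of H] that class_K(1)[of H _ n] unfolding nilpotent_class_def[of _ H] by (meson nilpotent_class_def)
  show "?P \<longleftrightarrow> (\<forall>H. solvable_class G H n \<longrightarrow> fin_gen G H)" if "n > 0" "solvable_class G H n"
    using all class_case[of H] that class_K(2)[of H _ n] unfolding solvable_class_def[of _ H] by (meson solvable_class_def)
  have maxab: "\<exists>A. maximal_abelian_sub G A"
  proof -
    obtain T where T: "T \<subseteq> commutant {}" "\<And>x y. x \<in> T \<Longrightarrow> y \<in> T \<Longrightarrow> x \<otimes> y = y \<otimes> x" "commutant ({} \<union> T) = T"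
      using self_centralizing_exists[of "{}" "{}"] by auto
    have Tc: "T \<subseteq> carrier G" using T(1) by (auto simp: commutant_def)
    have "subgroup T G" using commutant_subgroup[OF Tc] T(3) by simp
    moreover have "B = T" if "abelian_sub G B" "T \<subseteq> B" for B
    proof -
      have "B \<subseteq> commutant T" using that subgroup.subset unfolding abelian_sub_def commutant_def by blast
      then show ?thesis using T(3) that(2) by auto
    qed
    ultimately show ?thesis using T(2) unfolding maximal_abelian_sub_def abelian_sub_def by blast
  qed
  show "?P \<longleftrightarrow> (\<exists>A. maximal_abelian_sub G A \<and> fin_gen G A)"
  proof
    assume ?P
    then show "\<exists>A. maximal_abelian_sub G A \<and> fin_gen G A"
      using maxab all unfolding maximal_abelian_sub_def abelian_sub_def by blast
  next
    assume "\<exists>A. maximal_abelian_sub G A \<and> fin_gen G A"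
    then obtain A where A0: "maximal_abelian_sub G A" "fin_gen G A" by blast
    have "subgroup A G" "\<And>x y. x \<in> A \<Longrightarrow> y \<in> A \<Longrightarrow> x \<otimes> y = y \<otimes> x"
      "\<And>B. abelian_sub G B \<Longrightarrow> A \<subseteq> B \<Longrightarrow> B = A"
      using A0(1) by (simp_all add: maximal_abelian_sub_def abelian_sub_def)
    note A = this A0(2)
    have Ac: "A \<subseteq> carrier G" by (rule subgroup.subset[OF A(1)])
    have "commutant A \<subseteq> A"
    proof
      fix x assume x: "x \<in> commutant A"
      have "insert x A \<subseteq> commutant {}" "\<And>u v. u \<in> insert x A \<Longrightarrow> v \<in> insert x A \<Longrightarrow> u \<otimes> v = v \<otimes> u"
        using x Ac A(2) by (auto simp: commutant_def)
      then obtain T where T: "insert x A \<subseteq> T" "T \<subseteq> commutant {}" "\<forall>u\<in>T. \<forall>v\<in>T. u \<otimes> v = v \<otimes> u" "commutant ({} \<union> T) = T"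
        using self_centralizing_exists[of "{}" "insert x A"] by auto
      have "T \<subseteq> carrier G" using T(2) by (auto simp: commutant_def)
      then have "abelian_sub G T" using commutant_subgroup[of T] T(3,4) by (simp add: abelian_sub_def)
      then show "x \<in> A" using A(3)[of T] T(1) by blast
    qed
    then show ?P using centralizer_criterion[OF A(1,4)] A noetherian[OF A(1,4) commutant_subgroup[OF Ac]] by blast
  qed
  show "group_max_cond G" if ?P
    unfolding group_max_cond_def
  proof (intro allI impI, elim conjE)
    fix f :: "nat \<Rightarrow> 'a set" assume f: "\<forall>i. subgroup (f i) G" "\<forall>i. f i \<subseteq> f (Suc i)"
    have mono: "f i \<subseteq> f j" if "i \<le> j" for i j using f(2) that by (simp add: lift_Suc_mono_le)
    let ?U = "\<Union>i. f i"
    have "subgroup ?U G"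
    proof
      show "?U \<subseteq> carrier G" using f(1) subgroup.subset by blast
      show "\<one> \<in> ?U" using f(1) subgroup.one_closed by blast
      show "inv x \<in> ?U" if x: "x \<in> ?U" for x
      proof -
        obtain i where "x \<in> f i" using x by blast
        then have "inv x \<in> f i" using f(1) subgroup.m_inv_closed by metis
        then show ?thesis by blast
      qed
      show "x \<otimes> y \<in> ?U" if xy: "x \<in> ?U" "y \<in> ?U" for x y
      proof -
        obtain i j where "x \<in> f i" "y \<in> f j" using xy by blast
        then have "x \<in> f (max i j)" "y \<in> f (max i j)" using mono[of i "max i j"] mono[of j "max i j"] by auto
        then have "x \<otimes> y \<in> f (max i j)" using f(1) subgroup.m_closed by metis
        then show ?thesis by blast
      qed
    qed
    then have "fin_gen G ?U" by (rule all[OF \<open>?P\<close>])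
    then obtain S where S: "finite S" "S \<subseteq> ?U" "generate G S = ?U"
      unfolding fin_gen_def by (elim exE conjE) (rule that)
    have "\<exists>N. S \<subseteq> f N" using S(1,2)
    proof (induction S rule: finite_induct)
      case (insert x S)
      then obtain N i where "S \<subseteq> f N" "x \<in> f i" by auto
      then have "insert x S \<subseteq> f (max N i)" using mono[of N "max N i"] mono[of i "max N i"] by auto
      then show ?case by blast
    qed simp
    then obtain N where N: "S \<subseteq> f N" by blast
    have U: "?U \<subseteq> f N" using generate_subgroup_incl[OF N] f(1) S(3) by blast
    have "f m = f N" if "m \<ge> N" for m using mono[OF that] U by blast
    then show "\<exists>N. \<forall>m\<ge>N. f m = f N" by blast
  qed
qed
end

section \<open>Transfer to additive notation\<close>

context group
begin
lemma hom_props: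
  fixes \<Phi> :: "'a \<Rightarrow> 'g::group_add"
  assumes hom: "\<And>x y. x \<in> carrier G \<Longrightarrow> y \<in> carrier G \<Longrightarrow> \<Phi> (x \<otimes> y) = \<Phi> x + \<Phi> y"
  shows "\<Phi> \<one> = 0" "x \<in> carrier G \<Longrightarrow> \<Phi> (inv x) = - \<Phi> x"
proof -
  have "\<Phi> \<one> + \<Phi> \<one> = \<Phi> \<one> + 0" using hom[of \<one> \<one>] by simp
  then show 1: "\<Phi> \<one> = 0" by (simp only: add_left_cancel)
  show "\<Phi> (inv x) = - \<Phi> x" if "x \<in> carrier G"
    using hom[of "x" "inv x"] that 1 by (simp add: minus_unique)
qed

lemma generate_image:
  fixes \<Phi> :: "'a \<Rightarrow> 'g::group_add"
  assumes hom: "\<And>x y. x \<in> carrier G \<Longrightarrow> y \<in> carrier G \<Longrightarrow> \<Phi> (x \<otimes> y) = \<Phi> x + \<Phi> y"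
    and S: "S \<subseteq> carrier G"
  shows "\<Phi> ` generate G S = grp_span (\<Phi> ` S)"
proof
  note h = hom_props[of \<Phi>, OF hom]
  have "\<Phi> x \<in> grp_span (\<Phi> ` S)" if "x \<in> generate G S" for x
    using that
  proof (induction rule: generate.induct)
    case one then show ?case by (simp add: h)
  next
    case (incl x) then show ?case by (intro grp_span_in) simp
  next
    case (inv x)
    then have "\<Phi> (inv x) = - \<Phi> x" using S h(2) by blast
    then show ?case using inv by (simp add: grp_span_minus grp_span_in)
  next
    case (eng x y)
    then have "\<Phi> (x \<otimes> y) = \<Phi> x + \<Phi> y" using hom generate_in_carrier[OF S] by blast
    then show ?case using eng by (simp add: grp_span_add)
  qed
  then show "\<Phi> ` generate G S \<subseteq> grp_span (\<Phi> ` S)" by blast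
  have "x \<in> \<Phi> ` generate G S" if "x \<in> grp_span (\<Phi> ` S)" for x
    using that
  proof (induction rule: grp_span.induct)
    case grp_span_0 then show ?case using h(1) generate.one by (metis imageI)
  next
    case (grp_span_in x) then show ?case by (auto intro: generate.incl)
  next
    case (grp_span_minus x)
    then obtain y where y: "y \<in> generate G S" "x = \<Phi> y" by blast
    then have "- x = \<Phi> (inv y)" "inv y \<in> generate G S"
      using h(2) generate_in_carrier[OF S] generate_m_inv_closed[OF S] by auto
    then show ?case by blast
  next
    case (grp_span_add x y)
    then obtain u v where u: "u \<in> generate G S" "x = \<Phi> u" "v \<in> generate G S" "y = \<Phi> v" by blast
    then have "x + y = \<Phi> (u \<otimes> v)" "u \<otimes> v \<in> generate G S"
      using hom generate_in_carrier[OF S] generate.eng by auto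
    then show ?case by blast
  qed
  then show "grp_span (\<Phi> ` S) \<subseteq> \<Phi> ` generate G S" by blast
qed

lemma fin_gen_image:
  fixes \<Phi> :: "'a \<Rightarrow> 'g::group_add"
  assumes hom: "\<And>x y. x \<in> carrier G \<Longrightarrow> y \<in> carrier G \<Longrightarrow> \<Phi> (x \<otimes> y) = \<Phi> x + \<Phi> y"
    and inj: "inj_on \<Phi> (carrier G)" and H: "subgroup H G"
  shows "fin_gen G H \<longleftrightarrow> fgen (\<Phi> ` H)" "subgrp (\<Phi> ` H)"
proof -
  have Hc: "H \<subseteq> carrier G" by (rule subgroup.subset[OF H])
  have img: "\<Phi> ` generate G S = grp_span (\<Phi> ` S)" if "S \<subseteq> H" for S
    by (rule generate_image[OF hom]) (use that Hc in auto)
  have gH: "generate G H = H"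
    using generate_subgroup_incl[OF order_refl H] by (auto intro: generate.incl)
  show "subgrp (\<Phi> ` H)" using img[OF order_refl] subgrp_grp_span unfolding gH by metis
  show "fin_gen G H \<longleftrightarrow> fgen (\<Phi> ` H)"
  proof
    assume "fin_gen G H"
    then obtain S where "finite S" "S \<subseteq> H" "generate G S = H" unfolding fin_gen_def by blast
    then show "fgen (\<Phi> ` H)" unfolding fgen_def using img by (intro exI[of _ "\<Phi> ` S"]) auto
  next
    assume "fgen (\<Phi> ` H)"
    then obtain T where T: "finite T" "\<Phi> ` H = grp_span T" by (rule fgE)
    then have "T \<subseteq> \<Phi> ` H" using grp_span_sup by blast
    then obtain S where S: "finite S" "S \<subseteq> H" "T = \<Phi> ` S" using finite_subset_image[OF T(1)] by metis
    have "\<Phi> ` generate G S = \<Phi> ` H" using img[OF S(2)] S(3) T(2) by simp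
    moreover have "generate G S \<subseteq> H" by (rule generate_subgroup_incl[OF S(2) H])
    ultimately have "generate G S = H" using inj Hc inj_on_image_eq_iff by (metis subset_trans)
    then show "fin_gen G H" unfolding fin_gen_def using S by blast
  qed
qed
end

section \<open>The multiplication group of a loop on a carrier set\<close>

locale CML_loop =
  fixes Q :: "'a set" and mul e
  assumes CML: "CML Q mul e"
begin
lemma eQ: "e \<in> Q" and mulQ: "x \<in> Q \<Longrightarrow> y \<in> Q \<Longrightarrow> mul x y \<in> Q"
  and e_left: "x \<in> Q \<Longrightarrow> mul e x = x" and e_right: "x \<in> Q \<Longrightarrow> mul x e = x"
  and solve: "a \<in> Q \<Longrightarrow> b \<in> Q \<Longrightarrow> \<exists>!x. x \<in> Q \<and> mul a x = b"
  and commQ: "x \<in> Q \<Longrightarrow> y \<in> Q \<Longrightarrow> mul x y = mul y x"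
  using CML unfolding CML_def loop_def by (simp_all add: Ball_def)

lemma moufang_sq_Q: assumes "x \<in> Q" "y \<in> Q" "z \<in> Q" shows "mul (mul x x) (mul y z) = mul (mul x y) (mul x z)"
proof -
  have "\<forall>x\<in>Q. \<forall>y\<in>Q. \<forall>z\<in>Q. mul (mul x x) (mul y z) = mul (mul x y) (mul x z)"
    using CML unfolding CML_def by (elim conjE)
  from bspec[OF bspec[OF bspec[OF this assms(1)] assms(2)] assms(3)] show ?thesis .
qed

definition r where "r x = (if x \<in> Q then x else e)"

definition tmul where "tmul x y = mul (r x) (r y)"

definition tinv where "tinv x = (THE y. y \<in> Q \<and> mul (r x) y = e)"

lemma rQ: "r x \<in> Q" by (simp add: r_def eQ)

lemma r_id: "x \<in> Q \<Longrightarrow> r x = x" by (simp add: r_def)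

lemma tinv: "tinv x \<in> Q" "mul (r x) (tinv x) = e"
  using theI'[OF solve[OF rQ eQ, of x]] by (auto simp: tinv_def)

lemma cancelQ: "x \<in> Q \<Longrightarrow> y \<in> Q \<Longrightarrow> z \<in> Q \<Longrightarrow> mul x y = mul x z \<Longrightarrow> y = z"
  using solve[of x "mul x y"] mulQ by metis

text \<open>The inverse property comes from two instances of the defining law: with \<open>e\<close>
  as last factor it gives left alternativity, and with \<open>x'\<close> it gives
  \<open>(x x)(x' z) = (x x')(x z) = x z\<close>. Cancelling \<open>x\<close> finishes the
  proof.\<close>

lemma left_inv_Q: assumes "x \<in> Q" "x' \<in> Q" "mul x x' = e" "z \<in> Q" shows "mul x' (mul x z) = z"
proof -
  have *: "mul x (mul x' z) = z" if x: "x \<in> Q" "x' \<in> Q" "mul x x' = e" "z \<in> Q" for x x' z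
  proof -
    have lalt: "mul (mul x x) y = mul x (mul x y)" if "y \<in> Q" for y
      using moufang_sq_Q[OF x(1) that eQ] x(1) that by (simp add: e_right mulQ commQ)
    have "mul x (mul x (mul x' z)) = mul (mul x x') (mul x z)"
      using lalt[of "mul x' z"] moufang_sq_Q[OF x(1,2,4)] x mulQ by simp
    then have "mul x (mul x (mul x' z)) = mul x z" using x mulQ by (simp add: e_left)
    then show ?thesis using cancelQ[OF x(1)] x mulQ by simp
  qed
  show ?thesis by (rule *) (use assms commQ in auto)
qed

sublocale cml tmul tinv e
proof
  fix x y z
  have tmul: "r (tmul x y) = tmul x y" "r e = e" "r (tinv x) = tinv x" "r (r x) = r x" for x y
    using rQ mulQ eQ tinv by (auto simp: r_id tmul_def)
  show "tmul x y = tmul y x" by (simp add: tmul_def commQ rQ)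
  show "tmul (tmul x x) (tmul y z) = tmul (tmul x y) (tmul x z)"
    using moufang_sq_Q[OF rQ rQ rQ, of x y z] tmul(1) by (simp add: tmul_def)
  show "tmul (tinv x) (tmul x y) = tmul e y"
    using left_inv_Q[OF rQ tinv(1) tinv(2) rQ, of x y] tmul by (simp add: tmul_def e_left rQ)
  show "tmul e (tmul x y) = tmul x y" using tmul(1,2) by (simp add: tmul_def e_left rQ mulQ)
  show "tmul (tmul e x) y = tmul x y" using tmul by (simp add: tmul_def e_left rQ)
  show "tinv (tmul e x) = tinv x" using tmul by (simp add: tinv_def tmul_def e_left rQ)
  show "tmul e (tinv x) = tinv x" using tmul tinv by (simp add: tmul_def e_left)
  show "tmul e e = e" by (simp add: tmul_def r_def eQ e_left)
qed

lemma tmul_e: "tmul e x = r x" by (simp add: tmul_def r_id[OF eQ] e_left rQ)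

lemma car: "tmul e x = x \<longleftrightarrow> x \<in> Q" unfolding tmul_e by (metis r_id rQ)

lemma subloop_iff: "subloop S Q mul e \<longleftrightarrow> S \<subseteq> Q \<and> e \<in> S \<and> (\<forall>x\<in>S. tinv x \<in> S) \<and> (\<forall>x\<in>S. \<forall>y\<in>S. mul x y \<in> S)"
proof -
  have l: "ldiv Q mul a b = mul (tinv a) b" and rd: "rdiv Q mul b a = mul (tinv a) b" if ab: "a \<in> Q" "b \<in> Q" for a b
  proof -
    have 1: "mul a (mul (tinv a) b) = b"
      using left_inv'[of a b] ab tinv(1) mulQ by (simp add: tmul_def r_id e_left eQ)
    have 2: "mul (tinv a) b \<in> Q" using ab tinv(1) mulQ by blast
    show "ldiv Q mul a b = mul (tinv a) b" unfolding ldiv_def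
      by (rule the1_equality[OF solve[OF ab]]) (use 1 2 in blast)
    have "rdiv Q mul b a = ldiv Q mul a b" unfolding ldiv_def rdiv_def
      by (rule arg_cong[of _ _ The]) (use commQ ab(1) in \<open>auto simp: fun_eq_iff\<close>)
    then show "rdiv Q mul b a = mul (tinv a) b" using \<open>ldiv Q mul a b = mul (tinv a) b\<close> by simp
  qed
  show ?thesis
  proof
    assume S: "subloop S Q mul e"
    have "tinv x \<in> S" if "x \<in> S" for x
    proof -
      have x: "x \<in> Q" using S that by (auto simp: subloop_def)
      have "ldiv Q mul x e \<in> S" using S that by (simp add: subloop_def)
      then show ?thesis using l[OF x eQ] tinv(1) by (simp add: e_right)
    qed
    then show "S \<subseteq> Q \<and> e \<in> S \<and> (\<forall>x\<in>S. tinv x \<in> S) \<and> (\<forall>x\<in>S. \<forall>y\<in>S. mul x y \<in> S)"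
      using S by (simp add: subloop_def)
  next
    assume S: "S \<subseteq> Q \<and> e \<in> S \<and> (\<forall>x\<in>S. tinv x \<in> S) \<and> (\<forall>x\<in>S. \<forall>y\<in>S. mul x y \<in> S)"
    then show "subloop S Q mul e" using l rd unfolding subloop_def by (simp add: subset_eq)
  qed
qed

lemma gen_subloop: "subloop (gen S) Q mul e"
  unfolding subloop_iff
proof (intro conjI ballI)
  show sub: "gen S \<subseteq> Q" using gen_el car by blast
  show "e \<in> gen S" by (rule gen_e)
  show "tinv x \<in> gen S" if "x \<in> gen S" for x using that by (rule gen_iv)
  show "mul x y \<in> gen S" if "x \<in> gen S" "y \<in> gen S" for x y
    using gen_mul[OF that] sub that by (simp add: tmul_def r_id subset_eq)
qed

text \<open>Elements of \<open>Bij Q\<close> are extensional, with the value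
  \<open>undefined\<close> outside \<open>Q\<close>; completing them by the identity makes them
  permutations of the type.\<close>

definition \<Phi> :: "('a \<Rightarrow> 'a) \<Rightarrow> 'a bijection" where "\<Phi> f = Abs_bijection (\<lambda>x. if x \<in> Q then f x else x)"

abbreviation MG where "MG \<equiv> mult_group Q mul"

lemma app_Phi: assumes "f \<in> Bij Q" shows "app (\<Phi> f) x = (if x \<in> Q then f x else x)"
proof -
  have b: "bij_betw f Q Q" using assms by (simp add: Bij_def)
  have "bij (\<lambda>x. if x \<in> Q then f x else x)"
    using bij_betw_disjoint_Un[OF b, of "\<lambda>x. x" "- Q" "- Q"] by (simp add: bij_betw_def)
  then show ?thesis by (simp add: \<Phi>_def Abs_bijection_inverse)
qed

lemma Phi_hom: assumes "f \<in> Bij Q" "g \<in> Bij Q" shows "\<Phi> (f \<otimes>\<^bsub>BijGroup Q\<^esub> g) = \<Phi> f + \<Phi> g"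
proof (rule bijection_eqI)
  fix x
  have "f \<otimes>\<^bsub>BijGroup Q\<^esub> g = compose Q f g" using assms by (simp add: BijGroup_def)
  moreover have "g x \<in> Q" if "x \<in> Q" using Bij_imp_funcset[OF assms(2)] that by blast
  ultimately show "app (\<Phi> (f \<otimes>\<^bsub>BijGroup Q\<^esub> g)) x = app (\<Phi> f + \<Phi> g) x"
    using app_Phi[OF compose_Bij[OF assms]] by (simp add: app_Phi assms compose_eq)
qed

lemma Phi_inj: "inj_on \<Phi> (Bij Q)"
proof (rule inj_onI)
  fix f g assume fgen: "f \<in> Bij Q" "g \<in> Bij Q" "\<Phi> f = \<Phi> g"
  then have "f x = g x" if "x \<in> Q" for x using app_Phi[OF fgen(1), of x] app_Phi[OF fgen(2), of x] that by simp
  then show "f = g" using fgen Bij_imp_extensional by (metis extensionalityI)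
qed

lemma Lt_Bij: assumes "x \<in> Q" shows "Lt Q mul x \<in> Bij Q"
proof -
  have "bij_betw (Lt Q mul x) Q Q" unfolding bij_betw_def
  proof
    show "inj_on (Lt Q mul x) Q" using cancelQ[OF assms] by (auto simp: inj_on_def Lt_def)
    show "Lt Q mul x ` Q = Q"
    proof
      show "Lt Q mul x ` Q \<subseteq> Q" using mulQ[OF assms] by (auto simp: Lt_def)
      show "Q \<subseteq> Lt Q mul x ` Q"
      proof
        fix y assume "y \<in> Q"
        then obtain z where "z \<in> Q" "mul x z = y" using solve[OF assms] by blast
        then show "y \<in> Lt Q mul x ` Q" by (intro image_eqI[of _ _ z]) (auto simp: Lt_def)
      qed
    qed
  qed
  then show ?thesis by (simp add: Bij_def Lt_def)
qed

lemma Phi_Lt: "x \<in> Q \<Longrightarrow> \<Phi> (Lt Q mul x) = Lp x"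
  by (rule bijection_eqI) (simp add: app_Phi Lt_Bij app_Lp car, simp add: Lt_def tmul_def r_id)

lemma groupM: "group MG"
  unfolding mult_group_def by (rule group.group_subgroup_generated[OF group_BijGroup])

lemma carrierM: "carrier MG = generate (BijGroup Q) (Lt Q mul ` Q)"
proof -
  have "carrier (BijGroup Q) \<inter> Lt Q mul ` Q = Lt Q mul ` Q" using Lt_Bij by (auto simp: BijGroup_def)
  then show ?thesis by (simp add: mult_group_def carrier_subgroup_generated)
qed

lemma carrierM_Bij: "carrier MG \<subseteq> Bij Q"
  unfolding carrierM using group.generate_incl[OF group_BijGroup, of "Lt Q mul ` Q" Q] Lt_Bij
  by (auto simp: BijGroup_def)

lemma Phi_homM: "x \<in> carrier MG \<Longrightarrow> y \<in> carrier MG \<Longrightarrow> \<Phi> (x \<otimes>\<^bsub>MG\<^esub> y) = \<Phi> x + \<Phi> y"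
  using Phi_hom carrierM_Bij unfolding mult_group_def by auto

lemma Phi_injM: "inj_on \<Phi> (carrier MG)"
  by (rule inj_on_subset[OF Phi_inj carrierM_Bij])

lemma Lt_M: "x \<in> Q \<Longrightarrow> Lt Q mul x \<in> carrier MG"
  unfolding carrierM by (intro generate.incl) simp

lemma Phi_M: "\<Phi> ` carrier MG = M"
proof -
  have "\<Phi> ` carrier MG = grp_span (\<Phi> ` Lt Q mul ` Q)"
    unfolding carrierM
    by (rule group.generate_image[OF group_BijGroup]) (use Phi_hom Lt_Bij in \<open>auto simp: BijGroup_def\<close>)
  also have "\<Phi> ` Lt Q mul ` Q = range Lp"
  proof -
    have "Lp x \<in> Lp ` Q" for x using Lp_el[of x] rQ[of x] unfolding tmul_e by (metis imageI)
    moreover have "\<Phi> ` Lt Q mul ` Q = Lp ` Q" by (simp add: image_image Phi_Lt)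
    ultimately show ?thesis by blast
  qed
  finally show ?thesis .
qed

lemma fin_gen_iff: "subgroup H MG \<Longrightarrow> fin_gen MG H \<longleftrightarrow> fgen (\<Phi> ` H)"
  and subgrp_image: "subgroup H MG \<Longrightarrow> subgrp (\<Phi> ` H)"
  using group.fin_gen_image[OF groupM Phi_homM Phi_injM] by blast+

lemma noetherian:
  assumes "subgroup F MG" "fin_gen MG F" "subgroup H MG" "H \<subseteq> F" shows "fin_gen MG H"
proof -
  have "\<Phi> ` F \<subseteq> M" unfolding Phi_M[symmetric] using subgroup.subset[OF assms(1)] by blast
  then show ?thesis
    using subgroup_fgen[of "\<Phi> ` F" "\<Phi> ` H"] subgrp_image[OF assms(3)] assms by (simp add: fin_gen_iff image_mono)
qed

lemma centralizer_criterion: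
  assumes F: "subgroup F MG" "fin_gen MG F" and C: "fin_gen MG (group.commutant MG F)"
    "\<And>x y. x \<in> group.commutant MG F \<Longrightarrow> y \<in> group.commutant MG F \<Longrightarrow> x \<otimes>\<^bsub>MG\<^esub> y = y \<otimes>\<^bsub>MG\<^esub> x"
  shows "fin_gen MG (carrier MG)"
proof -
  interpret MG: group MG by (rule groupM)
  have Fc: "F \<subseteq> carrier MG" by (rule subgroup.subset[OF F(1)])
  have sC: "subgroup (MG.commutant F) MG" by (rule MG.commutant_subgroup[OF Fc])
  have Cc: "MG.commutant F \<subseteq> carrier MG" by (rule subgroup.subset[OF sC])
  have comm_iff: "x \<otimes>\<^bsub>MG\<^esub> y = y \<otimes>\<^bsub>MG\<^esub> x \<longleftrightarrow> \<Phi> x + \<Phi> y = \<Phi> y + \<Phi> x" if "x \<in> carrier MG" "y \<in> carrier MG" for x y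
    using that Phi_homM inj_on_eq_iff[OF Phi_injM, of "x \<otimes>\<^bsub>MG\<^esub> y" "y \<otimes>\<^bsub>MG\<^esub> x"] by simp
  have cjg_iff: "cjg p q = p \<longleftrightarrow> p + q = q + p" for p q :: "'a bijection"
    by (metis add.assoc add_minus_cancel minus_add_cancel)
  have "centralizer (\<Phi> ` F) = \<Phi> ` MG.commutant F"
  proof
    show "centralizer (\<Phi> ` F) \<subseteq> \<Phi> ` MG.commutant F"
    proof
      fix p assume p: "p \<in> centralizer (\<Phi> ` F)"
      then obtain x where x: "x \<in> carrier MG" "p = \<Phi> x" unfolding centralizer_def Phi_M[symmetric] by blast
      then have "x \<in> MG.commutant F" using p Fc comm_iff cjg_iff unfolding centralizer_def MG.commutant_def by blast
      then show "p \<in> \<Phi> ` MG.commutant F" using x by blast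
    qed
    show "\<Phi> ` MG.commutant F \<subseteq> centralizer (\<Phi> ` F)"
    proof
      fix p assume "p \<in> \<Phi> ` MG.commutant F"
      then obtain x where x: "x \<in> MG.commutant F" "p = \<Phi> x" by blast
      then have xc: "x \<in> carrier MG" using Cc by blast
      have "cjg (\<Phi> x) (\<Phi> f) = \<Phi> x" if "f \<in> F" for f
        using x(1) that Fc comm_iff[OF xc] unfolding cjg_iff MG.commutant_def by blast
      moreover have "\<Phi> x \<in> M" unfolding Phi_M[symmetric] using xc by blast
      ultimately show "p \<in> centralizer (\<Phi> ` F)" unfolding centralizer_def x(2) by blast
    qed
  qed
  moreover have "x + y = y + x" if "x \<in> \<Phi> ` MG.commutant F" "y \<in> \<Phi> ` MG.commutant F" for x y
    using that C(2) comm_iff Cc by blast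
  moreover have "\<Phi> ` F \<subseteq> M" unfolding Phi_M[symmetric] using Fc by blast
  ultimately have "fgen M"
    using M_fgen_if_centralizer_fgen[of "\<Phi> ` F"] F C(1) by (simp add: fin_gen_iff sC)
  then show ?thesis using fin_gen_iff[OF MG.subgroup_self] by (simp add: Phi_M)
qed

text \<open>Otherwise, repeatedly adjoining an element outside the subloop generated so far would
  give a strictly ascending chain. Once the loop is generated by a finite \<open>S\<close>,
  \<open>grp_span_gen\<close> passes to its translations.\<close>

lemma loop_max_imp_fgen: assumes "loop_max_cond Q mul e" shows "fin_gen MG (carrier MG)"
proof -
  interpret MG: group MG by (rule groupM)
  have "\<exists>S. finite S \<and> Q \<subseteq> gen S"
  proof (rule ccontr)
    assume "\<nexists>S. finite S \<and> Q \<subseteq> gen S"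
    then have "\<forall>S. finite S \<longrightarrow> (\<exists>x. x \<in> Q \<and> x \<notin> gen S)" by blast
    then obtain ch where ch: "\<And>S. finite S \<Longrightarrow> ch S \<in> Q \<and> ch S \<notin> gen S" by metis
    define F where "F = rec_nat {} (\<lambda>_ S. insert (ch S) S)"
    have F: "F (Suc n) = insert (ch (F n)) (F n)" "finite (F n)" for n
      by (simp add: F_def) (induction n, auto simp: F_def)
    have "gen (F n) \<subseteq> gen (F (Suc n))" for n
    proof
      fix x assume "x \<in> gen (F n)" then show "x \<in> gen (F (Suc n))"
        by (induction rule: gen.induct) (auto intro: gen.intros simp: F(1))
    qed
    then obtain N where N: "\<forall>m\<ge>N. gen (F m) = gen (F N)"
      using assms[unfolded loop_max_cond_def, rule_format, of "\<lambda>n. gen (F n)"] gen_subloop by blast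
    have "tmul e (ch (F N)) \<in> gen (F (Suc N))" by (rule gen_in) (simp add: F(1))
    then have "ch (F N) \<in> gen (F N)" using N[rule_format, of "Suc N"] ch[OF F(2)] car by (metis le_SucI order_refl)
    then show False using ch[OF F(2)] by blast
  qed
  then obtain S where S: "finite S" "Q \<subseteq> gen S" by blast
  have "range Lp \<subseteq> Lp ` gen S"
  proof (rule image_subsetI)
    fix x
    have "r x \<in> gen S" using rQ S(2) by blast
    then show "Lp x \<in> Lp ` gen S" using Lp_el[of x] unfolding tmul_e by (metis imageI)
  qed
  then have "M \<subseteq> grp_span (Lp ` S)" using grp_span_mono grp_span_gen by metis
  moreover have "grp_span (Lp ` S) \<subseteq> M" by (rule grp_span_mono) auto
  ultimately have "grp_span (Lp ` S) = M" by blast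
  then have "fgen M" unfolding fgen_def using S(1) by blast
  then show ?thesis using fin_gen_iff[OF MG.subgroup_self] by (simp add: Phi_M)
qed

text \<open>A subloop can be recovered from the group generated by its translations, as the orbit of
  \<open>e\<close>: the group maps the subloop into itself, and \<open>Lp x\<close> sends
  \<open>e\<close> to \<open>x\<close>. So if the groups become stationary, the subloops do.\<close>

lemma group_max_imp_loop_max: assumes "group_max_cond MG" shows "loop_max_cond Q mul e"
  unfolding loop_max_cond_def
proof (intro allI impI, elim conjE)
  interpret MG: group MG by (rule groupM)
  fix f :: "nat \<Rightarrow> 'a set" assume f: "\<forall>i. subloop (f i) Q mul e" "\<forall>i. f i \<subseteq> f (Suc i)"
  have fQ: "f i \<subseteq> Q" for i using f(1) by (simp add: subloop_def)
  let ?g = "\<lambda>i. generate MG (Lt Q mul ` f i)"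
  have Lf: "Lt Q mul ` f i \<subseteq> carrier MG" for i using Lt_M fQ by blast
  have "\<forall>i. subgroup (?g i) MG" using MG.generate_is_subgroup[OF Lf] by blast
  moreover have "\<forall>i. ?g i \<subseteq> ?g (Suc i)" using MG.mono_generate f(2) by (meson image_mono)
  moreover have "(\<forall>i. subgroup (?g i) MG) \<and> (\<forall>i. ?g i \<subseteq> ?g (Suc i)) \<longrightarrow> (\<exists>N. \<forall>m\<ge>N. ?g m = ?g N)"
    using assms unfolding group_max_cond_def by (rule spec)
  ultimately have "\<exists>N. \<forall>m\<ge>N. ?g m = ?g N" by (simp only: simp_thms)
  then obtain N where N0: "\<forall>m\<ge>N. ?g m = ?g N" ..
  note N = N0[rule_format]
  have stab: "app p ` f i \<subseteq> f i \<and> app (- p) ` f i \<subseteq> f i" if "p \<in> grp_span (Lp ` f i)" for p i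
    using that
  proof (induction rule: grp_span.induct)
    case (grp_span_in p)
    then obtain s where s: "s \<in> f i" "p = Lp s" by blast
    have cl: "tinv x \<in> f i" "mul x y \<in> f i" if "x \<in> f i" "y \<in> f i" for x y
      using f(1) that unfolding subloop_iff by blast+
    have "app (Lp s) x \<in> f i" if "s \<in> f i" "x \<in> f i" for s x
    proof -
      have "s \<in> Q" "x \<in> Q" using that fQ by blast+
      then show ?thesis using cl(2)[OF that] car[of x] by (simp add: app_Lp tmul_def r_id)
    qed
    then show ?case unfolding s(2) Lp_iv[symmetric] using s(1) cl(1) by blast
  next
    case (grp_span_add p q)
    then show ?case unfolding minus_add by (simp add: image_subset_iff del: add_uminus_conv_diff)
  qed (auto simp: minus_zero)
  have "f m = f N" if "m \<ge> N" for m
  proof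
    show "f N \<subseteq> f m" using lift_Suc_mono_le[of f, OF _ that] f(2) by blast
    show "f m \<subseteq> f N"
    proof
      fix x assume x: "x \<in> f m"
      then have xQ: "x \<in> Q" using fQ by blast
      have "Lt Q mul x \<in> ?g m" using x by (intro generate.incl) simp
      then have "Lt Q mul x \<in> ?g N" using N[OF that] by simp
      then have "\<Phi> (Lt Q mul x) \<in> grp_span (\<Phi> ` Lt Q mul ` f N)"
        using group.generate_image[OF groupM Phi_homM Lf] by blast
      moreover have "\<Phi> ` Lt Q mul ` f N = Lp ` f N" using fQ by (auto simp: image_image Phi_Lt subset_eq intro!: image_cong)
      ultimately have "Lp x \<in> grp_span (Lp ` f N)" using Phi_Lt[OF xQ] by simp
      then have "app (Lp x) e \<in> f N" using stab f(1) unfolding subloop_def by blast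
      then show "x \<in> f N" using xQ eQ car[of e] by (simp add: app_Lp tmul_def r_id e_right)
    qed
  qed
  then show "\<exists>N. \<forall>m\<ge>N. f m = f N" by blast
qed
end

theorem theorem2:
  fixes Q :: "'a set" and mul :: "'a \<Rightarrow> 'a \<Rightarrow> 'a" and e :: 'a
  assumes "CML Q mul e"
    and "\<not> associative_loop Q mul"
  defines "M \<equiv> mult_group Q mul"
  shows "(loop_max_cond Q mul e \<longleftrightarrow> fin_gen M (carrier M))
       \<and> (loop_max_cond Q mul e \<longleftrightarrow> group_max_cond M)
       \<and> (loop_max_cond Q mul e \<longleftrightarrow> (\<forall>N. N \<lhd> M \<longrightarrow> fin_gen M N))
       \<and> (loop_max_cond Q mul e \<longleftrightarrow> (\<exists>A. maximal_abelian_sub M A \<and> fin_gen M A))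
       \<and> (\<forall>n::nat. n > 0 \<and> (\<exists>H. nilpotent_class M H n) \<longrightarrow>
            (loop_max_cond Q mul e \<longleftrightarrow> (\<forall>H. nilpotent_class M H n \<longrightarrow> fin_gen M H)))
       \<and> (\<forall>s::nat. s > 0 \<and> (\<exists>H. solvable_class M H s) \<longrightarrow>
            (loop_max_cond Q mul e \<longleftrightarrow> (\<forall>H. solvable_class M H s \<longrightarrow> fin_gen M H)))"
proof -
  interpret CML_loop Q mul e by unfold_locales (rule assms(1))
  interpret MG: fin_group M
  proof (intro fin_group.intro fin_group_axioms.intro)
    show "group M" unfolding M_def by (rule groupM)
    show "fin_gen M (carrier M)" if "subgroup F M" "fin_gen M F" "fin_gen M (group.commutant M F)"
      "\<And>x y. x \<in> group.commutant M F \<Longrightarrow> y \<in> group.commutant M F \<Longrightarrow> x \<otimes>\<^bsub>M\<^esub> y = y \<otimes>\<^bsub>M\<^esub> x" for F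
      using that unfolding M_def by (rule centralizer_criterion)
    show "fin_gen M H" if "subgroup F M" "fin_gen M F" "subgroup H M" "H \<subseteq> F" for F H
      using that unfolding M_def by (rule noetherian)
  qed
  have 1: "loop_max_cond Q mul e = fin_gen M (carrier M)" "loop_max_cond Q mul e = group_max_cond M"
    using loop_max_imp_fgen group_max_imp_loop_max MG.finiteness_conditions(5) unfolding M_def by blast+
  show ?thesis
    using 1 MG.finiteness_conditions(1-4) by metis
qed

end
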